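(* Let $n\ge 3$ and $n_0=\lceil n/2\rceil-1$. The explicit polynomials $\mathbf Z_0(x),\dots,\mathbf Z_{n_0+1}(x)$ and $\mathbf Y_{n_0+1}(x),\dots,\mathbf Y_{n-1}(x)$ given in the context are polynomials of degree $n$ in $\mathbb Q[x]$, independent of the characteristic $p$, with the following property. For every prime $p\ne 2$ with $p>n-2$ there exist bounded continuous functions $\mu^{(p)}_{n_0-1},\mu^{(p)}_{n_0},\mu^{(p)}_{n_0+1}:[0,1)\to\mathbb R_{\ge 0}$ such that the Hilbert–Kunz density function $f=f_{R_{p,n+1}}$ is as follows. (1) If $n\ge 4$ is even, then $$f(x)=\begin{cases}\mathbf Z_i(x), & i\le x<i+1,\ 0\le i\le n_0,\\ \mathbf Z_{n_0+1}(x), & n_0+1\le x<(n_0+2)-\frac{n-2}{2p},\\ \mathbf Z_{n_0+1}(x)+\mu^{(p)}_{n_0-1}(x-n_0-1), & 1-\frac{n-2}{2p}\le x-(n_0+1)<1,\\ \mathbf Y_{n_0+2}(x)+\mu^{(p)}_{n_0+1}(x-n_0-2), & 0\le x-(n_0+2)<\frac{n-2}{2p},\\ \mathbf Y_{n_0+2}(x), & (n_0+2)+\frac{n-2}{2p}\le x<n_0+3,\\ \mathbf Y_i(x), & i\le x<i+1,\ n_0+3\le i<n,\end{cases}$$ and $f(x)=0$ elsewhere. (2) If $n\ge 3$ is odd, then $$f(x)=\begin{cases}\mathbf Z_i(x), & i\le x<i+1,\ 0\le i\le n_0,\\ \mathbf Z_{n_0+1}(x), & n_0+1\le x<(n_0+\frac32)-\frac{n-2}{2p},\\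 \mathbf Y_{n_0+1}(x)+\mu^{(p)}_{n_0}(x-n_0-1), & \frac12-\frac{n-2}{2p}\le x-(n_0+1)<\frac12+\frac{n-2}{2p},\\ \mathbf Y_{n_0+1}(x), & (n_0+1)+\frac12+\frac{n-2}{2p}\le x<n_0+2,\\ \mathbf Y_i(x), & i\le x<i+1,\ n_0+2\le i<n,\end{cases}$$ and $f(x)=0$ elsewhere. Moreover, in this case one also has $f(x)=\mathbf Z_{n_0+1}(x)+\mu^{(p)}_{n_0-1}(x-n_0-1)$ if $\frac12-\frac{n-2}{2p}\le x-(n_0+1)<\frac12$. Moreover, in both cases $f$ is partially symmetric: $f(x)=f(n-x)$ for $0\le x\le \frac{n-2}{2}\left(1-\frac1p\right)$.
   Context: $R_{p,n+1}=k[x_0,\dots,x_{n+1}]/(x_0^2+\cdots+x_{n+1}^2)$ with its standard grading, where $k$ is a perfect field of characteristic $p>2$ and $n\ge 3$; $\mathbf m=(x_0,\dots,x_{n+1})$. Its Hilbert–Kunz density function is $f_{R_{p,n+1}}(x)=\lim_{s\to\infty}\ell\big((R_{p,n+1}/\mathbf m^{[q]})_{\lfloor xq\rfloor}\big)/q^{n}$, $q=p^s$, for $x\in[0,\infty)$, where $\mathbf m^{[q]}$ is the ideal generated by $q$-th powers of elements of $\mathbf m$; it is a compactly supported continuous function. Polynomials: for integers $j\ge 1$ put $L_j=(2j+n)\frac{(j+n-1)\cdots(j+1)}{n!}$. For $0\le i\le n_0+1$ define $\mathbf Z_i\in\mathbb Q[x]$ recursively by $\mathbf Z_0(x)=\frac{2x^n}{n!}$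 and $\mathbf Z_i(x)=\frac{2x^n}{n!}-\sum_{j=1}^{i}L_j\,\mathbf Z_{i-j}(x-j)$. For $n_0+1\le i\le n-1$ define $\mathbf Y_i\in\mathbb Q[x]$ recursively (downwards in $i$) by $\mathbf Y_{n-1}(x)=\frac{2(n-x)^n}{n!}$ and $\mathbf Y_i(x)=\frac{2(n-x)^n}{n!}-\sum_{j=1}^{n-1-i}L_j\,\mathbf Y_{i+j}(x+j)$. *)

theory Defs
  imports
    "HOL-Analysis.Elementary_Metric_Spaces"
    "HOL-Library.Poly_Mapping"
    "HOL-Library.Extended_Nat"
    "HOL-Algebra.Algebraic_Closure_Type"
    "HOL-Algebra.Module"
begin

text \<open>A polynomial is a finitely supported map from exponent vectors to coefficients; an exponent
  vector is itself a finitely supported map from variable indices to exponents.\<close>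

type_synonym 'k mpoly = "(nat \<Rightarrow>\<^sub>0 nat) \<Rightarrow>\<^sub>0 'k"

definition mconst :: "'k::field \<Rightarrow> 'k mpoly" where
  "mconst c = Poly_Mapping.single 0 c"

definition mvar :: "nat \<Rightarrow> 'k::field mpoly" where
  "mvar i = Poly_Mapping.single (Poly_Mapping.single i 1) 1"

definition mdeg :: "(nat \<Rightarrow>\<^sub>0 nat) \<Rightarrow> nat" where
  "mdeg m = (\<Sum>i\<in>Poly_Mapping.keys m. Poly_Mapping.lookup m i)"

text \<open>The ring $k[x_0,\dots,x_{N-1}]$ in $N$ variables.\<close>

definition mpoly_ring :: "nat \<Rightarrow> 'k::field mpoly ring" where
  "mpoly_ring N = ring_of_type_algebra\<lparr>carrier := {P. \<forall>m\<in>Poly_Mapping.keys P. Poly_Mapping.keys m \<subseteq> {..<N}}\<rparr>"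

definition homogeneous_polys :: "nat \<Rightarrow> nat \<Rightarrow> 'k::field mpoly set" where
  "homogeneous_polys N d = {P \<in> carrier (mpoly_ring N). \<forall>m\<in>Poly_Mapping.keys P. mdeg m = d}"


text \<open>The quadric ring $k[x_0,\dots,x_{n+1}]/(x_0^2+\cdots+x_{n+1}^2)$; there are $n+2$ variables
  and the Krull dimension is $n+1$.\<close>

definition quadric_ideal :: "nat \<Rightarrow> 'k::field mpoly set" where
  "quadric_ideal n = Idl\<^bsub>mpoly_ring (n + 2)\<^esub> {\<Sum>i\<le>n + 1. mvar i ^ 2}"

definition quadric_ring :: "nat \<Rightarrow> 'k::field mpoly set ring" where
  "quadric_ring n = mpoly_ring (n + 2) Quot quadric_ideal n"

definition quadric_class :: "nat \<Rightarrow> 'k::field mpoly \<Rightarrow> 'k mpoly set" where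
  "quadric_class n P = quadric_ideal n +>\<^bsub>mpoly_ring (n + 2)\<^esub> P"

definition max_ideal :: "nat \<Rightarrow> 'k::field mpoly set set" where
  "max_ideal n = Idl\<^bsub>quadric_ring n\<^esub> ((\<lambda>i. quadric_class n (mvar i)) ` {..n + 1})"

definition frobenius_power :: "('a, 'b) ring_scheme \<Rightarrow> 'a set \<Rightarrow> nat \<Rightarrow> 'a set" where
  "frobenius_power R I q = Idl\<^bsub>R\<^esub> ((\<lambda>a. a [^]\<^bsub>R\<^esub> q) ` I)"

definition frobenius_quotient :: "nat \<Rightarrow> nat \<Rightarrow> 'k::field mpoly set set ring" where
  "frobenius_quotient n q = quadric_ring n Quot frobenius_power (quadric_ring n) (max_ideal n) q"

definition frobenius_class :: "nat \<Rightarrow> nat \<Rightarrow> 'k::field mpoly \<Rightarrow> 'k mpoly set set" where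
  "frobenius_class n q P =
     frobenius_power (quadric_ring n) (max_ideal n) q +>\<^bsub>quadric_ring n\<^esub> quadric_class n P"

text \<open>The degree $d$ component of $R/\mathbf m^{[q]}$ as a module over $k$. The record type forces
  the fields \<open>mult\<close> and \<open>one\<close> to be present, but they play no role in the module structure.\<close>

definition frobenius_component ::
    "nat \<Rightarrow> nat \<Rightarrow> nat \<Rightarrow> ('k::field, 'k mpoly set set) module" where
  "frobenius_component n q d =
     \<lparr>carrier = frobenius_class n q ` homogeneous_polys (n + 2) d,
      monoid.mult = monoid.mult (frobenius_quotient n q),
      monoid.one = monoid.one (frobenius_quotient n q),
      ring.zero = ring.zero (frobenius_quotient n q),
      ring.add = ring.add (frobenius_quotient n q),
      module.smult = (\<lambda>c v. monoid.mult (frobenius_quotient n q) (frobenius_class n q (mconst c)) v)\<rparr>"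


text \<open>Length of a module: the supremum of the lengths of strict chains of submodules.\<close>

definition module_length :: "('a, 'c) ring_scheme \<Rightarrow> ('a, 'b, 'd) module_scheme \<Rightarrow> enat" where
  "module_length K M =
     (SUP r \<in> {r. \<exists>N. (\<forall>i\<le>r. submodule (N i) K M) \<and> (\<forall>i<r. N i \<subset> N (Suc i))}. enat r)"

text \<open>The normalised length of the component of $R/\mathbf m^{[q]}$ in degree
  $\lfloor xq\rfloor$, for $x \ge 0$. The length is finite because the component is a quotient of
  the finite-dimensional space of forms of that degree.\<close>

definition hk_function :: "'k::field itself \<Rightarrow> nat \<Rightarrow> nat \<Rightarrow> real \<Rightarrow> real" where
  "hk_function _ n q x =
     real (the_enat (module_length (ring_of_type_algebra :: 'k ring)
       (frobenius_component n q (nat \<lfloor>x * real q\<rfloor>)))) / real q ^ n"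

definition hk_density :: "'k::field itself \<Rightarrow> nat \<Rightarrow> real \<Rightarrow> real" where
  "hk_density T n x = lim (\<lambda>s. hk_function T n (CHAR('k) ^ s) x)"

definition perfect_field :: "'k::field itself \<Rightarrow> bool" where
  "perfect_field _ \<longleftrightarrow> CHAR('k) = 0 \<or> surj (\<lambda>a::'k. a ^ CHAR('k))"


definition L :: "nat \<Rightarrow> nat \<Rightarrow> rat" where
  "L n j = of_nat (2 * j + n) * (\<Prod>t = j + 1..j + n - 1. of_nat t) / fact n"

function Z_poly :: "nat \<Rightarrow> nat \<Rightarrow> rat poly" where
  "Z_poly n i = Polynomial.smult (2 / fact n) ([:0, 1:] ^ n)
     - (\<Sum>j = 1..i. Polynomial.smult (L n j) (pcompose (Z_poly n (i - j)) [:- of_nat j, 1:]))"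
  by auto
termination
  by (relation "Wellfounded.measure snd") auto

text \<open>The recursion for $\mathbf Y_i$ runs downwards from $i = n - 1$; for $i \ge n - 1$ the sum is
  empty (truncated subtraction), and only $i \le n - 1$ is meaningful.\<close>

function Y_poly :: "nat \<Rightarrow> nat \<Rightarrow> rat poly" where
  "Y_poly n i = Polynomial.smult (2 / fact n) ([:of_nat n, -1:] ^ n)
     - (\<Sum>j = 1..n - 1 - i. Polynomial.smult (L n j) (pcompose (Y_poly n (i + j)) [:of_nat j, 1:]))"
  by auto
termination
  by (relation "Wellfounded.measure (\<lambda>(n, i). n - i)") auto

declare Z_poly.simps [simp del] Y_poly.simps [simp del]

definition Z :: "nat \<Rightarrow> nat \<Rightarrow> real \<Rightarrow> real" where
  "Z n i x = poly (map_poly of_rat (Z_poly n i)) x"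

definition Y :: "nat \<Rightarrow> nat \<Rightarrow> real \<Rightarrow> real" where
  "Y n i x = poly (map_poly of_rat (Y_poly n i)) x"

end

theory Submission
  imports Defs "HOL-Library.Function_Algebras" "HOL-Library.Product_Plus" "HOL-Computational_Algebra.Computational_Algebra"
begin

text \<open>
  Let \<open>S = k[x\<^sub>0, ..., x\<^bsub>N-1\<^esub>]\<close> with \<open>N = n + 2\<close>, let \<open>Q\<close> be the sum of the squares of the variables, and write
  \<open>A\<close> for \<open>S / (x\<^sub>i\<^sup>q)\<close>, a complete intersection with socle in degree \<open>\<sigma> = N (q - 1)\<close>. The length in
  question is the dimension \<open>h(d)\<close> of the degree \<open>d\<close> part of \<open>A / Q A\<close> (\<open>hdim\<close>, identified with the
  module length in \<open>module_length_component\<close>). Everything is elementary linear algebra on \<open>A\<close>.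

  Pairing into the socle shows that \<open>Q\<^sup>e\<close> has the same rank on \<open>A\<^sub>d\<close> and on the complementary
  degree (\<open>rk_duality\<close>). For \<open>e = 1\<close> this gives \<open>h(d) = dim A\<^sub>d - dim A\<^bsub>d-2\<^esub> + h(\<sigma> - d + 2)\<close>. As
  \<open>Q\<^sup>q = 0\<close> in \<open>A\<close>, the rank of \<open>Q\<^bsup>q-1\<^esup>\<close> on \<open>A\<^sub>d\<close> is at most \<open>h(d)\<close>, with equality when everything killed by
  \<open>Q\<^bsup>q-1\<^esup>\<close> is a multiple of \<open>Q\<close>. This holds outside a range of middle degrees:
  \<open>hdim_high\<close> above it and \<open>hdim_low\<close> below it. Since the rank of \<open>Q\<^bsup>q-1\<^esup>\<close> is symmetric about
  \<open>n (q - 1) / 2\<close>, it follows that \<open>h\<close> is symmetric about the same point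
  far from the middle, and combining the two reflections \<open>h(d) = dim A\<^sub>d - dim A\<^bsub>d-2\<^esub> + h(d - 2 q)\<close>
  for small \<open>d\<close>. The solution of this recursion is the function \<open>free_dim\<close>, whose generating function is
  \<open>\<Lambda>(t) / \<Lambda>(t\<^sup>q)\<close>, where \<open>\<Lambda>(t) = (1 - t\<^sup>2) / (1 - t)\<^bsup>N\<^esup>\<close> is the generating function of the coefficients \<open>L\<^sub>j\<close>.
  Clearing the denominator gives a recursion with coefficients \<open>L\<^sub>j\<close>, which after division by \<open>q\<^sup>n\<close> tends to
  the one defining the polynomials \<open>Z\<close> (\<open>free_dim_tendsto\<close>). The polynomials \<open>Y\<close> are their mirror images
  (\<open>Y_eq_Z\<close>). In the middle only the inequality between rank and dimension survives, and it yields the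
  nonnegativity of the functions \<open>\<mu>\<close>.

  For the exactness statement one first takes \<open>q = p\<close>. There \<open>A\<close> is a tensor product of modules
  \<open>k[x] / (x\<^sup>p)\<close> with \<open>x\<^sup>2\<close> acting, each the sum of two strings; a Clebsch-Gordan argument valid in characteristic \<open>p\<close> for strings of length
  at most \<open>p\<close> proves it by induction on the number of variables (\<open>lgrade_centred\<close>). The general case follows by
  writing \<open>q = r p\<close> and regarding \<open>S\<close> as a free module over \<open>k[x\<^sub>0\<^sup>r, ..., x\<^bsub>N-1\<^esub>\<^sup>r]\<close>, which contains
  \<open>Q\<^sup>r\<close> (\<open>lefschetz_low\<close>, \<open>lefschetz_high\<close>).

  The limit exists because the normalised dimension is almost decreasing in the exponent \<open>s\<close>
  (\<open>hdim_growth\<close>), and it is Lipschitz continuous because \<open>h(d + 1) - h(d)\<close> is \<open>O(q\<^bsup>n-1\<^esup>)\<close>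
  (\<open>hdim_lipschitz\<close>). Continuity then settles the end points of the intervals.
\<close>

section \<open>Graded modules with a nilpotent operator\<close>

text \<open>The abstract form of multiplication by the quadric on \<open>k[x] / (x\<^sub>i\<^sup>p)\<close>, with degrees shifted so
  that the grading is symmetric about 0.\<close>

locale lower_module = vector_space sc
  for sc :: "'k::field \<Rightarrow> 'v::ab_group_add \<Rightarrow> 'v" +
  fixes p :: nat and M :: "int \<Rightarrow> 'v set" and e :: "'v \<Rightarrow> 'v"
  assumes p: "prime p" "CHAR('k) = p"
    and sub: "subspace (M w)"
    and e_add: "e (x + y) = e x + e y"
    and e_sc: "e (sc c x) = sc c (e x)"
    and e_deg: "x \<in> M w \<Longrightarrow> e x \<in> M (w + 2)"
    and e_nil: "x \<in> M w \<Longrightarrow> (e ^^ p) x = 0"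
begin

lemma of_nat_nz: "0 < l \<Longrightarrow> l < p \<Longrightarrow> (of_nat l :: 'k) \<noteq> 0"
  using p by (auto simp: of_nat_eq_0_iff_char_dvd dest: nat_dvd_not_less)

lemma e_0 [simp]: "e 0 = 0" using e_add[of 0 0] by simp
lemma e_minus: "e (- x) = - e x" using e_add[of x "-x"] by (simp add: minus_unique)
lemma e_diff: "e (x - y) = e x - e y" using e_add[of x "-y"] by (simp add: e_minus)

lemma ek_add: "(e ^^ k) (x + y) = (e ^^ k) x + (e ^^ k) y" by (induction k) (auto simp: e_add)
lemma ek_0 [simp]: "(e ^^ k) 0 = 0" by (induction k) auto
lemma ek_minus: "(e ^^ k) (- x) = - (e ^^ k) x" by (induction k) (auto simp: e_minus)
lemma ek_diff: "(e ^^ k) (x - y) = (e ^^ k) x - (e ^^ k) y" by (induction k) (auto simp: e_diff)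
lemma ek_sc: "(e ^^ k) (sc c x) = sc c ((e ^^ k) x)" by (induction k) (auto simp: e_sc)
lemma ek_e: "(e ^^ k) (e x) = (e ^^ Suc k) x" by (simp add: funpow_swap1)
lemma ek_mono: "(e ^^ k) x = 0 \<Longrightarrow> k \<le> l \<Longrightarrow> (e ^^ l) x = 0"
  by (metis ek_0 funpow_add le_add_diff_inverse2 o_apply)

end

text \<open>Strings of length at most \<open>p\<close> placed symmetrically about weight 0 satisfy such exactness statements. The first clause
  is the one needed for the quadric. The other two concern the weights \<open>1 - l\<close> strictly between the two
  ranges of the first clause; with them the whole property passes to tensor products with strings.\<close>

definition centred :: "nat \<Rightarrow> (int \<Rightarrow> 'v::ab_group_add set) \<Rightarrow> ('v \<Rightarrow> 'v) \<Rightarrow> bool" where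
  "centred p M e \<longleftrightarrow>
    (\<forall>w v. v \<in> M w \<longrightarrow> (e ^^ (p - 1)) v = 0 \<longrightarrow> (w \<ge> 1 \<or> w \<le> - int (p - 1)) \<longrightarrow> v \<in> e ` M (w - 2)) \<and>
    (\<forall>l v. v \<in> M (1 - int l) \<longrightarrow> 1 \<le> l \<longrightarrow> l \<le> p - 1 \<longrightarrow> (e ^^ (p - 1)) v = 0 \<longrightarrow>
       (\<exists>x \<in> M (- 1 - int l). (e ^^ l) (v - e x) = 0)) \<and>
    (\<forall>l v. v \<in> M (1 - int l) \<longrightarrow> 1 \<le> l \<longrightarrow> l \<le> p - 1 \<longrightarrow> (e ^^ (l - 1)) v = 0 \<longrightarrow> v \<in> e ` M (- 1 - int l))"

text \<open>The tensor product with a string of length 2. The operator acts by \<open>e \<otimes> 1 + 1 \<otimes> f\<close>,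
  where \<open>f\<close> maps the lower basis vector of the string to the upper one.\<close>

definition dbl_grade :: "(int \<Rightarrow> 'v set) \<Rightarrow> int \<Rightarrow> ('v \<times> 'v) set" where
  "dbl_grade M w = M (w + 1) \<times> M (w - 1)"

definition dbl_op :: "('v \<Rightarrow> 'v) \<Rightarrow> 'v \<times> 'v \<Rightarrow> 'v \<times> ('v::ab_group_add)" where
  "dbl_op e = (\<lambda>(a, b). (e a, a + e b))"

definition dbl_sc :: "('k \<Rightarrow> 'v \<Rightarrow> 'v) \<Rightarrow> 'k \<Rightarrow> 'v \<times> 'v \<Rightarrow> 'v \<times> 'v" where
  "dbl_sc sc c = (\<lambda>(a, b). (sc c a, sc c b))"

context lower_module begin

lemma dbl_pow: "(dbl_op e ^^ k) (a, b) = ((e ^^ k) a, sc (of_nat k) ((e ^^ (k - 1)) a) + (e ^^ k) b)"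
proof (induction k)
  case (Suc k)
  show ?case
  proof (cases k)
    case (Suc j)
    have "sc 2 x = x + x" for x using scale_left_distrib[of 1 1 x] by simp
    then show ?thesis using Suc.IH Suc
      by (simp add: dbl_op_def e_add e_sc scale_left_distrib algebra_simps)
  qed (simp add: dbl_op_def)
qed simp

text \<open>On the double, the \<open>k\<close>-th power of the operator has the off-diagonal entry \<open>k e\<^bsup>k-1\<^esup>\<close>, and \<open>k\<close> is
  invertible for \<open>0 < k < p\<close>. Each clause for the double thus reduces to a clause for the two
  components, whose weights are shifted by 1 in opposite directions.\<close>

lemma dbl_centred:
  assumes C: "centred p M e" shows "centred p (dbl_grade M) (dbl_op e)"
proof -
  have p2: "p \<ge> 2" using p by (simp add: prime_ge_2_nat)
  note Ca = C[unfolded centred_def, THEN conjunct1, rule_format]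
  note Cb = C[unfolded centred_def, THEN conjunct2, THEN conjunct1, rule_format]
  note Cc = C[unfolded centred_def, THEN conjunct2, THEN conjunct2, rule_format]
  \<comment> \<open>modulo the image every element is represented by one without second component\<close>
  have red: "a - e b \<in> M (w + 1)" "(a, b) = (a - e b, 0) + dbl_op e (b, 0)" "(b, 0) \<in> dbl_grade M (w - 2)"
    if "(a, b) \<in> dbl_grade M w" for a b w
  proof -
    have ab: "a \<in> M (w + 1)" "b \<in> M (w - 1)" using that by (auto simp: dbl_grade_def)
    have "e b \<in> M (w + 1)" using e_deg[OF ab(2)] by (simp add: add.commute)
    then show "a - e b \<in> M (w + 1)" using ab sub by (intro subspace_diff)
    show "(a, b) = (a - e b, 0) + dbl_op e (b, 0)" by (simp add: dbl_op_def)
    show "(b, 0) \<in> dbl_grade M (w - 2)" using ab subspace_0[OF sub] by (simp add: dbl_grade_def)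
  qed
  have im2: "(e (e a), 0) = dbl_op e (e a, - a)" for a
    by (simp add: dbl_op_def e_minus)
  have adds: "dbl_op e (x + y) = dbl_op e x + dbl_op e y" for x y
    by (cases x; cases y) (simp add: dbl_op_def e_add)
  have addg: "x + y \<in> dbl_grade M w" if "x \<in> dbl_grade M w" "y \<in> dbl_grade M w" for x y w
    using that by (auto simp: dbl_grade_def intro: subspace_add[OF sub])
  have addk: "(dbl_op e ^^ k) (x + y) = (dbl_op e ^^ k) x + (dbl_op e ^^ k) y" for x y k
    by (induction k) (auto simp: adds)
  have negs: "dbl_op e (- x) = - dbl_op e x" for x
    by (cases x) (simp add: dbl_op_def e_minus)
  have negk: "(dbl_op e ^^ k) (- x) = - (dbl_op e ^^ k) x" for x k
    by (induction k) (auto simp: negs)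
  have imI: "v \<in> dbl_op e ` dbl_grade M (w - 2)"
    if v: "v = (a, b)" "v \<in> dbl_grade M w" and y: "a - e b = e (e y)" "y \<in> M (w - 3)" for v a b w y
  proof -
    have "v = dbl_op e ((e y, - y) + (b, 0))"
      unfolding adds im2[symmetric] using red(2)[of a b w] v y by simp
    moreover have "(e y, - y) \<in> dbl_grade M (w - 2)" using e_deg[OF y(2)] subspace_neg[OF sub y(2)]
      unfolding dbl_grade_def by (simp add: mem_Times_iff)
    ultimately show ?thesis using addg[OF _ red(3)[of a b w]] v by (metis image_eqI)
  qed
  have ker: "(e ^^ (p - 2)) (a - e b) = 0"
    if v: "(a, b) \<in> dbl_grade M w" "(dbl_op e ^^ (p - 1)) (a, b) = 0" for a b w
  proof -
    have b: "b \<in> M (w - 1)" using v by (simp add: dbl_grade_def)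
    have "0 < p" using p2 by simp
    then have p1: "Suc (p - 1) = p" by simp
    have "(dbl_op e ^^ p) (b, 0) = 0"
    proof -
      have "(of_nat p :: 'k) = 0" using p(2) of_nat_CHAR[where ?'a='k] by simp
      then show ?thesis using e_nil[OF b] by (simp add: dbl_pow zero_prod_def)
    qed
    moreover have "(dbl_op e ^^ (p - 1)) (dbl_op e (b, 0)) = (dbl_op e ^^ p) (b, 0)"
      using p1 by (metis funpow_Suc_right o_apply)
    moreover have "(dbl_op e ^^ (p - 1)) (a, b) =
        (dbl_op e ^^ (p - 1)) (a - e b, 0) + (dbl_op e ^^ (p - 1)) (dbl_op e (b, 0))"
      unfolding addk[symmetric] red(2)[OF v(1), symmetric] ..
    ultimately have "(dbl_op e ^^ (p - 1)) (a - e b, 0) = 0" using v(2) by simp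
    then have "sc (of_nat (p - 1)) ((e ^^ (p - 2)) (a - e b)) = 0"
      unfolding dbl_pow by (simp add: zero_prod_def numeral_2_eq_2)
    then show ?thesis using of_nat_nz[of "p - 1"] p2 by auto
  qed
  have A: "v \<in> dbl_op e ` dbl_grade M (w - 2)"
    if "v \<in> dbl_grade M w" "(dbl_op e ^^ (p - 1)) v = 0" "w \<ge> 1 \<or> w \<le> - int (p - 1)" for w v
  proof -
    obtain a b where v: "v = (a, b)" by (cases v)
    define c where "c = a - e b"
    have vg: "(a, b) \<in> dbl_grade M w" using that v by simp
    have cM: "c \<in> M (w + 1)" using red(1)[OF vg] c_def by simp
    have c0: "(e ^^ (p - 2)) c = 0" using ker[OF vg] that v c_def by simp
    have c1: "(e ^^ (p - 1)) c = 0" by (rule ek_mono[OF c0]) simp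
    have "c \<in> e ` M (w - 1)"
    proof (cases "w = - int (p - 1)")
      case True
      have w: "w + 1 = 1 - int (p - 1)" "w - 1 = - 1 - int (p - 1)" using True by auto
      show ?thesis using Cc[of c "p - 1"] cM c0 p2 unfolding w
        by (simp add: numeral_2_eq_2)
    next
      case False
      then show ?thesis using Ca[of c "w + 1"] cM c1 that(3) by (auto simp: algebra_simps)
    qed
    then obtain y where y: "c = e y" "y \<in> M (w - 1)" by auto
    have y0: "(e ^^ (p - 1)) y = 0"
      using c0 p2 unfolding y ek_e by (simp add: Suc_diff_le numeral_2_eq_2 Suc_diff_Suc)
    have "1 \<le> p - 1" using p2 by simp
    have "\<exists>z \<in> M (w - 3). e y = e (e z)"
    proof (cases "w = 1")
      case True
      obtain x where "x \<in> M (-2)" "(e ^^ 1) (y - e x) = 0" using Cb[of y 1] y y0 True \<open>1 \<le> p - 1\<close> by auto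
      then show ?thesis using True by (intro bexI[of _ x]) (auto simp: e_diff)
    next
      case False
      then have "y \<in> e ` M (w - 1 - 2)" using Ca[of y "w - 1"] y y0 that(3) by auto
      then show ?thesis by auto
    qed
    then show ?thesis using imI[OF v that(1)] y c_def by metis
  qed
  have B: "\<exists>x \<in> dbl_grade M (- 1 - int l). (dbl_op e ^^ l) (v - dbl_op e x) = 0"
    if "v \<in> dbl_grade M (1 - int l)" "(dbl_op e ^^ (p - 1)) v = 0" "1 \<le> l" "l \<le> p - 1" for l v
  proof (cases "l = p - 1")
    case True
    have "0 \<in> dbl_grade M (- 1 - int l)" by (auto simp: dbl_grade_def zero_prod_def subspace_0[OF sub])
    moreover have "dbl_op e 0 = 0" by (simp add: dbl_op_def zero_prod_def)
    ultimately show ?thesis using that True by (intro bexI[of _ 0]) auto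
  next
    case False
    then have lp: "l + 1 \<le> p - 1" "l + 1 < p" using that by auto
    define w where "w = 1 - int l"
    obtain a b where v: "v = (a, b)" by (cases v)
    define c where "c = a - e b"
    have vg: "(a, b) \<in> dbl_grade M w" using that v w_def by simp
    have cM: "c \<in> M (w + 1)" using red(1)[OF vg] c_def by simp
    have c0: "(e ^^ (p - 2)) c = 0" using ker[OF vg] that v c_def by simp
    have c1: "(e ^^ (p - 1)) c = 0" by (rule ek_mono[OF c0]) simp
    have "\<exists>y \<in> M (w - 1). (e ^^ (l - 1)) (c - e y) = 0"
    proof (cases "l = 1")
      case True
      then have "c \<in> e ` M (w + 1 - 2)" using Ca[of c "w + 1"] cM c1 by (auto simp: w_def)
      then show ?thesis using True by auto
    next
      case False
      then have w: "w + 1 = 1 - int (l - 1)" "w - 1 = - 1 - int (l - 1)" using that w_def by auto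
      show ?thesis using Cb[of c "l - 1"] cM c1 False that unfolding w by auto
    qed
    then obtain y where y: "y \<in> M (w - 1)" "(e ^^ (l - 1)) (c - e y) = 0" by auto
    have "(e ^^ (p - 2)) (c - e y) = 0" by (rule ek_mono[OF y(2)]) (use lp in simp)
    then have "(e ^^ (p - 2)) (e y) = 0" using c0 by (simp add: ek_diff)
    then have y0: "(e ^^ (p - 1)) y = 0"
      using p2 unfolding ek_e by (simp add: Suc_diff_le numeral_2_eq_2 Suc_diff_Suc)
    have w: "w - 1 = 1 - int (l + 1)" "w - 3 = - 1 - int (l + 1)" "w - 2 = - 1 - int l" using w_def by auto
    obtain z where z: "z \<in> M (w - 3)" "(e ^^ (l + 1)) (y - e z) = 0"
      using Cb[of y "l + 1"] y y0 lp unfolding w by auto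
    define u where "u = y - e z"
    have uM: "u \<in> M (w - 1)" using e_deg[OF z(1)] y(1) unfolding u_def by (auto intro: subspace_diff[OF sub])
    \<comment> \<open>The block through \<open>u\<close> has length \<open>l + 1\<close>; its shorter offspring is generated by
       \<open>(e u, - l u)\<close>, which is congruent to \<open>(l + 1) (e u, 0)\<close>.\<close>
    define \<alpha> where "\<alpha> = inverse (of_nat (l + 1) :: 'k)"
    have al: "\<alpha> * of_nat l = 1 - \<alpha>" using of_nat_nz[of "l + 1"] lp by (simp add: \<alpha>_def field_simps)
    define x where "x = (b, 0) + (e z, - z) + (sc (\<alpha> * of_nat l) u, 0)"
    have "x \<in> dbl_grade M (w - 2)" unfolding x_def
      using red(3)[OF vg] z(1) e_deg[OF z(1)] subspace_neg[OF sub z(1)] subspace_scale[OF sub uM] subspace_0[OF sub]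
      by (intro addg) (simp_all add: dbl_grade_def)
    moreover have "v - dbl_op e x = (c - e y, 0) + (sc \<alpha> (e u), - sc (\<alpha> * of_nat l) u)"
      unfolding v x_def adds
      by (simp add: dbl_op_def c_def u_def e_minus e_sc e_diff al scale_left_diff_distrib scale_right_diff_distrib)
    moreover have "(dbl_op e ^^ l) (c - e y, 0) = 0"
      using y(2) ek_mono[OF y(2), of l] unfolding dbl_pow by (auto simp: zero_prod_def)
    moreover have "(dbl_op e ^^ l) (sc \<alpha> (e u), - sc (\<alpha> * of_nat l) u) = 0"
    proof -
      have "(e ^^ l) (e u) = 0" using z(2) unfolding ek_e u_def by simp
      moreover have "(e ^^ (l - 1)) (e u) = (e ^^ l) u" using that unfolding ek_e by simp
      ultimately show ?thesis unfolding dbl_pow by (simp add: ek_sc ek_minus zero_prod_def mult.commute)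
    qed
    ultimately have "(dbl_op e ^^ l) (v - dbl_op e x) = 0" by (simp only: addk) simp
    then show ?thesis using \<open>x \<in> _\<close> unfolding w(3)[symmetric] by blast
  qed
  have D: "v \<in> dbl_op e ` dbl_grade M (- 1 - int l)"
    if "v \<in> dbl_grade M (1 - int l)" "(dbl_op e ^^ (l - 1)) v = 0" "1 \<le> l" "l \<le> p - 1" for l v
  proof (cases "l = 1")
    case True
    have "dbl_op e 0 = 0" by (simp add: dbl_op_def zero_prod_def)
    then show ?thesis using True that
      by (auto simp: dbl_grade_def zero_prod_def subspace_0[OF sub] intro!: image_eqI[of _ _ 0])
  next
    case False
    define w where "w = 1 - int l"
    define k where "k = l - 1"
    have k: "l = Suc k" "1 \<le> k" "k < p" "k \<le> p - 1" "k + 1 < p" using False that k_def by auto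
    have kn: "(of_nat k :: 'k) \<noteq> 0" using of_nat_nz k by simp
    obtain a b where v: "v = (a, b)" by (cases v)
    have vg: "(a, b) \<in> dbl_grade M w" using that v w_def by simp
    have ab: "a \<in> M (w + 1)" "b \<in> M (w - 1)" using vg by (auto simp: dbl_grade_def)
    have ka: "(e ^^ k) a = 0" and kb: "(e ^^ k) b = - sc (of_nat k) ((e ^^ (k - 1)) a)"
      using that(2) unfolding v k_def[symmetric] dbl_pow by (auto simp: zero_prod_def eq_neg_iff_add_eq_0 add.commute)
    have deep: "y \<in> e ` M (w - 3)" if y: "y \<in> M (w - 1)" "(e ^^ l) y = 0" for y
    proof (cases "l = p - 1")
      case True
      then have w': "w - 1 = - int (p - 1)" "w - 1 - 2 = w - 3" by (simp_all add: w_def)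
      then show ?thesis using Ca[of y "w - 1"] y True w'(1) unfolding w'(2) by simp
    next
      case False
      have w: "w - 1 = 1 - int (l + 1)" "w - 3 = - 1 - int (l + 1)" using w_def by auto
      show ?thesis using Cc[of y "l + 1"] y False \<open>l \<le> p - 1\<close> unfolding w by auto
    qed
    have "(e ^^ l) b = e ((e ^^ k) b)" using k by simp
    also have "\<dots> = 0" unfolding kb using ka k by (cases k) (auto simp: e_minus e_sc)
    finally obtain z where z: "z \<in> M (w - 3)" "b = e z" using deep[OF ab(2)] by auto
    define c where "c = a + sc (inverse (of_nat k)) (e (e z))"
    have zz: "e (e z) \<in> M (w + 1)" using e_deg[OF e_deg[OF z(1)]] by (simp add: add.commute)
    have cM: "c \<in> M (w + 1)" unfolding c_def by (intro subspace_add subspace_scale sub ab zz)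
    have c0: "(e ^^ (k - 1)) c = 0"
    proof -
      have "(e ^^ (k - 1)) (e (e z)) = (e ^^ k) b" using k z by (simp add: ek_e)
      then show ?thesis unfolding c_def using kn by (simp add: ek_add ek_sc kb)
    qed
    have w: "w + 1 = 1 - int k" "w - 1 = - 1 - int k" using w_def k by auto
    obtain y where y: "c = e y" "y \<in> M (w - 1)" using Cc[of c k] cM c0 k unfolding w by auto
    have "(e ^^ k) y = 0" using c0 k unfolding y ek_e by simp
    then have "(e ^^ l) y = 0" using k by simp
    then obtain y' where y': "y' \<in> M (w - 3)" "y = e y'" using deep[OF y(2)] by auto
    define t where "t = y' - sc (inverse (of_nat k)) z - z"
    have "a = e (e y') - sc (inverse (of_nat k)) (e (e z))"
      using y(1) unfolding c_def y'(2) eq_diff_eq .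
    then have "a - e b = e (e t)" unfolding t_def z(2) by (simp add: e_diff e_sc)
    moreover have "t \<in> M (w - 3)" unfolding t_def by (intro subspace_diff subspace_scale sub z y')
    ultimately have "v \<in> dbl_op e ` dbl_grade M (w - 2)" using imI[OF v _ _ ] vg v by blast
    then show ?thesis by (simp add: w_def)
  qed
  show ?thesis unfolding centred_def using A B D by blast
qed

end

text \<open>Preimages are found in the larger module and mapped back by the retraction; the inclusion
  preserves the vanishing of powers of the operator.\<close>

lemma centred_retract:
  fixes M :: "int \<Rightarrow> 'v::ab_group_add set" and M' :: "int \<Rightarrow> 'u::ab_group_add set"
  assumes C: "centred p M' e'"
    and i: "\<And>w v. v \<in> M w \<Longrightarrow> i v \<in> M' w" "i 0 = 0" "\<And>w v. v \<in> M w \<Longrightarrow> i (e v) = e' (i v)"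
    and r: "\<And>w v. v \<in> M' w \<Longrightarrow> r v \<in> M w" "\<And>x y. r (x - y) = r x - r y"
      "\<And>w v. v \<in> M' w \<Longrightarrow> r (e' v) = e (r v)"
    and ri: "\<And>w v. v \<in> M w \<Longrightarrow> r (i v) = v"
    and deg: "\<And>w v. v \<in> M w \<Longrightarrow> e v \<in> M (w + 2)" "\<And>w v. v \<in> M' w \<Longrightarrow> e' v \<in> M' (w + 2)"
    and diff: "\<And>w x y. x \<in> M' w \<Longrightarrow> y \<in> M' w \<Longrightarrow> x - y \<in> M' w"
  shows "centred p M e"
proof -
  have degk: "(e ^^ k) v \<in> M (w + 2 * int k)" if "v \<in> M w" for v w k
    using that by (induction k) (auto dest: deg(1) simp: algebra_simps)
  have degk': "(e' ^^ k) v \<in> M' (w + 2 * int k)" if "v \<in> M' w" for v w k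
    using that by (induction k) (auto dest: deg(2) simp: algebra_simps)
  have ik: "i ((e ^^ k) v) = (e' ^^ k) (i v)" if "v \<in> M w" for v w k
    using that by (induction k) (simp_all add: i(3)[OF degk])
  have rk: "r ((e' ^^ k) v) = (e ^^ k) (r v)" if "v \<in> M' w" for v w k
    using that by (induction k) (simp_all add: r(3)[OF degk'])
  have r0: "r 0 = 0" using r(2)[of 0 0] by simp
  have ik0: "(e' ^^ k) (i v) = 0" if "v \<in> M w" "(e ^^ k) v = 0" for v w k
    using ik[OF that(1), of k] that(2) i(2) by simp
  have pull: "v \<in> e ` M w'" if "v \<in> M w" "i v \<in> e' ` M' w'" for v w w'
    using that ri[of v w] r(1,3) by force
  note Ca = C[unfolded centred_def, THEN conjunct1, rule_format]
  note Cb = C[unfolded centred_def, THEN conjunct2, THEN conjunct1, rule_format]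
  note Cc = C[unfolded centred_def, THEN conjunct2, THEN conjunct2, rule_format]
  show ?thesis unfolding centred_def
  proof (intro conjI allI impI)
    fix w v assume a: "v \<in> M w" "(e ^^ (p - 1)) v = 0" "w \<ge> 1 \<or> w \<le> - int (p - 1)"
    show "v \<in> e ` M (w - 2)"
      by (rule pull[OF a(1)], rule Ca[OF i(1)[OF a(1)] ik0[OF a(1,2)] a(3)])
  next
    fix l v assume a: "v \<in> M (1 - int l)" "1 \<le> l" "l \<le> p - 1" "(e ^^ (p - 1)) v = 0"
    obtain x where x: "x \<in> M' (- 1 - int l)" "(e' ^^ l) (i v - e' x) = 0"
      using Cb[OF i(1)[OF a(1)] a(2,3) ik0[OF a(1,4)]] by auto
    have "e' x \<in> M' (1 - int l)" using deg(2)[OF x(1)] by simp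
    then have "i v - e' x \<in> M' (1 - int l)" using i(1)[OF a(1)] diff by blast
    from rk[OF this, of l] have "(e ^^ l) (v - e (r x)) = 0"
      using x(2) r0 ri[OF a(1)] r(3)[OF x(1)] by (simp add: r(2))
    then show "\<exists>x \<in> M (- 1 - int l). (e ^^ l) (v - e x) = 0" using r(1)[OF x(1)] by blast
  next
    fix l v assume a: "v \<in> M (1 - int l)" "1 \<le> l" "l \<le> p - 1" "(e ^^ (l - 1)) v = 0"
    show "v \<in> e ` M (- 1 - int l)"
      by (rule pull[OF a(1)], rule Cc[OF i(1)[OF a(1)] a(2,3) ik0[OF a(1,4)]])
  qed
qed

lemma centred_Times:
  assumes C: "centred p M e" and C': "centred p M' e'"
  shows "centred p (\<lambda>w. M w \<times> M' w) (map_prod e e')"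
proof -
  have pw: "(map_prod e e' ^^ k) (x, y) = ((e ^^ k) x, (e' ^^ k) y)" for k x y
    by (induction k) auto
  note Ca = C[unfolded centred_def, THEN conjunct1, rule_format]
  note Cb = C[unfolded centred_def, THEN conjunct2, THEN conjunct1, rule_format]
  note Cc = C[unfolded centred_def, THEN conjunct2, THEN conjunct2, rule_format]
  note Ca' = C'[unfolded centred_def, THEN conjunct1, rule_format]
  note Cb' = C'[unfolded centred_def, THEN conjunct2, THEN conjunct1, rule_format]
  note Cc' = C'[unfolded centred_def, THEN conjunct2, THEN conjunct2, rule_format]
  have im: "(x, y) \<in> map_prod e e' ` (A \<times> B)" if "x \<in> e ` A" "y \<in> e' ` B" for x y A B
    using that by auto
  show ?thesis unfolding centred_def
  proof (intro conjI allI impI)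
    fix w v assume a: "v \<in> M w \<times> M' w" "(map_prod e e' ^^ (p - 1)) v = 0" "w \<ge> 1 \<or> w \<le> - int (p - 1)"
    then show "v \<in> map_prod e e' ` (M (w - 2) \<times> M' (w - 2))"
      by (cases v) (auto simp: pw zero_prod_def intro!: im Ca Ca')
  next
    fix l v assume a: "v \<in> M (1 - int l) \<times> M' (1 - int l)" "1 \<le> l" "l \<le> p - 1" "(map_prod e e' ^^ (p - 1)) v = 0"
    obtain s t where v: "v = (s, t)" by (cases v)
    obtain x where "x \<in> M (- 1 - int l)" "(e ^^ l) (s - e x) = 0"
      using Cb[of s l] a unfolding v pw by (auto simp: zero_prod_def)
    moreover obtain y where "y \<in> M' (- 1 - int l)" "(e' ^^ l) (t - e' y) = 0"
      using Cb'[of t l] a unfolding v pw by (auto simp: zero_prod_def)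
    ultimately show "\<exists>x \<in> M (- 1 - int l) \<times> M' (- 1 - int l). (map_prod e e' ^^ l) (v - map_prod e e' x) = 0"
      unfolding v by (intro bexI[of _ "(x, y)"]) (auto simp: pw zero_prod_def)
  next
    fix l v assume a: "v \<in> M (1 - int l) \<times> M' (1 - int l)" "1 \<le> l" "l \<le> p - 1" "(map_prod e e' ^^ (l - 1)) v = 0"
    then show "v \<in> map_prod e e' ` (M (- 1 - int l) \<times> M' (- 1 - int l))"
      by (cases v) (auto simp: pw zero_prod_def intro!: im Cc Cc')
  qed
qed

text \<open>The tensor product with a string of length \<open>m\<close>, written as \<open>k[t] / (t\<^sup>m)\<close>: the function \<open>F\<close> stands
  for the sum of the \<open>F i t\<^sup>i\<close>, and the operator is \<open>e + t\<close>.\<close>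

definition str_grade :: "(int \<Rightarrow> 'v::ab_group_add set) \<Rightarrow> nat \<Rightarrow> int \<Rightarrow> (nat \<Rightarrow> 'v) set" where
  "str_grade M m w = {F. (\<forall>i<m. F i \<in> M (w + int m - 1 - 2 * int i)) \<and> (\<forall>i\<ge>m. F i = 0)}"

definition str_op :: "('v \<Rightarrow> 'v) \<Rightarrow> nat \<Rightarrow> (nat \<Rightarrow> 'v) \<Rightarrow> nat \<Rightarrow> 'v::ab_group_add" where
  "str_op e m F = (\<lambda>i. if i < m then e (F i) + (if i = 0 then 0 else F (i - 1)) else 0)"

definition str_sc :: "('k \<Rightarrow> 'v \<Rightarrow> 'v) \<Rightarrow> 'k \<Rightarrow> (nat \<Rightarrow> 'v) \<Rightarrow> nat \<Rightarrow> 'v" where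
  "str_sc sc c F = (\<lambda>i. sc c (F i))"

context lower_module begin

lemma str_deg:
  assumes "F \<in> str_grade M m w" shows "str_op e m F \<in> str_grade M m (w + 2)"
proof -
  have "str_op e m F i \<in> M (w + 2 + int m - 1 - 2 * int i)" if i: "i < m" for i
  proof -
    have "e (F i) \<in> M (w + 2 + int m - 1 - 2 * int i)"
      using e_deg[of "F i" "w + int m - 1 - 2 * int i"] assms i by (simp add: str_grade_def algebra_simps)
    moreover have "F (i - 1) \<in> M (w + 2 + int m - 1 - 2 * int i)" if "i \<noteq> 0"
    proof -
      have "F (i - 1) \<in> M (w + int m - 1 - 2 * int (i - 1))" using assms i by (simp add: str_grade_def)
      moreover have "w + int m - 1 - 2 * int (i - 1) = w + 2 + int m - 1 - 2 * int i" using that by simp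
      ultimately show ?thesis by metis
    qed
    ultimately show ?thesis using i by (cases "i = 0") (simp_all add: str_op_def subspace_add[OF sub])
  qed
  then show ?thesis by (simp add: str_grade_def str_op_def)
qed

lemma str_vs: "vector_space (str_sc sc)"
  by unfold_locales (auto simp: str_sc_def fun_eq_iff scale_left_distrib scale_right_distrib)

lemma str_sub: "module.subspace (str_sc sc) (str_grade M m w)"
proof -
  interpret s: vector_space "str_sc sc" by (rule str_vs)
  show ?thesis
    by (rule s.subspaceI)
      (auto simp: str_grade_def str_sc_def subspace_0[OF sub] subspace_add[OF sub] subspace_scale[OF sub])
qed

lemma str_add: "str_op e m (F + G) = str_op e m F + str_op e m G"
  by (auto simp: str_op_def fun_eq_iff e_add)

lemma str_diff: "F \<in> str_grade M m w \<Longrightarrow> G \<in> str_grade M m w \<Longrightarrow> F - G \<in> str_grade M m w"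
  by (auto simp: str_grade_def subspace_diff[OF sub])

lemma str_lm:
  assumes "\<And>w x. x \<in> str_grade M m w \<Longrightarrow> (str_op e m ^^ p) x = 0"
  shows "lower_module (str_sc sc) p (str_grade M m) (str_op e m)"
  by (intro lower_module.intro str_vs lower_module_axioms.intro p str_sub str_add str_deg assms)
    (auto simp: str_op_def str_sc_def fun_eq_iff e_sc scale_right_distrib)

text \<open>Powers of the operator on the retract can be computed in the larger module.\<close>

lemma nil_retract:
  fixes M' :: "int \<Rightarrow> 'u::ab_group_add set"
  assumes nil: "\<And>w x. x \<in> M' w \<Longrightarrow> (e' ^^ p) x = 0" and v: "v \<in> A w"
    and i: "\<And>w v. v \<in> A w \<Longrightarrow> i v \<in> M' w"
    and r0: "r 0 = (0::'z::ab_group_add)" and r: "\<And>w v. v \<in> M' w \<Longrightarrow> r (e' v) = f (r v)"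
    and ri: "\<And>w v. v \<in> A w \<Longrightarrow> r (i v) = v"
    and deg: "\<And>w v. v \<in> M' w \<Longrightarrow> e' v \<in> M' (w + 2)"
  shows "(f ^^ p) v = 0"
proof -
  have degk': "(e' ^^ k) v \<in> M' (w + 2 * int k)" if "v \<in> M' w" for v w k
    using that by (induction k) (auto dest: deg simp: algebra_simps)
  have rk: "r ((e' ^^ k) v) = (f ^^ k) (r v)" if "v \<in> M' w" for v w k
    using that by (induction k) (simp_all add: r[OF degk'])
  show ?thesis using rk[OF i[OF v], of p] nil[OF i[OF v]] r0 ri[OF v] by simp
qed

lemma str_one:
  assumes C: "centred p M e"
  shows "centred p (str_grade M 1) (str_op e 1)" "x \<in> str_grade M 1 w \<Longrightarrow> (str_op e 1 ^^ p) x = 0"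
proof -
  let ?i = "\<lambda>F::nat \<Rightarrow> 'v. F 0" and ?r = "\<lambda>x (i::nat). if i = 0 then x else (0::'v)"
  have 1: "\<And>w v. v \<in> str_grade M 1 w \<Longrightarrow> ?i v \<in> M w" by (simp add: str_grade_def)
  have 2: "\<And>w v. v \<in> str_grade M 1 w \<Longrightarrow> ?i (str_op e 1 v) = e (?i v)" by (simp add: str_op_def)
  have 3: "\<And>w v. v \<in> M w \<Longrightarrow> ?r v \<in> str_grade M 1 w" by (simp add: str_grade_def)
  have 4: "\<And>w v. v \<in> M w \<Longrightarrow> ?r (e v) = str_op e 1 (?r v)" by (auto simp: str_op_def fun_eq_iff)
  have 5: "\<And>w v. v \<in> str_grade M 1 w \<Longrightarrow> ?r (?i v) = v" by (auto simp: str_grade_def fun_eq_iff)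
  show "centred p (str_grade M 1) (str_op e 1)"
    by (rule centred_retract[where i = ?i and r = ?r and M = "str_grade M 1" and M' = M and e = "str_op e 1" and e' = e])
      (fact C 1 2 3 4 5 | simp add: fun_eq_iff str_deg e_deg subspace_diff[OF sub])+
  show "(str_op e 1 ^^ p) x = 0" if "x \<in> str_grade M 1 w"
    by (rule nil_retract[where i = ?i and r = ?r and A = "str_grade M 1" and M' = M and f = "str_op e 1" and e' = e])
      (fact that 1 2 3 4 5 e_nil | simp add: fun_eq_iff str_deg e_deg subspace_diff[OF sub])+
qed

text \<open>The Clebsch-Gordan step: because \<open>m\<close> is invertible modulo \<open>p\<close>, the string of length \<open>m + 1\<close> is a
  direct summand of the tensor product of the strings of lengths \<open>m\<close> and 2.\<close>

lemma str_step:
  assumes C: "centred p (str_grade M m) (str_op e m)" and nil: "\<And>w x. x \<in> str_grade M m w \<Longrightarrow> (str_op e m ^^ p) x = 0"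
    and m: "1 \<le> m" "m < p"
  shows "centred p (str_grade M (Suc m)) (str_op e (Suc m))"
    "x \<in> str_grade M (Suc m) w \<Longrightarrow> (str_op e (Suc m) ^^ p) x = 0"
proof -
  interpret S: lower_module "str_sc sc" p "str_grade M m" "str_op e m" by (rule str_lm[OF nil])
  let ?D = "dbl_grade (str_grade M m)" and ?d = "dbl_op (str_op e m)"
  have mn: "(of_nat m :: 'k) \<noteq> 0" using of_nat_nz m by simp
  define i where "i = (\<lambda>F::nat \<Rightarrow> 'v. (\<lambda>k. if k < m then F k else 0, \<lambda>k. if k < m then sc (of_nat (Suc k)) (F (Suc k)) else 0))"
  define r where "r = (\<lambda>(A, B) k. if k \<le> m then sc (1 - of_nat k / of_nat m) (A k) +
      (if k = 0 then (0::'v) else sc (1 / of_nat m) (B (k - 1))) else 0)"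
  have 1: "i v \<in> ?D w" if "v \<in> str_grade M (Suc m) w" for v w
  proof -
    have "sc (of_nat (Suc k)) (v (Suc k)) \<in> M (w - 1 + int m - 1 - 2 * int k)" if "k < m" for k
    proof -
      have "v (Suc k) \<in> M (w + int (Suc m) - 1 - 2 * int (Suc k))"
        using \<open>v \<in> _\<close> that unfolding str_grade_def by blast
      moreover have "w + int (Suc m) - 1 - 2 * int (Suc k) = w - 1 + int m - 1 - 2 * int k" by simp
      ultimately show ?thesis using subspace_scale[OF sub] by metis
    qed
    then show ?thesis using that by (simp add: i_def dbl_grade_def str_grade_def algebra_simps)
  qed
  have 2: "i (str_op e (Suc m) v) = ?d (i v)" for v
    by (auto simp: i_def dbl_op_def str_op_def fun_eq_iff e_sc e_add scale_right_distrib scale_left_distrib of_nat_diff less_Suc_eq_0_disj algebra_simps)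
  have 3: "r v \<in> str_grade M (Suc m) w" if "v \<in> ?D w" for v w
  proof -
    obtain A B where v: "v = (A, B)" by (cases v)
    have A: "A k \<in> M (w + int (Suc m) - 1 - 2 * int k)" if "k \<le> m" for k
      using \<open>v \<in> _\<close> that subspace_0[OF sub] unfolding v
      by (cases "k = m") (auto simp: dbl_grade_def str_grade_def algebra_simps)
    have B: "B (k - 1) \<in> M (w + int (Suc m) - 1 - 2 * int k)" if "k \<le> m" "k \<noteq> 0" for k
    proof -
      have "B (k - 1) \<in> M (w - 1 + int m - 1 - 2 * int (k - 1))"
      proof -
        have "k - 1 < m" using that by simp
        then show ?thesis using \<open>v \<in> _\<close> unfolding v dbl_grade_def str_grade_def by blast
      qed
      moreover have "w - 1 + int m - 1 - 2 * int (k - 1) = w + int (Suc m) - 1 - 2 * int k" using that by simp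
      ultimately show ?thesis by metis
    qed
    show ?thesis unfolding v r_def str_grade_def
      using A A[of 0] B subspace_0[OF sub] by (auto intro!: subspace_add[OF sub] subspace_scale[OF sub])
  qed
  have 4: "r (?d v) = str_op e (Suc m) (r v)" if "v \<in> ?D w" for v w
  proof -
    obtain A B where v: "v = (A, B)" by (cases v)
    have Am: "A m = 0" using that unfolding v by (simp add: dbl_grade_def str_grade_def)
    show ?thesis
    proof
      fix k
      consider "k = 0" | j where "k = Suc j" "k < m" | j where "k = Suc j" "k = m" | "k > m" by (cases k; force)
      then show "r (?d v) k = str_op e (Suc m) (r v) k"
      proof cases
        case 1
        then show ?thesis using m unfolding v by (simp add: r_def dbl_op_def str_op_def)
      next
        case (2 j)
        have "sc (1 - of_nat k / of_nat m) (A j) + sc (1 / of_nat m) (A j) = sc (1 - of_nat j / of_nat m) (A j)"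
          unfolding 2(1) scale_left_distrib[symmetric] using mn by (simp add: field_simps)
        then have "sc (1 - of_nat k / of_nat m) (A j) + (sc (1 / of_nat m) (A j) + x) = sc (1 - of_nat j / of_nat m) (A j) + x" for x
          by (metis add.assoc)
        then show ?thesis using m 2(2) unfolding v 2(1)
          by (auto simp: r_def dbl_op_def str_op_def e_add e_sc scale_right_distrib add_ac)
      next
        case (3 j)
        have "sc (1 / of_nat m) (A j) = sc (1 - of_nat j / of_nat m) (A j)"
          using mn unfolding 3(2)[unfolded 3(1), symmetric] by (simp add: field_simps)
        then show ?thesis using m mn 3(2) Am unfolding v 3(1)
          by (auto simp: r_def dbl_op_def str_op_def e_add e_sc scale_right_distrib add_ac)
      next
        case 4
        then show ?thesis unfolding v by (simp add: r_def str_op_def dbl_op_def)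
      qed
    qed
  qed
  have 5: "r (i v) = v" if "v \<in> str_grade M (Suc m) w" for v w
  proof
    fix k
    consider "k = 0" | "0 < k" "k < m" | "k = m" "0 < k" | "k > m" by linarith
    then show "r (i v) k = v k"
    proof cases
      case 2
      then have "r (i v) k = sc (1 - of_nat k / of_nat m + (1 / of_nat m) * of_nat k) (v k)"
        unfolding scale_left_distrib by (cases k) (simp_all add: r_def i_def)
      then show ?thesis using mn by (simp add: field_simps)
    next
      case 3
      then show ?thesis using mn by (auto simp: r_def i_def)
    qed (use that m in \<open>auto simp: r_def i_def str_grade_def\<close>)
  qed
  have 6: "r (x - y) = r x - r y" for x y
    by (cases x; cases y) (auto simp: r_def fun_eq_iff scale_right_diff_distrib algebra_simps)
  have 7: "?d v \<in> ?D (w + 2)" if "v \<in> ?D w" for v w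
    using that by (auto simp: dbl_grade_def dbl_op_def intro!: S.subspace_add[OF str_sub] dest: str_deg simp: algebra_simps)
  have 8: "(?d ^^ p) v = 0" if "v \<in> ?D w" for v w
  proof -
    obtain A B where v: "v = (A, B)" by (cases v)
    have "(of_nat p :: 'k) = 0" using p(2) of_nat_CHAR[where ?'a='k] by simp
    then show ?thesis using that nil unfolding v S.dbl_pow
      by (auto simp: dbl_grade_def zero_prod_def str_sc_def fun_eq_iff)
  qed
  have 9: "i 0 = 0" by (simp add: i_def zero_prod_def fun_eq_iff)
  have 10: "x - y \<in> ?D w" if "x \<in> ?D w" "y \<in> ?D w" for x y w
    using that by (auto simp: dbl_grade_def intro: str_diff)
  have 11: "r 0 = 0" by (simp add: r_def zero_prod_def fun_eq_iff)
  show "centred p (str_grade M (Suc m)) (str_op e (Suc m))"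
    by (rule centred_retract[where i = i and r = r and M = "str_grade M (Suc m)" and M' = ?D and e = "str_op e (Suc m)" and e' = ?d])
      (rule S.dbl_centred[OF C] 2 6 9 | erule 1 3 4 5 7 str_deg | erule (1) 10)+
  show "(str_op e (Suc m) ^^ p) x = 0" if "x \<in> str_grade M (Suc m) w"
    by (rule nil_retract[where i = i and r = r and A = "str_grade M (Suc m)" and M' = ?D and f = "str_op e (Suc m)" and e' = ?d])
      (fact that 1 4 5 7 8 11)+
qed

lemma str_centred:
  assumes C: "centred p M e" and m: "1 \<le> m" "m \<le> p"
  shows "centred p (str_grade M m) (str_op e m)"
proof -
  have "centred p (str_grade M m) (str_op e m) \<and> (\<forall>w. \<forall>x \<in> str_grade M m w. (str_op e m ^^ p) x = 0)"
    using m
  proof (induction m rule: nat_induct_at_least)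
    case base
    then show ?case using str_one[OF C] by blast
  next
    case (Suc m)
    then have C: "centred p (str_grade M m) (str_op e m)"
      and nil: "x \<in> str_grade M m w \<Longrightarrow> (str_op e m ^^ p) x = 0" for x w by auto
    show ?case using str_step[OF C] nil Suc.hyps Suc.prems by (metis Suc_le_eq)
  qed
  then show ?thesis ..
qed

end

section \<open>Codimension of subspaces\<close>

locale vspace = vector_space scale
  for scale :: "'a::field \<Rightarrow> 'b::ab_group_add \<Rightarrow> 'b"
begin

definition fin_dim :: "'b set \<Rightarrow> bool" where
  "fin_dim V \<longleftrightarrow> (\<exists>F. finite F \<and> V \<subseteq> span F)"

definition codim :: "'b set \<Rightarrow> 'b set \<Rightarrow> nat" where
  "codim V U = dim V - dim U"

lemma fin_dim_subset: "fin_dim V \<Longrightarrow> U \<subseteq> V \<Longrightarrow> fin_dim U"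
  unfolding fin_dim_def by blast

lemma fin_dim_basis:
  assumes "fin_dim V"
  obtains B where "finite B" "B \<subseteq> V" "independent B" "V \<subseteq> span B" "card B = dim V"
proof -
  obtain F where F: "finite F" "V \<subseteq> span F" using assms fin_dim_def by auto
  obtain B where B: "B \<subseteq> V" "independent B" "V \<subseteq> span B" "card B = dim V" by (rule basis_exists)
  have "finite B" using independent_span_bound[OF F(1) B(2)] B(1) F(2) by auto
  then show ?thesis using B that by blast
qed

lemma codim_basis:
  assumes V: "fin_dim V" and U: "U \<subseteq> V"
  obtains B where "finite B" "B \<subseteq> V" "V \<subseteq> span (B \<union> U)" "card B = codim V U" "dim U \<le> dim V"
proof -
  obtain C where C: "finite C" "C \<subseteq> U" "independent C" "U \<subseteq> span C" "card C = dim U"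
    by (rule fin_dim_basis[OF fin_dim_subset[OF V U]])
  obtain D where D: "C \<subseteq> D" "D \<subseteq> V" "independent D" "V \<subseteq> span D"
    by (rule maximal_independent_subset_extend[OF subset_trans[OF C(2) U] C(3)])
  have dD: "card D = dim V" using basis_card_eq_dim[OF D(2,4,3)] .
  have fD: "finite D"
  proof -
    obtain F where F: "finite F" "V \<subseteq> span F" using V fin_dim_def by auto
    then show ?thesis using independent_span_bound[OF F(1) D(3)] D(2) by auto
  qed
  show ?thesis
  proof (rule that[of "D - C"])
    have "D \<subseteq> (D - C) \<union> U" using C(2) by blast
    then show "V \<subseteq> span ((D - C) \<union> U)" using D(4) span_mono by blast
    show "card (D - C) = codim V U"
      using card_Diff_subset[OF C(1) D(1)] dD C(5) codim_def by simp
    show "dim U \<le> dim V" using card_mono[OF fD D(1)] dD C(5) by simp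
  qed (use fD D in auto)
qed

lemma codim_le:
  assumes "V \<subseteq> span (B \<union> U)" "finite B" "fin_dim U"
  shows "codim V U \<le> card B"
proof -
  obtain C where C: "finite C" "C \<subseteq> U" "independent C" "U \<subseteq> span C" "card C = dim U"
    by (rule fin_dim_basis[OF assms(3)])
  have "B \<union> U \<subseteq> span (B \<union> C)"
    using C(4) span_mono[of C "B \<union> C"] span_superset[of "B \<union> C"] by auto
  then have "V \<subseteq> span (B \<union> C)" using assms(1) span_minimal[OF _ subspace_span] by blast
  then have "dim V \<le> card (B \<union> C)" by (rule dim_le_card) (use assms C in auto)
  also have "\<dots> \<le> card B + dim U" using card_Un_le C(5) by metis
  finally show ?thesis by (simp add: codim_def)
qed

lemma codim_trans:
  assumes "fin_dim V" "U \<subseteq> M" "M \<subseteq> V"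
  shows "codim V U = codim V M + codim M U"
proof -
  have "dim U \<le> dim M" "dim M \<le> dim V"
    using codim_basis assms fin_dim_subset by metis+
  then show ?thesis by (simp add: codim_def)
qed

lemma codim_self [simp]: "codim V V = 0" by (simp add: codim_def)

lemma codim_antimono: "fin_dim V \<Longrightarrow> U \<subseteq> M \<Longrightarrow> M \<subseteq> V \<Longrightarrow> codim V M \<le> codim V U"
  by (simp add: codim_trans[of V U M])

lemma codim_mono: "fin_dim V \<Longrightarrow> U \<subseteq> M \<Longrightarrow> M \<subseteq> V \<Longrightarrow> codim M U \<le> codim V U"
  by (simp add: codim_trans[of V U M])

lemma codim_0_imp:
  assumes "fin_dim V" "U \<subseteq> V" "subspace U" "codim V U = 0"
  shows "V = U"
proof -
  obtain B where B: "finite B" "B \<subseteq> V" "V \<subseteq> span (B \<union> U)" "card B = codim V U"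
    by (rule codim_basis[OF assms(1,2)])
  then have "B = {}" using assms(4) by auto
  then have "V \<subseteq> span U" using B(3) by simp
  then show ?thesis using assms(2,3) span_eq_iff by blast
qed

text \<open>The first isomorphism theorem for the map induced by \<open>f\<close> into the quotient by \<open>U\<close>.\<close>

lemma codim_image:
  assumes V: "fin_dim V" "subspace V" and U: "fin_dim U" "subspace U"
    and f: "\<And>x y. f (x + y) = f x + f y" "\<And>c x. f (scale c x) = scale c (f x)"
  shows "codim {f v + l | v l. v \<in> V \<and> l \<in> U} U = codim V {v \<in> V. f v \<in> U}"
proof -
  let ?W = "{f v + l | v l. v \<in> V \<and> l \<in> U}" and ?K = "{v \<in> V. f v \<in> U}"
  interpret f: module_hom scale scale f
    by unfold_locales (simp_all add: f)
  obtain B where B: "finite B" "B \<subseteq> V" "V \<subseteq> span (B \<union> ?K)" "card B = codim V ?K"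
    by (rule codim_basis[OF V(1) Collect_restrict])
  have "?W \<subseteq> span (f ` B \<union> U)"
  proof
    fix x assume "x \<in> ?W"
    then obtain v l where x: "x = f v + l" "v \<in> V" "l \<in> U" by auto
    have "f v \<in> span (f ` (B \<union> ?K))" using B(3) x(2) unfolding f.span_image by auto
    moreover have "f ` (B \<union> ?K) \<subseteq> f ` B \<union> U" by auto
    ultimately have "f v \<in> span (f ` B \<union> U)" using span_mono by blast
    then show "x \<in> span (f ` B \<union> U)" unfolding x using x(3) by (intro span_add) (auto intro: span_base)
  qed
  then have "codim ?W U \<le> card (f ` B)" by (rule codim_le) (use B U in auto)
  also have "\<dots> \<le> codim V ?K" using card_image_le[OF B(1)] B(4) by metis
  finally have 1: "codim ?W U \<le> codim V ?K" .
  have fW: "fin_dim ?W"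
  proof -
    obtain C where C: "finite C" "U \<subseteq> span C" using U(1) fin_dim_def by auto
    obtain F where F: "finite F" "V \<subseteq> span F" using V(1) fin_dim_def by auto
    have "?W \<subseteq> span (f ` F \<union> C)"
    proof
      fix x assume "x \<in> ?W"
      then obtain v l where x: "x = f v + l" "v \<in> V" "l \<in> U" by auto
      have "f v \<in> span (f ` F)" using F x(2) unfolding f.span_image by auto
      then have "f v \<in> span (f ` F \<union> C)" using span_mono[of "f ` F" "f ` F \<union> C"] by auto
      moreover have "l \<in> span (f ` F \<union> C)" using x C span_mono[of C "f ` F \<union> C"] by auto
      ultimately show "x \<in> span (f ` F \<union> C)" unfolding x by (intro span_add)
    qed
    moreover have "finite (f ` F \<union> C)" using F C by simp
    ultimately show ?thesis unfolding fin_dim_def by (intro exI[of _ "f ` F \<union> C"] conjI)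
  qed
  have LW: "U \<subseteq> ?W" 
  proof
    fix l assume "l \<in> U"
    moreover have "l = f 0 + l" by (simp add: f.zero)
    ultimately show "l \<in> ?W" using subspace_0[OF V(2)] by blast
  qed
  obtain D where D: "finite D" "D \<subseteq> ?W" "?W \<subseteq> span (D \<union> U)" "card D = codim ?W U"
    by (rule codim_basis[OF fW LW])
  have "\<exists>v. v \<in> V \<and> d - f v \<in> U" if "d \<in> D" for d
  proof -
    obtain v l where "d = f v + l" "v \<in> V" "l \<in> U" using D(2) \<open>d \<in> D\<close> by blast
    then show ?thesis by (intro exI[of _ v]) simp
  qed
  then obtain g where g: "\<And>d. d \<in> D \<Longrightarrow> g d \<in> V \<and> d - f (g d) \<in> U" by metis
  have "V \<subseteq> span (g ` D \<union> ?K)"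
  proof
    fix v assume v: "v \<in> V"
    then have "f v + 0 \<in> ?W" using subspace_0[OF U(2)] by blast
    then have "f v \<in> span (D \<union> U)" using D(3) by auto
    moreover have "D \<union> U \<subseteq> span (f ` g ` D \<union> U)"
    proof
      fix x assume "x \<in> D \<union> U"
      moreover have "x \<in> span (f ` g ` D \<union> U)" if "x \<in> D"
      proof -
        have "f (g x) + (x - f (g x)) \<in> span (f ` g ` D \<union> U)"
          using g[OF that] that by (intro span_add span_base) auto
        then show ?thesis by simp
      qed
      ultimately show "x \<in> span (f ` g ` D \<union> U)" using span_base by blast
    qed
    ultimately have "f v \<in> span (f ` g ` D \<union> U)" using span_minimal[OF _ subspace_span] by blast
    then obtain a b where ab: "f v = a + b" "a \<in> span (f ` g ` D)" "b \<in> span U"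
      unfolding span_Un by auto
    then obtain u where u: "u \<in> span (g ` D)" "a = f u" unfolding f.span_image by auto
    have "span (g ` D) \<subseteq> V" using g by (intro span_minimal V) auto
    then have "v - u \<in> ?K" using u ab v span_minimal[OF subset_refl U(2)] V(2) by (auto simp: f.diff subspace_diff)
    then have "u + (v - u) \<in> span (g ` D \<union> ?K)"
      using u span_mono[of "g ` D" "g ` D \<union> ?K"] by (intro span_add) (auto intro: span_base)
    then show "v \<in> span (g ` D \<union> ?K)" by simp
  qed
  then have "codim V ?K \<le> card (g ` D)"
    by (rule codim_le) (use D fin_dim_subset[OF V(1)] in auto)
  also have "\<dots> \<le> codim ?W U" using card_image_le[OF D(1)] D(4) by metis
  finally show ?thesis using 1 by simp
qed

lemma codim_functionals:
  assumes "finite B" "fin_dim V" "subspace V"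
    and f: "\<And>b x y. f b (x + y) = f b x + (f b y :: 'a)" "\<And>b c x. f b (scale c x) = c * f b x"
  shows "codim V {v \<in> V. \<forall>b \<in> B. f b v = 0} \<le> card B"
  using assms(1)
proof (induction B)
  case empty
  then show ?case by simp
next
  case (insert b B)
  let ?U = "{v \<in> V. \<forall>b \<in> B. f b v = 0}" and ?U' = "{v \<in> V. \<forall>b \<in> insert b B. f b v = 0}"
  have diff: "f b (x - y) = f b x - f b y" for b x y
    using f(1)[of b "x - y" y] by (simp add: algebra_simps)
  have zero: "f b 0 = 0" for b using f(1)[of b 0 0] by (metis add_cancel_right_right add_0)
  have "codim ?U ?U' \<le> 1"
  proof (cases "\<exists>u \<in> ?U. f b u \<noteq> 0")
    case True
    then obtain u where u: "u \<in> ?U" "f b u \<noteq> 0" by auto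
    have "?U \<subseteq> span ({u} \<union> ?U')"
    proof
      fix v assume v: "v \<in> ?U"
      define c where "c = f b v / f b u"
      have "v - scale c u \<in> ?U'"
        using u v assms(3) by (auto simp: diff f(2) c_def intro: subspace_diff subspace_scale)
      then have "scale c u + (v - scale c u) \<in> span ({u} \<union> ?U')"
        by (intro span_add span_scale) (auto intro: span_base)
      then show "v \<in> span ({u} \<union> ?U')" by simp
    qed
    then have "codim ?U ?U' \<le> card {u}"
      by (rule codim_le) (auto intro: fin_dim_subset[OF assms(2)])
    then show ?thesis by simp
  next
    case False
    then have "?U = ?U'" by auto
    then show ?thesis by simp
  qed
  moreover have "codim V ?U' = codim V ?U + codim ?U ?U'"
    by (rule codim_trans[OF assms(2)]) auto
  ultimately show ?case using insert by simp
qed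

text \<open>A spanning set of \<open>W\<close> modulo the right radical supplies enough functionals to cut out the left
  radical. Applied in both directions this says that the two radicals have the same codimension.\<close>

lemma codim_bilinear_le:
  assumes V: "fin_dim V" "subspace V" and W: "fin_dim W" "subspace W"
    and b: "\<And>x y z. b (x + y) z = b x z + (b y z :: 'a)" "\<And>c x z. b (scale c x) z = c * b x z"
      "\<And>x y z. b z (x + y) = b z x + b z y" "\<And>c x z. b z (scale c x) = c * b z x"
  shows "codim V {v \<in> V. \<forall>w \<in> W. b v w = 0} \<le> codim W {w \<in> W. \<forall>v \<in> V. b v w = 0}"
proof -
  let ?R = "{w \<in> W. \<forall>v \<in> V. b v w = 0}"
  obtain B where B: "finite B" "B \<subseteq> W" "W \<subseteq> span (B \<union> ?R)" "card B = codim W ?R"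
    by (rule codim_basis[OF W(1) Collect_restrict])
  have zero: "b z 0 = 0" for z using b(3)[of z 0 0] by (metis add_cancel_right_right add_0)
  have "{v \<in> V. \<forall>w \<in> W. b v w = 0} = {v \<in> V. \<forall>w \<in> B. b v w = 0}"
  proof safe
    fix v w assume v: "v \<in> V" "\<forall>w \<in> B. b v w = 0" and w: "w \<in> W"
    have "subspace {w. b v w = 0}" by (auto simp: subspace_def b zero)
    moreover have "B \<union> ?R \<subseteq> {w. b v w = 0}" using v by auto
    ultimately have "span (B \<union> ?R) \<subseteq> {w. b v w = 0}" by (rule span_minimal[rotated])
    then show "b v w = 0" using w B by auto
  qed (use B in auto)
  then show ?thesis
    using codim_functionals[of B V "\<lambda>w v. b v w", OF B(1) V b(1,2)] B(4) by simp
qed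

text \<open>Together with the next lemma: the codimension is the length of a longest chain of subspaces, hence
  the length of the quotient as a module.\<close>

lemma codim_sub_chain:
  assumes V: "fin_dim V" and N: "\<And>i. i \<le> r \<Longrightarrow> subspace (N i) \<and> U \<subseteq> N i \<and> N i \<subseteq> V"
    and strict: "\<And>i. i < r \<Longrightarrow> N i \<subset> N (Suc i)"
  shows "r \<le> codim V U"
proof -
  have "i \<le> codim (N i) U" if "i \<le> r" for i
    using that
  proof (induction i)
    case (Suc i)
    have f: "fin_dim (N (Suc i))" using N[OF Suc.prems] V fin_dim_subset by blast
    have s: "N i \<subset> N (Suc i)" "subspace (N i)" "U \<subseteq> N i" using strict N Suc.prems by auto
    have "codim (N (Suc i)) (N i) \<noteq> 0" using codim_0_imp[OF f _ s(2)] s(1) by auto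
    moreover have "codim (N (Suc i)) U = codim (N (Suc i)) (N i) + codim (N i) U"
      using codim_trans[OF f s(3)] s(1) by auto
    ultimately show ?case using Suc by simp
  qed simp
  then have "r \<le> codim (N r) U" by simp
  also have "\<dots> \<le> codim V U" using N[of r] codim_mono[OF V] by simp
  finally show ?thesis .
qed

lemma codim_sub_chain_exists:
  assumes V: "fin_dim V" "subspace V" and U: "subspace U" "U \<subseteq> V"
  obtains N where "\<And>i. i \<le> codim V U \<Longrightarrow> subspace (N i) \<and> U \<subseteq> N i \<and> N i \<subseteq> V"
    "\<And>i. i < codim V U \<Longrightarrow> N i \<subset> N (Suc i)"
proof -
  obtain B where B: "finite B" "B \<subseteq> V" "V \<subseteq> span (B \<union> U)" "card B = codim V U"
    by (rule codim_basis[OF V(1) U(2)])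
  define r where "r = codim V U"
  obtain e where e: "bij_betw e {0..<r} B"
    using ex_bij_betw_nat_finite[OF B(1)] B(4) r_def by auto
  define N where "N = (\<lambda>i. span (e ` {0..<i} \<union> U))"
  have sub: "N i \<subseteq> V" if "i \<le> r" for i
    unfolding N_def using e that B(2) U(2) by (intro span_minimal V) (auto simp: bij_betw_def)
  have LN: "U \<subseteq> N i" for i unfolding N_def using span_superset by blast
  have mono: "N i \<subseteq> N (Suc i)" for i unfolding N_def by (intro span_mono) auto
  have "N i \<noteq> N (Suc i)" if i: "i < r" for i
  proof
    assume eq: "N i = N (Suc i)"
    have "e i \<in> N i" unfolding eq unfolding N_def by (intro span_base) auto
    have "e ` {0..<i} \<union> U \<subseteq> e ` ({0..<r} - {i}) \<union> U" using i by auto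
    from span_mono[OF this] have ei: "e i \<in> span (e ` ({0..<r} - {i}) \<union> U)"
      using \<open>e i \<in> N i\<close> unfolding N_def by (rule subsetD)
    have "B \<union> U \<subseteq> span (e ` ({0..<r} - {i}) \<union> U)"
    proof
      fix x assume "x \<in> B \<union> U"
      then consider "x = e i" | "x \<in> e ` ({0..<r} - {i}) \<union> U" using e by (auto simp: bij_betw_def)
      then show "x \<in> span (e ` ({0..<r} - {i}) \<union> U)" using ei span_base by cases auto
    qed
    then have "V \<subseteq> span (e ` ({0..<r} - {i}) \<union> U)"
      using B(3) span_minimal[OF _ subspace_span] by blast
    then have "codim V U \<le> card (e ` ({0..<r} - {i}))"
      by (rule codim_le) (auto intro: fin_dim_subset[OF V(1) U(2)])
    also have "\<dots> \<le> card ({0..<r} - {i})" by (rule card_image_le) simp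
    also have "\<dots> < r" using i by simp
    finally show False by (simp add: r_def)
  qed
  then show ?thesis using that[of N] sub LN mono r_def N_def by (metis psubsetI subspace_span)
qed

end

section \<open>Polynomials with prescribed support\<close>

type_synonym expo = "nat \<Rightarrow>\<^sub>0 nat"

lemma lookup_mconst: "Poly_Mapping.lookup (mconst c * P) m = c * Poly_Mapping.lookup P m"
  unfolding mconst_def mult_map_scale_conv_mult[symmetric] by (simp add: Poly_Mapping.map.rep_eq when_def)

lemma mconst_add: "mconst (a + b) = mconst a + mconst b" by (simp add: mconst_def single_add)
lemma mconst_mult: "mconst a * mconst b = mconst (a * b)" by (simp add: mconst_def mult_single)
lemma mconst_1: "mconst 1 = 1" by (simp add: mconst_def)
lemma mconst_0 [simp]: "mconst 0 = 0" by (simp add: mconst_def)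

lemma poly_vspace: "vspace (\<lambda>c (P :: 'k::field mpoly). mconst c * P)"
  by unfold_locales
    (simp_all add: mconst_add mconst_1 distrib_left distrib_right mult.assoc flip: mconst_mult)

interpretation mp: vspace "\<lambda>c (P :: 'k::field mpoly). mconst c * P" by (rule poly_vspace)

definition pdom :: "expo set \<Rightarrow> 'k::field mpoly set" where
  "pdom A = {P. Poly_Mapping.keys P \<subseteq> A}"

lemma pdom_iff: "P \<in> pdom A \<longleftrightarrow> (\<forall>m. m \<notin> A \<longrightarrow> Poly_Mapping.lookup P m = 0)"
  unfolding pdom_def by (auto simp: in_keys_iff)

lemma pdom_sub: "mp.subspace (pdom A)"
  by (rule mp.subspaceI) (auto simp: pdom_iff lookup_add lookup_mconst)

lemma pdom_Int: "pdom A \<inter> pdom B = pdom (A \<inter> B)" by (auto simp: pdom_def)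

lemmas pdom_add = mp.subspace_add[OF pdom_sub] and pdom_diff = mp.subspace_diff[OF pdom_sub]
  and pdom_neg = mp.subspace_neg[OF pdom_sub] and pdom_0 = mp.subspace_0[OF pdom_sub]
  and pdom_scale = mp.subspace_scale[OF pdom_sub] and pdom_sum = mp.subspace_sum[OF pdom_sub]

abbreviation mono :: "expo \<Rightarrow> 'k::field mpoly" where "mono m \<equiv> Poly_Mapping.single m 1"

lemma mono_pdom: "m \<in> A \<Longrightarrow> mono m \<in> pdom A" by (simp add: pdom_def)

lemma mono_mult: "mono m * mono m' = mono (m + m')" by (simp add: mult_single)

lemma poly_expand: "P = (\<Sum>m \<in> Poly_Mapping.keys P. mconst (Poly_Mapping.lookup P m) * mono m)"
proof (rule poly_mapping_eqI)
  fix k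
  show "Poly_Mapping.lookup P k = Poly_Mapping.lookup (\<Sum>m \<in> Poly_Mapping.keys P. mconst (Poly_Mapping.lookup P m) * mono m) k"
    by (simp add: lookup_sum lookup_mconst lookup_single when_def in_keys_iff if_distrib[of "(*) _"] cong: if_cong)
qed

lemma pdom_span: "(pdom A :: 'k::field mpoly set) = mp.span (mono ` A)"
proof
  show "(pdom A :: 'k mpoly set) \<subseteq> mp.span (mono ` A)"
  proof
    fix P :: "'k mpoly" assume "P \<in> pdom A"
    then have "(\<Sum>m \<in> Poly_Mapping.keys P. mconst (Poly_Mapping.lookup P m) * mono m) \<in> mp.span (mono ` A)"
      by (intro mp.span_sum mp.span_scale mp.span_base) (auto simp: pdom_def)
    then show "P \<in> mp.span (mono ` A)" using poly_expand[of P] by simp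
  qed
  show "mp.span (mono ` A) \<subseteq> (pdom A :: 'k mpoly set)"
    by (rule mp.span_minimal[OF _ pdom_sub]) (auto intro: mono_pdom)
qed

text \<open>To check that a linear map sends \<open>pdom A\<close> into a subspace it suffices to look at monomials.\<close>

lemma pdom_induct:
  assumes "P \<in> pdom A" "mp.subspace {P. Q P}" "\<And>m. m \<in> A \<Longrightarrow> Q (mono m)"
  shows "Q P"
proof -
  have "pdom A \<subseteq> {P. Q P}" unfolding pdom_span by (rule mp.span_minimal[OF _ assms(2)]) (use assms(3) in auto)
  then show ?thesis using assms(1) by auto
qed

lemma pdom_fin_dim: "finite A \<Longrightarrow> mp.fin_dim (pdom A)"
  unfolding mp.fin_dim_def pdom_span by (intro exI[of _ "mono ` A"]) auto

lemma mono_inj: "inj_on (mono :: _ \<Rightarrow> 'k::field mpoly) A"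
proof (rule inj_onI)
  fix a b assume "(mono a :: 'k mpoly) = mono b"
  then have "Poly_Mapping.lookup (mono a :: 'k mpoly) a = Poly_Mapping.lookup (mono b :: 'k mpoly) a" by simp
  then show "a = b" by (auto simp: lookup_single when_def split: if_splits)
qed

lemma mono_indep: "mp.independent (mono ` A :: 'k::field mpoly set)"
proof -
  have "mono a \<notin> mp.span (mono ` A - {mono a} :: 'k mpoly set)" for a
  proof
    assume "mono a \<in> mp.span (mono ` A - {mono a} :: 'k mpoly set)"
    moreover have "mono ` A - {mono a} \<subseteq> (mono ` (A - {a}) :: 'k mpoly set)" by auto
    ultimately have "(mono a :: 'k mpoly) \<in> pdom (A - {a})" unfolding pdom_span using mp.span_mono by blast
    then show False by (simp add: pdom_def)
  qed
  then show ?thesis unfolding mp.dependent_def by blast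
qed

lemma dim_pdom: "mp.dim (pdom A :: 'k::field mpoly set) = card A"
proof -
  have "mp.dim (mono ` A :: 'k mpoly set) = card (mono ` A :: 'k mpoly set)"
    by (rule mp.dim_eq_card_independent[OF mono_indep])
  then show ?thesis unfolding pdom_span by (simp add: card_image[OF mono_inj])
qed

lemma codim_pdom: "finite A \<Longrightarrow> B \<subseteq> A \<Longrightarrow> mp.codim (pdom A :: 'k::field mpoly set) (pdom B) = card (A - B)"
  by (simp add: mp.codim_def dim_pdom card_Diff_subset finite_subset)

lemma pdom_mult:
  assumes "P \<in> pdom A" "R \<in> pdom B" "\<And>a b. a \<in> A \<Longrightarrow> b \<in> B \<Longrightarrow> a + b \<in> C"
  shows "P * R \<in> pdom C"
  using assms keys_mult[of P R] unfolding pdom_def by blast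

section \<open>Forms, the quadric and the box ideal\<close>

text \<open>Degrees are integers, so that there are (zero) forms of negative degree and reflections of degrees need
  no side conditions.\<close>

definition mons :: "nat \<Rightarrow> int \<Rightarrow> expo set" where
  "mons N d = {m. Poly_Mapping.keys m \<subseteq> {..<N} \<and> int (mdeg m) = d}"

definition forms :: "nat \<Rightarrow> int \<Rightarrow> 'k::field mpoly set" where
  "forms N d = pdom (mons N d)"

definition big :: "nat \<Rightarrow> expo set" where
  "big q = {m. \<exists>i. q \<le> Poly_Mapping.lookup m i}"

text \<open>The ideal generated by the \<open>q\<close>-th powers of all variables, as the span of its monomials.\<close>

definition bigs :: "nat \<Rightarrow> 'k::field mpoly set" where
  "bigs q = pdom (big q)"

definition quad :: "nat \<Rightarrow> 'k::field mpoly" where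
  "quad N = (\<Sum>i<N. mvar i ^ 2)"

lemma mdeg_eq: "Poly_Mapping.keys m \<subseteq> {..<N} \<Longrightarrow> mdeg m = (\<Sum>i<N. Poly_Mapping.lookup m i)"
  unfolding mdeg_def by (rule sum.mono_neutral_left) (auto simp: in_keys_iff)

lemma mdeg_add: "mdeg (m + m') = mdeg m + mdeg m'"
proof -
  let ?K = "Poly_Mapping.keys m \<union> Poly_Mapping.keys m'"
  have "mdeg x = (\<Sum>i \<in> ?K. Poly_Mapping.lookup x i)" if "Poly_Mapping.keys x \<subseteq> ?K" for x :: expo
    unfolding mdeg_def by (rule sum.mono_neutral_left) (use that in \<open>auto simp: in_keys_iff\<close>)
  then show ?thesis using Poly_Mapping.keys_add[of m m'] by (simp add: lookup_add sum.distrib)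
qed

lemma mdeg_0 [simp]: "mdeg 0 = 0" by (simp add: mdeg_def)
lemma mdeg_single [simp]: "mdeg (Poly_Mapping.single i k) = k" by (simp add: mdeg_def)

lemma keys_expo_add: "Poly_Mapping.keys (m + m' :: expo) = Poly_Mapping.keys m \<union> Poly_Mapping.keys m'"
  by (auto simp: in_keys_iff lookup_add)

lemma mons_add: "a \<in> mons N d \<Longrightarrow> b \<in> mons N e \<Longrightarrow> a + b \<in> mons N (d + e)"
  by (auto simp: mons_def mdeg_add keys_expo_add)

lemma mons_neg: "d < 0 \<Longrightarrow> mons N d = {}" by (auto simp: mons_def)

lemma mons_lookup_le:
  assumes "m \<in> mons N d" shows "int (Poly_Mapping.lookup m i) \<le> d"
proof (cases "i \<in> Poly_Mapping.keys m")
  case True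
  then have "Poly_Mapping.lookup m i \<le> mdeg m" unfolding mdeg_def by (intro member_le_sum) auto
  then show ?thesis using assms by (auto simp: mons_def)
qed (use assms in \<open>auto simp: mons_def in_keys_iff\<close>)

lemma expo_box_finite: "finite {m :: expo. Poly_Mapping.keys m \<subseteq> {..<N} \<and> (\<forall>i. Poly_Mapping.lookup m i \<le> b)}"
proof (rule finite_imageD)
  let ?A = "{m :: expo. Poly_Mapping.keys m \<subseteq> {..<N} \<and> (\<forall>i. Poly_Mapping.lookup m i \<le> b)}"
  have "Poly_Mapping.lookup ` ?A \<subseteq> {f. \<forall>i. (i \<in> {..<N} \<longrightarrow> f i \<in> {..b}) \<and> (i \<notin> {..<N} \<longrightarrow> f i = 0)}"
    by (auto simp: in_keys_iff)
  then show "finite (Poly_Mapping.lookup ` ?A)"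
    by (rule finite_subset) (rule finite_set_of_finite_funs; simp)
  show "inj_on Poly_Mapping.lookup ?A" by (rule inj_onI) (rule poly_mapping_eq_iff[THEN iffD2])
qed

lemma mons_finite: "finite (mons N d)"
proof (rule finite_subset[OF _ expo_box_finite])
  show "mons N d \<subseteq> {m. Poly_Mapping.keys m \<subseteq> {..<N} \<and> (\<forall>i. Poly_Mapping.lookup m i \<le> nat d)}"
  proof
    fix m assume m: "m \<in> mons N d"
    then have "Poly_Mapping.lookup m i \<le> nat d" for i using mons_lookup_le[OF m, of i] by simp
    then show "m \<in> {m. Poly_Mapping.keys m \<subseteq> {..<N} \<and> (\<forall>i. Poly_Mapping.lookup m i \<le> nat d)}"
      using m by (simp add: mons_def)
  qed
qed

lemma forms_sub: "mp.subspace (forms N d)" and forms_fin_dim: "mp.fin_dim (forms N d)"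
  unfolding forms_def by (simp_all add: pdom_sub pdom_fin_dim mons_finite)

lemmas forms_add = mp.subspace_add[OF forms_sub] and forms_diff = mp.subspace_diff[OF forms_sub]
  and forms_0 = mp.subspace_0[OF forms_sub] and forms_sum = mp.subspace_sum[OF forms_sub]
  and forms_neg = mp.subspace_neg[OF forms_sub] and forms_scale = mp.subspace_scale[OF forms_sub]

lemma forms_mult: "P \<in> forms N d \<Longrightarrow> R \<in> forms N e \<Longrightarrow> P * R \<in> forms N (d + e)"
  unfolding forms_def by (rule pdom_mult) (auto intro: mons_add)

lemma forms_neg_deg: "d < 0 \<Longrightarrow> forms N d = {0}"
  unfolding forms_def by (simp add: mons_neg pdom_def)

lemma forms_1: "1 \<in> forms N 0"
  unfolding forms_def by (auto simp: pdom_def mons_def)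

lemma forms_power: "P \<in> forms N d \<Longrightarrow> P ^ k \<in> forms N (int k * d)"
  by (induction k) (auto intro: forms_1 dest: forms_mult simp: algebra_simps)

lemma mvar_forms: "i < N \<Longrightarrow> mvar i \<in> forms N 1"
  unfolding mvar_def forms_def by (rule mono_pdom) (auto simp: mons_def)

lemma quad_forms: "quad N \<in> forms N 2"
  unfolding quad_def using forms_power[OF mvar_forms, of _ N 2] by (intro forms_sum) auto

lemma quad_pow_forms: "quad N ^ k \<in> forms N (2 * int k)"
  using forms_power[OF quad_forms, of N k] by (simp add: mult.commute)

lemma homogeneous_forms: "homogeneous_polys N d = forms N (int d)"
  unfolding homogeneous_polys_def forms_def pdom_def mons_def mpoly_ring_def by auto

lemma big_add: "m \<in> big q \<Longrightarrow> m + m' \<in> big q"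
  unfolding big_def by (auto simp: lookup_add intro: trans_le_add1)

lemma bigs_sub: "mp.subspace (bigs q)" unfolding bigs_def by (rule pdom_sub)

lemmas bigs_add = mp.subspace_add[OF bigs_sub] and bigs_diff = mp.subspace_diff[OF bigs_sub]
  and bigs_0 = mp.subspace_0[OF bigs_sub] and bigs_sum = mp.subspace_sum[OF bigs_sub]
  and bigs_neg = mp.subspace_neg[OF bigs_sub] and bigs_scale = mp.subspace_scale[OF bigs_sub]

lemma bigs_mult: "P \<in> bigs q \<Longrightarrow> P * R \<in> bigs q" "P \<in> bigs q \<Longrightarrow> R * P \<in> bigs q"
proof -
  have "R \<in> pdom UNIV" by (simp add: pdom_def)
  then show "P \<in> bigs q \<Longrightarrow> P * R \<in> bigs q"
    unfolding bigs_def by (rule pdom_mult[rotated]) (auto intro: big_add)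
  then show "P \<in> bigs q \<Longrightarrow> R * P \<in> bigs q" by (simp add: mult.commute)
qed

lemma lookup_mono_mult:
  "Poly_Mapping.lookup (mono m * P) k =
    (if \<forall>i. Poly_Mapping.lookup m i \<le> Poly_Mapping.lookup k i then Poly_Mapping.lookup P (k - m) else 0)"
  (is "_ = ?rhs P")
proof (rule pdom_induct[where P = P and A = UNIV])
  show "P \<in> pdom UNIV" by (simp add: pdom_def)
  show "mp.subspace {P. Poly_Mapping.lookup (mono m * P) k = ?rhs P}"
  proof (rule mp.subspaceI)
    fix c x assume "x \<in> {P. Poly_Mapping.lookup (mono m * P) k = ?rhs P}"
    moreover have "mono m * (mconst c * x) = mconst c * (mono m * x)" by (rule mult.left_commute)
    ultimately show "mconst c * x \<in> {P. Poly_Mapping.lookup (mono m * P) k = ?rhs P}"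
      by (simp add: lookup_mconst \<open>_ = mconst c * (mono m * x)\<close>)
  qed (simp_all add: lookup_add distrib_left)
  fix a :: expo
  have "m + a = k \<longleftrightarrow> (\<forall>i. Poly_Mapping.lookup m i + Poly_Mapping.lookup a i = Poly_Mapping.lookup k i)"
    by (simp add: poly_mapping_eq_iff fun_eq_iff lookup_add)
  also have "\<dots> \<longleftrightarrow> (\<forall>i. Poly_Mapping.lookup m i \<le> Poly_Mapping.lookup k i \<and>
      Poly_Mapping.lookup a i = Poly_Mapping.lookup k i - Poly_Mapping.lookup m i)"
    by (intro iff_allI) auto
  also have "\<dots> \<longleftrightarrow> (\<forall>i. Poly_Mapping.lookup m i \<le> Poly_Mapping.lookup k i) \<and> a = k - m"
    by (auto simp: poly_mapping_eq_iff fun_eq_iff lookup_minus)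
  finally have "m + a = k \<longleftrightarrow> (\<forall>i. Poly_Mapping.lookup m i \<le> Poly_Mapping.lookup k i) \<and> a = k - m" .
  then show "Poly_Mapping.lookup (mono m * mono a) k = ?rhs (mono a)"
    by (auto simp: mono_mult lookup_single when_def)
qed

lemma lookup_mono_mult_add [simp]: "Poly_Mapping.lookup (mono m * P) (m + k) = Poly_Mapping.lookup P k"
proof -
  have "m + k - m = k" by (simp add: poly_mapping_eq_iff fun_eq_iff lookup_add lookup_minus)
  then show ?thesis by (simp add: lookup_mono_mult lookup_add)
qed

lemma mvar_power: "mvar i ^ k = mono (Poly_Mapping.single i k)"
  by (induction k) (simp_all add: mvar_def mult_single flip: single_add)

lemma lookup_quad_mult:
  "Poly_Mapping.lookup (quad N * P) k =
    (\<Sum>i<N. if 2 \<le> Poly_Mapping.lookup k i then Poly_Mapping.lookup P (k - Poly_Mapping.single i 2) else 0)"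
  unfolding quad_def sum_distrib_right lookup_sum mvar_power lookup_mono_mult
  by (intro sum.cong refl) (auto simp: lookup_single when_def)

section \<open>The truncated polynomial ring\<close>

definition restr :: "expo set \<Rightarrow> 'k::field mpoly \<Rightarrow> 'k mpoly" where
  "restr A P = (\<Sum>m \<in> Poly_Mapping.keys P \<inter> A. mconst (Poly_Mapping.lookup P m) * mono m)"

lemma lookup_restr: "Poly_Mapping.lookup (restr A P) m = (if m \<in> A then Poly_Mapping.lookup P m else 0)"
  by (simp add: restr_def lookup_sum lookup_mconst lookup_single when_def in_keys_iff if_distrib[of "(*) _"] cong: if_cong)

text \<open>The representative without large exponents modulo \<open>bigs q\<close>; it serves in place of the
  residue class, so that the truncated ring is a set of polynomials.\<close>

definition cut :: "nat \<Rightarrow> 'k::field mpoly \<Rightarrow> 'k mpoly" where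
  "cut q P = restr (- big q) P"

lemma lookup_cut: "Poly_Mapping.lookup (cut q P) m = (if m \<in> big q then 0 else Poly_Mapping.lookup P m)"
  by (simp add: cut_def lookup_restr)

lemma cut_bigs: "P - cut q P \<in> bigs q"
  by (simp add: bigs_def pdom_iff lookup_minus lookup_cut)

lemma cut_eq_iff: "cut q P = cut q R \<longleftrightarrow> P - R \<in> bigs q"
  by (auto simp: bigs_def pdom_iff lookup_minus lookup_cut poly_mapping_eq_iff fun_eq_iff)

lemma cut_0_iff: "cut q P = 0 \<longleftrightarrow> P \<in> bigs q"
  by (auto simp: bigs_def pdom_iff lookup_cut poly_mapping_eq_iff fun_eq_iff)

lemma char_mpoly: "CHAR('k::field mpoly) = CHAR('k)"
proof (rule CHAR_eqI)
  have z: "(of_nat n :: 'k mpoly) = 0 \<longleftrightarrow> (of_nat n :: 'k) = 0" for n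
  proof
    have "Poly_Mapping.lookup (of_nat n :: 'k mpoly) 0 = of_nat n" by (simp add: lookup_of_nat)
    then show "(of_nat n :: 'k) = 0" if "(of_nat n :: 'k mpoly) = 0" using that by simp
    have "(of_nat n :: 'k mpoly) = Poly_Mapping.single 0 (of_nat n)" by simp
    then show "(of_nat n :: 'k mpoly) = 0" if "(of_nat n :: 'k) = 0" using that by simp
  qed
  show "(of_nat CHAR('k) :: 'k mpoly) = 0" by (simp add: z)
  show "CHAR('k) dvd n" if "(of_nat n :: 'k mpoly) = 0" for n
    using that by (simp add: z of_nat_eq_0_iff_char_dvd)
qed

lemma quad_frobenius:
  assumes "prime p" "CHAR('k::field) = p"
  shows "quad N ^ (p ^ s) = (\<Sum>i<N. mvar i ^ (2 * p ^ s) :: 'k mpoly)"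
  unfolding quad_def power_mult
  by (rule freshmans_dream_sum'[where n = s]) (use assms in \<open>simp_all add: char_mpoly\<close>)

lemma mvar_pow_bigs: "q \<le> k \<Longrightarrow> mvar i ^ k \<in> bigs q"
  unfolding mvar_power bigs_def by (rule mono_pdom) (auto simp: big_def lookup_single intro!: exI[of _ i])

lemma quad_pow_bigs:
  assumes "prime p" "CHAR('k::field) = p"
  shows "(quad N ^ (p ^ s) :: 'k mpoly) \<in> bigs (p ^ s)"
  unfolding quad_frobenius[OF assms] by (intro bigs_sum mvar_pow_bigs) simp

definition lop :: "nat \<Rightarrow> nat \<Rightarrow> 'k::field mpoly \<Rightarrow> 'k mpoly" where
  "lop p N P = cut p (quad N * P)"

text \<open>The truncated ring \<open>k[x] / (x\<^sub>i\<^sup>p)\<close> in \<open>N\<close> variables, with weights measured from half of its socle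
  degree \<open>N (p - 1)\<close>.\<close>

definition lgrade :: "nat \<Rightarrow> nat \<Rightarrow> int \<Rightarrow> 'k::field mpoly set" where
  "lgrade p N w = pdom (mons N (w + int (N * ((p - 1) div 2))) - big p)"

lemma lgrade_forms: "P \<in> lgrade p N w \<Longrightarrow> P \<in> forms N (w + int (N * ((p - 1) div 2)))"
  unfolding lgrade_def forms_def by (auto simp: pdom_def)

lemma cut_lgrade: "P \<in> forms N (w + int (N * ((p - 1) div 2))) \<Longrightarrow> cut p P \<in> lgrade p N w"
  unfolding lgrade_def forms_def by (auto simp: pdom_iff lookup_cut)

lemma lop_pow: "cut p P = P \<Longrightarrow> (lop p N ^^ k) P = cut p (quad N ^ k * P)"
proof (induction k)
  case (Suc k)
  have "quad N ^ Suc k * P - quad N * cut p (quad N ^ k * P) = quad N * (quad N ^ k * P - cut p (quad N ^ k * P))"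
    by (simp add: algebra_simps)
  also have "\<dots> \<in> bigs p" by (rule bigs_mult(2)[OF cut_bigs])
  finally show ?case using Suc by (simp add: lop_def cut_eq_iff[THEN iffD2])
qed simp

lemma lgrade_cut: "P \<in> lgrade p N w \<Longrightarrow> cut p P = P"
  unfolding lgrade_def by (auto simp: pdom_iff lookup_cut poly_mapping_eq_iff fun_eq_iff)

lemma lgrade_lower:
  assumes p: "prime p" "CHAR('k::field) = p"
  shows "lower_module (\<lambda>c (P :: 'k mpoly). mconst c * P) p (lgrade p N) (lop p N)"
proof (intro lower_module.intro lower_module_axioms.intro p)
  show "vector_space (\<lambda>c (P :: 'k mpoly). mconst c * P)" by unfold_locales
  show "mp.subspace (lgrade p N w :: 'k mpoly set)" for w unfolding lgrade_def by (rule pdom_sub)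
  show "lop p N (x + y) = lop p N x + lop p N (y :: 'k mpoly)" for x y
    by (rule poly_mapping_eqI) (simp add: lop_def lookup_cut lookup_add distrib_left)
  show "lop p N (mconst c * x) = mconst c * lop p N (x :: 'k mpoly)" for c x
    by (rule poly_mapping_eqI) (simp add: lop_def lookup_cut mult.left_commute[of "quad N"] lookup_mconst)
  show "lop p N x \<in> lgrade p N (w + 2)" if "x \<in> lgrade p N w" for w and x :: "'k mpoly"
    using forms_mult[OF quad_forms lgrade_forms[OF that]] unfolding lop_def
    by (intro cut_lgrade) (simp add: algebra_simps)
  show "(lop p N ^^ p) x = 0" if "x \<in> lgrade p N w" for w and x :: "'k mpoly"
    using quad_pow_bigs[OF p, of N 1] bigs_mult(1) unfolding lop_pow[OF lgrade_cut[OF that]] cut_0_iff by simp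
qed

text \<open>The coefficient of \<open>x\<^sub>N\<^sup>j\<close> as a polynomial in the first \<open>N\<close> variables.\<close>

definition vcoeff :: "nat \<Rightarrow> nat \<Rightarrow> 'k::field mpoly \<Rightarrow> 'k mpoly" where
  "vcoeff N j P = restr {m. Poly_Mapping.keys m \<subseteq> {..<N}} (Poly_Mapping.map_key (\<lambda>m. m + Poly_Mapping.single N j) P)"

lemma lookup_vcoeff: "Poly_Mapping.lookup (vcoeff N j P) m =
    (if Poly_Mapping.keys m \<subseteq> {..<N} then Poly_Mapping.lookup P (m + Poly_Mapping.single N j) else 0)"
proof -
  have "inj (\<lambda>m :: expo. m + Poly_Mapping.single N j)" by (rule injI) simp
  then show ?thesis by (simp add: vcoeff_def lookup_restr map_key.rep_eq)
qed

lemma shift_mem: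
  assumes "Poly_Mapping.keys m \<subseteq> {..<N}"
  shows "m + Poly_Mapping.single N j \<in> mons (Suc N) d \<longleftrightarrow> m \<in> mons N (d - int j)"
    "m + Poly_Mapping.single N j \<in> big q \<longleftrightarrow> m \<in> big q \<or> q \<le> j"
proof -
  have m0: "Poly_Mapping.lookup m N = 0" using assms by (auto simp: in_keys_iff)
  show "m + Poly_Mapping.single N j \<in> mons (Suc N) d \<longleftrightarrow> m \<in> mons N (d - int j)"
    using assms by (auto simp: mons_def mdeg_add keys_expo_add split: if_splits)
  have "q \<le> Poly_Mapping.lookup (m + Poly_Mapping.single N j) i \<longleftrightarrow>
      (if i = N then q \<le> j else q \<le> Poly_Mapping.lookup m i)" for i
    using m0 by (simp add: lookup_add lookup_single when_def)
  moreover have "(\<exists>i. if i = N then q \<le> j else q \<le> Poly_Mapping.lookup m i) \<longleftrightarrow>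
      (\<exists>i. q \<le> Poly_Mapping.lookup m i) \<or> q \<le> j"
    using m0 by (metis le0 le_trans)
  ultimately show "m + Poly_Mapping.single N j \<in> big q \<longleftrightarrow> m \<in> big q \<or> q \<le> j"
    unfolding big_def by simp
qed

lemma vcoeff_lgrade:
  assumes "P \<in> lgrade p (Suc N) w"
  shows "vcoeff N j P \<in> lgrade p N (w + int ((p - 1) div 2) - int j)"
proof -
  have "Poly_Mapping.lookup (vcoeff N j P) m = 0"
    if "m \<notin> mons N (w + int ((p - 1) div 2) - int j + int (N * ((p - 1) div 2))) - big p" for m
    using assms that shift_mem[of m N j] unfolding lgrade_def pdom_iff lookup_vcoeff
    by (auto simp: algebra_simps)
  then show ?thesis unfolding lgrade_def pdom_iff by simp
qed

text \<open>The quadric in \<open>N + 1\<close> variables is the one in \<open>N\<close> variables plus \<open>x\<^sub>N\<^sup>2\<close>, so even and odd powers of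
  \<open>x\<^sub>N\<close> do not interact and each family behaves like one string.\<close>

lemma vcoeff_lop:
  assumes P: "P \<in> lgrade p (Suc N) w" and j: "j < p"
  shows "vcoeff N j (lop p (Suc N) P) = lop p N (vcoeff N j P) + (if 2 \<le> j then vcoeff N (j - 2) P else 0)"
proof (rule poly_mapping_eqI)
  fix m
  show "Poly_Mapping.lookup (vcoeff N j (lop p (Suc N) P)) m =
    Poly_Mapping.lookup (lop p N (vcoeff N j P) + (if 2 \<le> j then vcoeff N (j - 2) P else 0)) m"
  proof (cases "Poly_Mapping.keys m \<subseteq> {..<N}")
    case False
    have "Poly_Mapping.lookup (lop p N (vcoeff N j P)) m = 0"
      using cut_lgrade[of "quad N * vcoeff N j P" N "w + int ((p - 1) div 2) - int j + 2" p]
        forms_mult[OF quad_forms lgrade_forms[OF vcoeff_lgrade[OF P, of j]]] False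
      unfolding lop_def lgrade_def pdom_iff by (auto simp: mons_def algebra_simps)
    then show ?thesis using False by (simp add: lookup_vcoeff lookup_add)
  next
    case True
    then have m0: "Poly_Mapping.lookup m N = 0" by (auto simp: in_keys_iff)
    show ?thesis
    proof (cases "m \<in> big p")
      case big: True
      have "Poly_Mapping.lookup P (m + Poly_Mapping.single N (j - 2)) = 0"
        using P big shift_mem(2)[OF True] unfolding lgrade_def pdom_iff by blast
      then show ?thesis using big shift_mem(2)[OF True]
        by (simp add: lookup_vcoeff True lookup_add lop_def lookup_cut)
    next
      case small: False
      let ?k = "m + Poly_Mapping.single N j"
      have k: "?k \<notin> big p" using small shift_mem(2)[OF True] j by simp
      have 1: "?k - Poly_Mapping.single i 2 = (m - Poly_Mapping.single i 2) + Poly_Mapping.single N j" if "i < N" for i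
        using that by (intro poly_mapping_eqI) (auto simp: lookup_add lookup_minus lookup_single when_def)
      have 2: "?k - Poly_Mapping.single N 2 = m + Poly_Mapping.single N (j - 2)"
        using m0 by (intro poly_mapping_eqI) (auto simp: lookup_add lookup_minus lookup_single when_def)
      have 3: "Poly_Mapping.keys (m - Poly_Mapping.single i 2) \<subseteq> {..<N}" for i
        using True by (auto simp: in_keys_iff lookup_minus subset_iff)
      have "Poly_Mapping.lookup (vcoeff N j (lop p (Suc N) P)) m =
          (\<Sum>i<Suc N. if 2 \<le> Poly_Mapping.lookup ?k i then Poly_Mapping.lookup P (?k - Poly_Mapping.single i 2) else 0)"
        using k by (simp only: lookup_vcoeff True lop_def lookup_cut lookup_quad_mult if_True if_False simp_thms)
      also have "\<dots> = (\<Sum>i<N. if 2 \<le> Poly_Mapping.lookup m i then Poly_Mapping.lookup (vcoeff N j P) (m - Poly_Mapping.single i 2) else 0)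
          + (if 2 \<le> j then Poly_Mapping.lookup P (m + Poly_Mapping.single N (j - 2)) else 0)"
        unfolding sum.lessThan_Suc 2
        by (intro arg_cong2[where f = "(+)"] sum.cong refl) (simp_all add: lookup_add lookup_single m0 1 lookup_vcoeff 3)
      finally show ?thesis using small True
        by (simp add: lookup_add lop_def lookup_cut lookup_quad_mult) (simp add: lookup_vcoeff)
    qed
  qed
qed

lemma vcoeff_mult_power:
  assumes "P \<in> lgrade p N w"
  shows "vcoeff N j (P * mvar N ^ i) = (if i = j then P else 0)"
proof (rule poly_mapping_eqI)
  fix m
  have P0: "Poly_Mapping.lookup P k = 0" if "\<not> Poly_Mapping.keys k \<subseteq> {..<N}" for k
    using assms that unfolding lgrade_def pdom_iff by (auto simp: mons_def)
  show "Poly_Mapping.lookup (vcoeff N j (P * mvar N ^ i)) m = Poly_Mapping.lookup (if i = j then P else 0) m"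
  proof (cases "Poly_Mapping.keys m \<subseteq> {..<N}")
    case True
    then have m0: "Poly_Mapping.lookup m N = 0" by (auto simp: in_keys_iff)
    have "Poly_Mapping.lookup (mono (Poly_Mapping.single N i) * P) (m + Poly_Mapping.single N j) =
        (if i \<le> j then Poly_Mapping.lookup P (m + Poly_Mapping.single N j - Poly_Mapping.single N i) else 0)"
      unfolding lookup_mono_mult using m0 by (auto simp: lookup_add lookup_single when_def)
    moreover have "m + Poly_Mapping.single N j - Poly_Mapping.single N i = m + Poly_Mapping.single N (j - i)" if "i \<le> j"
      using that by (intro poly_mapping_eqI) (auto simp: lookup_add lookup_minus lookup_single when_def)
    moreover have "Poly_Mapping.lookup P (m + Poly_Mapping.single N (j - i)) = 0" if "i < j"
      using that by (intro P0) (auto simp: keys_expo_add)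
    ultimately show ?thesis using True by (auto simp: lookup_vcoeff mvar_power mult.commute[of P])
  qed (auto simp: lookup_vcoeff P0)
qed

lemma vcoeff_expand:
  assumes "P \<in> lgrade p (Suc N) w"
  shows "P = (\<Sum>j<p. vcoeff N j P * mvar N ^ j)"
proof (rule poly_mapping_eqI)
  fix k :: expo
  let ?t = "Poly_Mapping.lookup k N"
  have k: "k - Poly_Mapping.single N ?t + Poly_Mapping.single N ?t = k"
    by (intro poly_mapping_eqI) (auto simp: lookup_add lookup_minus lookup_single when_def)
  have K: "Poly_Mapping.keys (k - Poly_Mapping.single N j) \<subseteq> {..<N} \<longleftrightarrow>
      ?t \<le> j \<and> Poly_Mapping.keys k \<subseteq> {..<Suc N}" for j
    by (auto simp: subset_iff in_keys_iff lookup_minus lookup_single when_def less_Suc_eq split: if_splits)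
  have P0: "Poly_Mapping.lookup P k = 0" if "\<not> (?t < p \<and> Poly_Mapping.keys k \<subseteq> {..<Suc N})"
    using assms that unfolding lgrade_def pdom_iff by (auto simp: mons_def big_def not_less)
  have "Poly_Mapping.lookup (mono (Poly_Mapping.single N j) * vcoeff N j P) k =
      (if j = ?t then Poly_Mapping.lookup P k else 0)" if "j < p" for j
  proof -
    have "(\<forall>i. Poly_Mapping.lookup (Poly_Mapping.single N j) i \<le> Poly_Mapping.lookup k i) \<longleftrightarrow> j \<le> ?t"
      by (auto simp: lookup_single when_def)
    then show ?thesis using that P0 k by (auto simp: lookup_mono_mult lookup_vcoeff K)
  qed
  then have "Poly_Mapping.lookup (\<Sum>j<p. vcoeff N j P * mvar N ^ j) k = (\<Sum>j<p. if j = ?t then Poly_Mapping.lookup P k else 0)"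
    by (simp add: lookup_sum mvar_power mult.commute[of "vcoeff _ _ _"])
  then show "Poly_Mapping.lookup P k = Poly_Mapping.lookup (\<Sum>j<p. vcoeff N j P * mvar N ^ j) k"
    using P0 by auto
qed

section \<open>The Lefschetz property at exponent p\<close>

lemma sum_parity:
  fixes r :: nat
  shows "(\<Sum>j<2 * r + 1. f j) = (\<Sum>t<r + 1. f (2 * t)) + (\<Sum>t<r. f (2 * t + 1) :: 'a::comm_monoid_add)"
  by (induction r) (simp_all add: algebra_simps)

lemma vcoeff_add: "vcoeff N j (P + R) = vcoeff N j P + vcoeff N j R"
  by (rule poly_mapping_eqI) (simp add: lookup_vcoeff lookup_add)

lemma vcoeff_sum: "vcoeff N j (sum f A) = (\<Sum>a\<in>A. vcoeff N j (f a))"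
  by (rule poly_mapping_eqI) (simp add: lookup_vcoeff lookup_sum)

lemma lgrade_mult:
  assumes "P \<in> lgrade p N w" "j < p"
  shows "P * mvar N ^ j \<in> lgrade p (Suc N) (w + int j - int ((p - 1) div 2))"
  unfolding lgrade_def mvar_power
proof (rule pdom_mult[OF assms(1)[unfolded lgrade_def] mono_pdom[of _ "{Poly_Mapping.single N j}"]])
  fix a b assume "a \<in> mons N (w + int (N * ((p - 1) div 2))) - big p" "b \<in> {Poly_Mapping.single N j}"
  moreover from this have "Poly_Mapping.keys a \<subseteq> {..<N}" by (simp add: mons_def)
  ultimately show "a + b \<in> mons (Suc N) (w + int j - int ((p - 1) div 2) + int (Suc N * ((p - 1) div 2))) - big p"
    using assms(2) by (auto simp: shift_mem algebra_simps)
qed simp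

text \<open>As a module over \<open>x\<^sup>2\<close>, the ring \<open>k[x] / (x\<^sup>p)\<close> is the sum of a string of length \<open>(p + 1) / 2\<close> (even
  powers) and one of length \<open>(p - 1) / 2\<close> (odd powers), and both lengths are at most \<open>p\<close>. Hence each further variable
  replaces the module by a sum of two tensor products with strings.\<close>

lemma lgrade_centred:
  assumes p: "prime p" "CHAR('k::field) = p" "odd p"
  shows "centred p (lgrade p N :: int \<Rightarrow> 'k mpoly set) (lop p N)"
proof (induction N)
  case 0
  have M: "(lgrade p 0 w :: 'k mpoly set) = {0}" if "w \<noteq> 0" for w
  proof -
    have "mons 0 w = {}" using that by (auto simp: mons_def)
    then show ?thesis by (simp add: lgrade_def pdom_def)
  qed
  have M0: "0 \<in> (lgrade p 0 w :: 'k mpoly set)" for w unfolding lgrade_def by (rule pdom_0)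
  have e: "lop p 0 = (\<lambda>_. 0 :: 'k mpoly)"
    by (auto simp: lop_def quad_def cut_0_iff bigs_0)
  have ek: "((\<lambda>_. 0 :: 'k mpoly) ^^ l) x = (if l = 0 then x else 0)" for l x by (induction l) auto
  show ?case unfolding centred_def e
  proof (intro conjI allI impI)
    fix w and v :: "'k mpoly"
    assume "v \<in> lgrade p 0 w" "1 \<le> w \<or> w \<le> - int (p - 1)"
    moreover have "p > 1" using p(1) by (rule prime_gt_1_nat)
    ultimately have "v = 0" using M[of w] by auto
    then show "v \<in> (\<lambda>_ :: 'k mpoly. 0) ` lgrade p 0 (w - 2)" using M0 by (intro image_eqI[of _ _ 0]) simp_all
  next
    fix l and v :: "'k mpoly"
    assume "v \<in> lgrade p 0 (1 - int l)" "1 \<le> l" "((\<lambda>_. 0 :: 'k mpoly) ^^ (l - 1)) v = 0"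
    then have "v = 0" using M[of "1 - int l"] by (cases "l = 1") (auto simp: ek)
    then show "v \<in> (\<lambda>_ :: 'k mpoly. 0) ` lgrade p 0 (- 1 - int l)" using M0 by (intro image_eqI[of _ _ 0]) simp_all
  qed (use M0 in \<open>auto simp: ek intro!: bexI[of _ 0]\<close>)
next
  case (Suc N)
  interpret S: lower_module "\<lambda>c (P :: 'k mpoly). mconst c * P" p "lgrade p N" "lop p N"
    by (rule lgrade_lower[OF p(1,2)])
  define r where "r = (p - 1) div 2"
  have pr: "p = 2 * r + 1" using p(3) by (auto simp: r_def elim: oddE)
  have r1: "1 \<le> r" using p(1) pr by (cases r) auto
  define i where "i = (\<lambda>P :: 'k mpoly. (\<lambda>t. if t < r + 1 then vcoeff N (2 * t) P else 0, \<lambda>t. if t < r then vcoeff N (2 * t + 1) P else 0))"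
  define b where "b = (\<lambda>(F, G). (\<Sum>t<r + 1. F t * mvar N ^ (2 * t)) + (\<Sum>t<r. G t * mvar N ^ (2 * t + 1)) :: 'k mpoly)"
  let ?M = "lgrade p N :: int \<Rightarrow> 'k mpoly set" and ?e = "lop p N :: 'k mpoly \<Rightarrow> 'k mpoly"
  define D where "D = (\<lambda>w. str_grade ?M (r + 1) w \<times> str_grade ?M r w)"
  define d where "d = map_prod (str_op ?e (r + 1)) (str_op ?e r)"
  have C: "centred p D d" unfolding D_def d_def
    by (intro centred_Times S.str_centred Suc.IH) (use r1 pr in auto)
  have 1: "i v \<in> D w" if "v \<in> lgrade p (Suc N) w" for v w
  proof -
    have e: "w + int (r + 1) - 1 - 2 * int t = w + int r - int (2 * t)"
      "w + int r - 1 - 2 * int t = w + int r - int (2 * t + 1)" for t by simp_all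
    show ?thesis unfolding i_def D_def str_grade_def mem_Times_iff fst_conv snd_conv mem_Collect_eq e
      using vcoeff_lgrade[OF that, folded r_def] by (simp del: of_nat_mult of_nat_add of_nat_Suc)
  qed
  have 2: "i (lop p (Suc N) v) = d (i v)" if "v \<in> lgrade p (Suc N) w" for v w
  proof -
    have "vcoeff N (2 * t) (lop p (Suc N) v) = lop p N (vcoeff N (2 * t) v) + (if t = 0 then 0 else vcoeff N (2 * (t - 1)) v)"
      if "t < r + 1" for t
    proof -
      have "2 * t < p" using that pr by simp
      then show ?thesis using vcoeff_lop[OF \<open>v \<in> _\<close>] by (cases t) auto
    qed
    moreover have "vcoeff N (2 * t + 1) (lop p (Suc N) v) = lop p N (vcoeff N (2 * t + 1) v) + (if t = 0 then 0 else vcoeff N (2 * (t - 1) + 1) v)"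
      if "t < r" for t
    proof -
      have "2 * t + 1 < p" using that pr by simp
      then show ?thesis using vcoeff_lop[OF \<open>v \<in> _\<close>] by (cases t) auto
    qed
    ultimately show ?thesis unfolding i_def d_def str_op_def by (auto simp: fun_eq_iff)
  qed
  have 3: "b v \<in> lgrade p (Suc N) w" if v: "v \<in> D w" for v w
  proof -
    obtain F G where FG: "v = (F, G)" by (cases v)
    have "F t * mvar N ^ (2 * t) \<in> lgrade p (Suc N) w" if "t < r + 1" for t
    proof -
      have "F t \<in> lgrade p N (w + int r - 2 * int t)" using v that unfolding FG D_def str_grade_def by auto
      from lgrade_mult[OF this, of "2 * t"] show ?thesis using that pr by (simp add: r_def[symmetric, simplified])
    qed
    moreover have "G t * mvar N ^ (2 * t + 1) \<in> lgrade p (Suc N) w" if "t < r" for t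
    proof -
      have "G t \<in> lgrade p N (w + int r - 1 - 2 * int t)" using v that unfolding FG D_def str_grade_def by auto
      from lgrade_mult[OF this, of "2 * t + 1"] show ?thesis using that pr by (simp add: algebra_simps r_def[symmetric, simplified])
    qed
    ultimately show ?thesis unfolding b_def FG lgrade_def by (auto intro!: pdom_add pdom_sum)
  qed
  have 5: "b (i v) = v" if "v \<in> lgrade p (Suc N) w" for v w
    using vcoeff_expand[OF that] unfolding pr sum_parity by (simp add: b_def i_def)
  have 6: "i (b v) = v" if v: "v \<in> D w" for v w
  proof -
    obtain F G where FG: "v = (F, G)" by (cases v)
    have F: "F t \<in> lgrade p N (w + int r - 2 * int t)" if "t < r + 1" for t
      using v that unfolding FG D_def str_grade_def by auto
    have G: "G t \<in> lgrade p N (w + int r - 1 - 2 * int t)" if "t < r" for t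
      using v that unfolding FG D_def str_grade_def by auto
    have vF: "vcoeff N j (\<Sum>t<r + 1. F t * mvar N ^ (2 * t)) = (\<Sum>t<r + 1. if 2 * t = j then F t else 0)" for j
      unfolding vcoeff_sum by (intro sum.cong refl vcoeff_mult_power[OF F]) simp
    have vG: "vcoeff N j (\<Sum>t<r. G t * mvar N ^ (2 * t + 1)) = (\<Sum>t<r. if 2 * t + 1 = j then G t else 0)" for j
      unfolding vcoeff_sum by (intro sum.cong refl vcoeff_mult_power[OF G]) simp
    have parity: "2 * t \<noteq> Suc (2 * s)" "Suc (2 * s) \<noteq> 2 * t" for s t :: nat by presburger+
    have z: "F t = 0" if "t \<ge> r + 1" for t using v that unfolding FG D_def str_grade_def by auto
    have z': "G t = 0" if "t \<ge> r" for t using v that unfolding FG D_def str_grade_def by auto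
    show ?thesis unfolding FG i_def b_def prod.case vcoeff_add vF vG
      using z z' by (auto simp: fun_eq_iff parity not_less)
  qed
  have 7: "lop p (Suc N) v \<in> lgrade p (Suc N) (w + 2)" if "v \<in> lgrade p (Suc N) w" for w and v :: "'k mpoly"
    using lower_module.e_deg[OF lgrade_lower[OF p(1,2)] that] .
  have 4: "b (d v) = lop p (Suc N) (b v)" if v: "v \<in> D w" for v w
    using 2[OF 3[OF v]] 6[OF v] 5[OF 7[OF 3[OF v]]] by simp
  have 8: "d v \<in> D (w + 2)" if "v \<in> D w" for v w
    using that unfolding D_def d_def by (auto intro: S.str_deg)
  have 9: "x - y \<in> D w" if "x \<in> D w" "y \<in> D w" for x y w
    using that unfolding D_def by (auto intro: S.str_diff)
  have 10: "i 0 = 0"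
  proof -
    have "vcoeff N j 0 = (0 :: 'k mpoly)" for j by (rule poly_mapping_eqI) (simp add: lookup_vcoeff)
    then show ?thesis by (simp add: i_def zero_prod_def fun_eq_iff)
  qed
  have 11: "b (x - y) = b x - b y" for x y
    by (cases x; cases y) (simp add: b_def left_diff_distrib sum_subtractf)
  show ?case
    by (rule centred_retract[where i = i and r = b and M = "lgrade p (Suc N)" and M' = D and e = "lop p (Suc N)" and e' = d])
      (rule C 10 11 | erule 1 2 3 4 5 7 8 | erule (1) 9)+
qed

lemma lefschetz_prime:
  assumes p: "prime p" "CHAR('k::field) = p" "odd p"
    and P: "(P :: 'k mpoly) \<in> forms N d" "quad N ^ (p - 1) * P \<in> bigs p"
    and d: "d > int (N * ((p - 1) div 2)) \<or> d \<le> int (N * ((p - 1) div 2)) - int (p - 1)"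
  obtains R where "R \<in> forms N (d - 2)" "P - quad N * R \<in> bigs p"
proof -
  define w where "w = d - int (N * ((p - 1) div 2))"
  have g: "cut p P \<in> lgrade p N w" using P(1) by (intro cut_lgrade) (simp add: w_def)
  have "quad N ^ (p - 1) * P - quad N ^ (p - 1) * (P - cut p P) \<in> bigs p"
    by (intro bigs_diff P(2) bigs_mult(2)[OF cut_bigs])
  then have "quad N ^ (p - 1) * cut p P \<in> bigs p" by (simp add: right_diff_distrib)
  then have "(lop p N ^^ (p - 1)) (cut p P) = 0"
    unfolding lop_pow[OF lgrade_cut[OF g]] cut_0_iff by simp
  then have "cut p P \<in> lop p N ` lgrade p N (w - 2)"
    using lgrade_centred[OF p, of N] g d unfolding centred_def w_def by auto
  then obtain R where R: "R \<in> lgrade p N (w - 2)" "cut p P = cut p (quad N * R)"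
    unfolding lop_def by auto
  show ?thesis
  proof
    show "R \<in> forms N (d - 2)" using lgrade_forms[OF R(1)] by (simp add: w_def algebra_simps)
    show "P - quad N * R \<in> bigs p" using R(2) by (simp add: cut_eq_iff)
  qed
qed

section \<open>Slices over a Frobenius subring\<close>

definition escale :: "nat \<Rightarrow> expo \<Rightarrow> expo" where
  "escale r m = Poly_Mapping.map ((*) r) m"

lemma lookup_escale [simp]: "Poly_Mapping.lookup (escale r m) i = r * Poly_Mapping.lookup m i"
  by (simp add: escale_def Poly_Mapping.map.rep_eq when_def)

lemma escale_add: "escale r (a + b) = escale r a + escale r b"
  by (rule poly_mapping_eqI) (simp add: lookup_add algebra_simps)

lemma escale_single [simp]: "escale r (Poly_Mapping.single i k) = Poly_Mapping.single i (r * k)"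
  by (rule poly_mapping_eqI) (simp add: lookup_single when_def)

lemma escale_inj: "r > 0 \<Longrightarrow> escale r a = escale r b \<longleftrightarrow> a = b"
  by (auto simp: poly_mapping_eq_iff fun_eq_iff dest: spec)

lemma keys_escale: "r > 0 \<Longrightarrow> Poly_Mapping.keys (escale r m) = Poly_Mapping.keys m"
  by (auto simp: in_keys_iff)

lemma mdeg_escale: "mdeg (escale r m) = r * mdeg m"
proof (cases "r = 0")
  case True
  then have "escale r m = 0" by (intro poly_mapping_eqI) simp
  then show ?thesis using True by simp
qed (simp add: mdeg_def keys_escale sum_distrib_left)

text \<open>The substitution \<open>x\<^sub>i \<mapsto> x\<^sub>i\<^sup>r\<close>.\<close>

definition stretch :: "nat \<Rightarrow> 'k::field mpoly \<Rightarrow> 'k mpoly" where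
  "stretch r P = (\<Sum>m \<in> Poly_Mapping.keys P. mconst (Poly_Mapping.lookup P m) * mono (escale r m))"

lemma stretch_on: "finite A \<Longrightarrow> Poly_Mapping.keys P \<subseteq> A \<Longrightarrow>
    stretch r P = (\<Sum>m \<in> A. mconst (Poly_Mapping.lookup P m) * mono (escale r m))"
  unfolding stretch_def by (rule sum.mono_neutral_left) (auto simp: in_keys_iff)

lemma stretch_add: "stretch r (P + R) = stretch r P + stretch r R"
proof -
  let ?A = "Poly_Mapping.keys P \<union> Poly_Mapping.keys R"
  have "Poly_Mapping.keys (P + R) \<subseteq> ?A" by (rule Poly_Mapping.keys_add)
  then show ?thesis
    by (simp add: stretch_on[of ?A] lookup_add mconst_add distrib_right sum.distrib)
qed

lemma stretch_scale: "stretch r (mconst c * P) = mconst c * stretch r P"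
proof -
  have "Poly_Mapping.keys (mconst c * P) \<subseteq> Poly_Mapping.keys P" by (auto simp: in_keys_iff lookup_mconst)
  then have "stretch r (mconst c * P) = (\<Sum>m \<in> Poly_Mapping.keys P. mconst (Poly_Mapping.lookup (mconst c * P) m) * mono (escale r m))"
    by (rule stretch_on[OF finite_keys])
  also have "\<dots> = (\<Sum>m \<in> Poly_Mapping.keys P. mconst c * (mconst (Poly_Mapping.lookup P m) * mono (escale r m)))"
    by (simp only: lookup_mconst mconst_mult[symmetric] mult.assoc)
  finally show ?thesis by (simp only: stretch_def sum_distrib_left)
qed

lemma stretch_mono [simp]: "stretch r (mono m) = mono (escale r m)"
  by (simp add: stretch_def mconst_1)

lemma stretch_0 [simp]: "stretch r 0 = 0" by (simp add: stretch_def)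

lemma stretch_1 [simp]: "stretch r 1 = 1"
proof -
  have "escale r 0 = 0" by (intro poly_mapping_eqI) simp
  then show ?thesis using stretch_mono[of r 0] by simp
qed

lemma stretch_diff: "stretch r (P - R) = stretch r P - stretch r R"
  using stretch_add[of r "P - R" R] by (simp add: algebra_simps)

lemma stretch_sum: "stretch r (sum f A) = (\<Sum>a\<in>A. stretch r (f a))"
  by (induction A rule: infinite_finite_induct) (simp_all add: stretch_add)

lemma in_pdom_UNIV [simp]: "P \<in> pdom UNIV" by (simp add: pdom_def)

lemma stretch_mult: "stretch r (P * R) = stretch r P * (stretch r R :: 'k::field mpoly)"
proof (rule pdom_induct[where P = P and A = UNIV])
  show "mp.subspace {P. stretch r (P * R) = stretch r P * stretch r R}"
    by (rule mp.subspaceI) (simp_all add: stretch_add stretch_scale distrib_right mult.assoc)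
  fix m :: expo
  show "stretch r (mono m * R) = stretch r (mono m) * stretch r R"
  proof (rule pdom_induct[where P = R and A = UNIV])
    show "mp.subspace {R :: 'k mpoly. stretch r (mono m * R) = stretch r (mono m) * stretch r R}"
    proof (rule mp.subspaceI)
      fix c and x :: "'k mpoly"
      assume "x \<in> {R :: 'k mpoly. stretch r (mono m * R) = stretch r (mono m) * stretch r R}"
      moreover have "mono m * (mconst c * x) = mconst c * (mono m * x)" by (rule mult.left_commute)
      ultimately show "mconst c * x \<in> {R :: 'k mpoly. stretch r (mono m * R) = stretch r (mono m) * stretch r R}"
        by (simp add: stretch_scale mult.left_commute)
    qed (simp_all add: stretch_add distrib_left)
  qed (simp_all add: mono_mult escale_add)
qed simp

lemma stretch_power: "stretch r (P ^ k) = stretch r P ^ k"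
  by (induction k) (simp_all add: stretch_mult)

lemma stretch_mvar: "stretch r (mvar i) = mvar i ^ r"
  using stretch_mono[of r "Poly_Mapping.single i 1"] unfolding mvar_power by (simp add: mvar_def)

lemma stretch_quad:
  assumes "prime p" "CHAR('k::field) = p"
  shows "stretch (p ^ s) (quad N :: 'k mpoly) = quad N ^ (p ^ s)"
  unfolding quad_frobenius[OF assms] by (simp add: quad_def stretch_sum stretch_power stretch_mvar mult.commute flip: power_mult)

lemma lookup_stretch: "r > 0 \<Longrightarrow> Poly_Mapping.lookup (stretch r P) (escale r m) = Poly_Mapping.lookup P m"
  by (simp add: stretch_def lookup_sum lookup_mconst lookup_single when_def escale_inj in_keys_iff
      if_distrib[of "(*) _"] cong: if_cong)

lemma lookup_stretch_0: "(\<And>m. k \<noteq> escale r m) \<Longrightarrow> Poly_Mapping.lookup (stretch r P) k = 0"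
  unfolding stretch_def lookup_sum lookup_mconst by (intro sum.neutral) (auto simp: lookup_single when_def)

lemma stretch_pdom:
  assumes "P \<in> pdom A" "\<And>a. a \<in> A \<Longrightarrow> escale r a \<in> B"
  shows "stretch r P \<in> pdom B"
proof (rule pdom_induct[OF assms(1)])
  show "mp.subspace {P. stretch r P \<in> pdom B}"
    by (rule mp.subspaceI) (simp_all add: stretch_add stretch_scale pdom_0 pdom_add pdom_scale)
qed (use assms(2) mono_pdom in auto)

lemma stretch_forms: "P \<in> forms N d \<Longrightarrow> r > 0 \<Longrightarrow> stretch r P \<in> forms N (int r * d)"
  unfolding forms_def by (rule stretch_pdom) (auto simp: mons_def keys_escale mdeg_escale)

lemma stretch_bigs: "P \<in> bigs p \<Longrightarrow> stretch r P \<in> bigs (r * p)"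
  unfolding bigs_def by (rule stretch_pdom) (auto simp: big_def intro: mult_le_mono2)

text \<open>The component of \<open>P\<close> at \<open>x\<^sup>b\<close> in the decomposition of \<open>k[x]\<close> over \<open>k[x\<^sup>r]\<close>.\<close>

definition slice :: "nat \<Rightarrow> expo \<Rightarrow> 'k::field mpoly \<Rightarrow> 'k mpoly" where
  "slice r b P = Poly_Mapping.map_key (\<lambda>m. b + escale r m) P"

lemma lookup_slice:
  assumes "r > 0" shows "Poly_Mapping.lookup (slice r b P) m = Poly_Mapping.lookup P (b + escale r m)"
proof -
  have "inj (\<lambda>m. b + escale r m)" by (rule injI) (simp add: escale_inj[OF assms])
  then show ?thesis by (simp add: slice_def map_key.rep_eq)
qed

lemma slice_add: "r > 0 \<Longrightarrow> slice r b (P + R) = slice r b P + slice r b R"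
  by (rule poly_mapping_eqI) (simp add: lookup_slice lookup_add)

lemma slice_scale: "r > 0 \<Longrightarrow> slice r b (mconst c * P) = mconst c * slice r b P"
  by (rule poly_mapping_eqI) (simp add: lookup_slice lookup_mconst)

lemma slice_0: "r > 0 \<Longrightarrow> slice r b 0 = 0"
  by (rule poly_mapping_eqI) (simp add: lookup_slice)

lemma slice_stretch_mult:
  assumes r: "r > 0" and b: "\<And>i. Poly_Mapping.lookup b i < r"
  shows "slice r b (stretch r P * R) = P * slice r b R"
proof (rule pdom_induct[where P = P and A = UNIV])
  show "mp.subspace {P. slice r b (stretch r P * R) = P * slice r b R}"
    by (rule mp.subspaceI)
      (simp_all add: stretch_add stretch_scale slice_add slice_scale slice_0 r distrib_right mult.assoc)
  fix m :: expo
  show "slice r b (stretch r (mono m) * R) = mono m * slice r b R"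
  proof (rule poly_mapping_eqI)
    fix k
    have "r * x \<le> Poly_Mapping.lookup b i + r * y \<longleftrightarrow> x \<le> y" for x y i
    proof
      assume "r * x \<le> Poly_Mapping.lookup b i + r * y"
      then have "r * x < r * Suc y" using b[of i] by simp
      then have "x < Suc y" by (simp only: mult_less_cancel1)
      then show "x \<le> y" by simp
    qed (simp add: trans_le_add2)
    then have 1: "(\<forall>i. Poly_Mapping.lookup (escale r m) i \<le> Poly_Mapping.lookup (b + escale r k) i) \<longleftrightarrow>
        (\<forall>i. Poly_Mapping.lookup m i \<le> Poly_Mapping.lookup k i)"
      by (simp add: lookup_add)
    have 2: "b + escale r k - escale r m = b + escale r (k - m)" if "\<forall>i. Poly_Mapping.lookup m i \<le> Poly_Mapping.lookup k i"
      using that by (intro poly_mapping_eqI) (simp add: lookup_add lookup_minus right_diff_distrib')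
    show "Poly_Mapping.lookup (slice r b (stretch r (mono m) * R)) k = Poly_Mapping.lookup (mono m * slice r b R) k"
      unfolding stretch_mono lookup_slice[OF r] lookup_mono_mult 1 using 2 by (simp add: lookup_slice[OF r])
  qed
qed simp

definition box :: "nat \<Rightarrow> nat \<Rightarrow> expo set" where
  "box N r = {b. Poly_Mapping.keys b \<subseteq> {..<N} \<and> (\<forall>i. Poly_Mapping.lookup b i < r)}"

lemma box_finite: "finite (box N r)"
  by (rule finite_subset[OF _ expo_box_finite[of N r]]) (auto simp: box_def less_imp_le)

lemma box_mdeg: "b \<in> box N r \<Longrightarrow> mdeg b \<le> N * (r - 1)"
proof -
  assume b: "b \<in> box N r"
  then have "mdeg b = (\<Sum>i<N. Poly_Mapping.lookup b i)" by (intro mdeg_eq) (simp add: box_def)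
  also have "\<dots> \<le> (\<Sum>i<N. r - 1)" 
  proof (intro sum_mono)
    fix i
    have "Poly_Mapping.lookup b i < r" using b by (simp add: box_def)
    then show "Poly_Mapping.lookup b i \<le> r - 1" by simp
  qed
  finally show ?thesis by simp
qed

text \<open>The monomials in the box form a basis of the polynomial ring over the subring of polynomials in the
  \<open>r\<close>-th powers of the variables.\<close>

lemma slice_expand:
  assumes r: "r > 0" and P: "P \<in> forms N d"
  shows "P = (\<Sum>b \<in> box N r. mono b * stretch r (slice r b P))"
proof (rule poly_mapping_eqI)
  fix k :: expo
  define k0 where "k0 = Poly_Mapping.map (\<lambda>c. c mod r) k"
  define k1 where "k1 = Poly_Mapping.map (\<lambda>c. c div r) k"
  have l0: "Poly_Mapping.lookup k0 i = Poly_Mapping.lookup k i mod r" for i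
    by (simp add: k0_def Poly_Mapping.map.rep_eq when_def)
  have l1: "Poly_Mapping.lookup k1 i = Poly_Mapping.lookup k i div r" for i
    by (simp add: k1_def Poly_Mapping.map.rep_eq when_def)
  have k: "k = k0 + escale r k1" by (rule poly_mapping_eqI) (simp add: lookup_add l0 l1)
  have "Poly_Mapping.lookup (mono b * stretch r (slice r b P)) k = (if b = k0 then Poly_Mapping.lookup P k else 0)"
    if b: "b \<in> box N r" for b
  proof (cases "b = k0")
    case True
    have "k - k0 = escale r k1" unfolding k by simp
    moreover have "\<forall>i. Poly_Mapping.lookup k0 i \<le> Poly_Mapping.lookup k i" by (simp add: l0)
    ultimately have "Poly_Mapping.lookup (mono b * stretch r (slice r b P)) k = Poly_Mapping.lookup P (k0 + escale r k1)"
      unfolding True lookup_mono_mult by (simp add: lookup_stretch[OF r] lookup_slice[OF r])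
    then show ?thesis using True k by simp
  next
    case False
    have "Poly_Mapping.lookup (stretch r (slice r b P)) (k - b) = 0" if le: "\<forall>i. Poly_Mapping.lookup b i \<le> Poly_Mapping.lookup k i"
    proof (rule lookup_stretch_0)
      fix m
      show "k - b \<noteq> escale r m"
      proof
        assume m: "k - b = escale r m"
        have "Poly_Mapping.lookup b i = Poly_Mapping.lookup k0 i" for i
        proof -
          have "Poly_Mapping.lookup k i - Poly_Mapping.lookup b i = r * Poly_Mapping.lookup m i"
            using arg_cong[OF m, of "\<lambda>x. Poly_Mapping.lookup x i"] by (simp add: lookup_minus)
          then have "Poly_Mapping.lookup k i = Poly_Mapping.lookup b i + r * Poly_Mapping.lookup m i"
            using le[rule_format, of i] by simp
          then show ?thesis using b by (simp add: l0 box_def)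
        qed
        then show False using False by (simp add: poly_mapping_eqI)
      qed
    qed
    then show ?thesis using False by (simp add: lookup_mono_mult)
  qed
  then have "Poly_Mapping.lookup (\<Sum>b \<in> box N r. mono b * stretch r (slice r b P)) k =
      (\<Sum>b \<in> box N r. if b = k0 then Poly_Mapping.lookup P k else 0)"
    by (simp add: lookup_sum)
  also have "\<dots> = (if k0 \<in> box N r then Poly_Mapping.lookup P k else 0)"
    by (simp add: box_finite)
  also have "\<dots> = Poly_Mapping.lookup P k"
  proof -
    have "k0 \<in> box N r" if "Poly_Mapping.lookup P k \<noteq> 0"
    proof -
      have "Poly_Mapping.keys k \<subseteq> {..<N}" using P that by (auto simp: forms_def pdom_iff mons_def)
      moreover have "Poly_Mapping.keys k0 \<subseteq> Poly_Mapping.keys k"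
      proof
        fix i assume "i \<in> Poly_Mapping.keys k0"
        then have "Poly_Mapping.lookup k i mod r \<noteq> 0" by (simp add: in_keys_iff l0)
        then have "Poly_Mapping.lookup k i \<noteq> 0" by (metis mod_0)
        then show "i \<in> Poly_Mapping.keys k" by (simp add: in_keys_iff)
      qed
      ultimately show ?thesis using r by (auto simp: box_def l0)
    qed
    then show ?thesis by auto
  qed
  finally show "Poly_Mapping.lookup P k = Poly_Mapping.lookup (\<Sum>b \<in> box N r. mono b * stretch r (slice r b P)) k" ..
qed

lemma slice_bigs:
  assumes r: "r > 0" and b: "b \<in> box N r" and P: "P \<in> bigs (r * p)"
  shows "slice r b P \<in> bigs p"
proof -
  have "Poly_Mapping.lookup P (b + escale r m) = 0" if m: "m \<notin> big p" for m
  proof -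
    have "Poly_Mapping.lookup b i + r * Poly_Mapping.lookup m i < r * p" for i
    proof -
      have "Poly_Mapping.lookup b i + r * Poly_Mapping.lookup m i < r * Suc (Poly_Mapping.lookup m i)"
        using b by (simp add: box_def)
      also have "\<dots> \<le> r * p" using m by (intro mult_le_mono2) (auto simp: big_def not_le Suc_le_eq)
      finally show ?thesis .
    qed
    then have "b + escale r m \<notin> big (r * p)" by (auto simp: big_def lookup_add not_le)
    then show ?thesis using P by (simp add: bigs_def pdom_iff)
  qed
  then show ?thesis by (simp add: bigs_def pdom_iff lookup_slice[OF r])
qed

lemma slice_forms:
  assumes r: "r > 0" and b: "b \<in> box N r" and P: "P \<in> forms N d"
  shows "slice r b P \<in> forms N j \<or> int (mdeg b) + int r * j \<noteq> d"
    "(\<And>j. int (mdeg b) + int r * j \<noteq> d) \<Longrightarrow> slice r b P = 0"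
proof -
  have *: "Poly_Mapping.keys m \<subseteq> {..<N} \<and> int (mdeg b) + int r * int (mdeg m) = d"
    if "Poly_Mapping.lookup (slice r b P) m \<noteq> 0" for m
  proof -
    have "b + escale r m \<in> mons N d"
      using P that by (auto simp: lookup_slice[OF r] forms_def pdom_iff)
    then show ?thesis by (simp add: mons_def mdeg_add mdeg_escale keys_expo_add keys_escale[OF r])
  qed
  have "slice r b P \<in> forms N j" if "int (mdeg b) + int r * j = d"
  proof -
    have "Poly_Mapping.lookup (slice r b P) m = 0" if m: "m \<notin> mons N j" for m
    proof (rule ccontr)
      assume "Poly_Mapping.lookup (slice r b P) m \<noteq> 0"
      from *[OF this] that m r \<open>_ = d\<close> show False by (auto simp: mons_def)
    qed
    then show ?thesis by (simp add: forms_def pdom_iff)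
  qed
  then show "slice r b P \<in> forms N j \<or> int (mdeg b) + int r * j \<noteq> d" by blast
  show "slice r b P = 0" if "\<And>j. int (mdeg b) + int r * j \<noteq> d"
    using * that by (intro poly_mapping_eqI) (metis lookup_zero)
qed

lemma mono_box_forms: "b \<in> box N r \<Longrightarrow> mono b \<in> forms N (int (mdeg b))"
  unfolding forms_def by (rule mono_pdom) (simp add: mons_def box_def)

section \<open>The Lefschetz property at powers of p\<close>

text \<open>The degree \<open>d\<close> part of the ideal generated by the quadric and the \<open>q\<close>-th powers of the variables.\<close>

definition qrel :: "nat \<Rightarrow> nat \<Rightarrow> int \<Rightarrow> 'k::field mpoly set" where
  "qrel N q d = {P \<in> forms N d. \<exists>R \<in> forms N (d - 2). P - quad N * R \<in> bigs q}"

lemma qrel_sub: "mp.subspace (qrel N q d :: 'k::field mpoly set)"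
proof (rule mp.subspaceI)
  show "0 \<in> (qrel N q d :: 'k mpoly set)" unfolding qrel_def using forms_0 bigs_0 by force
next
  fix x y :: "'k mpoly" assume "x \<in> qrel N q d" "y \<in> qrel N q d"
  then obtain R S where *: "R \<in> forms N (d - 2)" "x - quad N * R \<in> bigs q" "S \<in> forms N (d - 2)" "y - quad N * S \<in> bigs q"
    "x \<in> forms N d" "y \<in> forms N d"
    unfolding qrel_def by blast
  have "(x - quad N * R) + (y - quad N * S) \<in> bigs q" by (intro bigs_add *)
  then have "x + y - quad N * (R + S) \<in> bigs q" by (simp add: algebra_simps)
  moreover have "R + S \<in> forms N (d - 2)" "x + y \<in> forms N d" by (intro forms_add *)+
  ultimately show "x + y \<in> qrel N q d" unfolding qrel_def by blast
next
  fix c and x :: "'k mpoly" assume "x \<in> qrel N q d"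
  then obtain R where *: "R \<in> forms N (d - 2)" "x - quad N * R \<in> bigs q" "x \<in> forms N d"
    unfolding qrel_def by blast
  have "mconst c * (x - quad N * R) \<in> bigs q" by (rule bigs_scale[OF *(2)])
  moreover have "mconst c * (x - quad N * R) = mconst c * x - quad N * (mconst c * R)" by (simp add: algebra_simps)
  moreover have "mconst c * R \<in> forms N (d - 2)" "mconst c * x \<in> forms N d" by (intro forms_scale *)+
  ultimately show "mconst c * x \<in> qrel N q d" unfolding qrel_def by auto
qed

lemmas qrel_add = mp.subspace_add[OF qrel_sub] and qrel_diff = mp.subspace_diff[OF qrel_sub]
  and qrel_0 = mp.subspace_0[OF qrel_sub] and qrel_sum = mp.subspace_sum[OF qrel_sub]
  and qrel_neg = mp.subspace_neg[OF qrel_sub] and qrel_scale = mp.subspace_scale[OF qrel_sub]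

lemma qrel_forms: "P \<in> qrel N q d \<Longrightarrow> P \<in> forms N d" by (simp add: qrel_def)

lemma qrel_bigs: "P \<in> forms N d \<Longrightarrow> P \<in> bigs q \<Longrightarrow> P \<in> qrel N q d"
  unfolding qrel_def using forms_0[of N "d - 2"] by force

lemma qrel_quad:
  assumes "R \<in> forms N (d - 2)" shows "quad N * R \<in> qrel N q d"
proof -
  have "quad N * R \<in> forms N d" using forms_mult[OF quad_forms assms] by simp
  then show ?thesis unfolding qrel_def using assms bigs_0 by force
qed

lemma qrel_mult:
  assumes "P \<in> qrel N q d" "G \<in> forms N e" shows "G * P \<in> qrel N q (d + e)"
proof -
  obtain R where R: "R \<in> forms N (d - 2)" "P - quad N * R \<in> bigs q" "P \<in> forms N d"
    using assms unfolding qrel_def by blast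
  have "G * P - quad N * (G * R) = G * (P - quad N * R)" by (simp add: algebra_simps)
  then have "G * P - quad N * (G * R) \<in> bigs q" using bigs_mult(2)[OF R(2)] by simp
  moreover have "G * R \<in> forms N (d + e - 2)" using forms_mult[OF assms(2) R(1)] by (simp add: algebra_simps)
  moreover have "G * P \<in> forms N (d + e)" using forms_mult[OF assms(2) R(3)] by (simp add: algebra_simps)
  ultimately show ?thesis unfolding qrel_def by blast
qed

text \<open>Multiplication by \<open>Q\<^bsup>r(p-1)\<^esup>\<close> is linear over the polynomials in the \<open>r\<close>-th powers of the variables, so
  the hypothesis passes to the slices of \<open>P\<close>. The condition on degrees puts every slice into the range where the
  result for the exponent \<open>p\<close> applies.\<close>

lemma quad_frob_descent:
  assumes p: "prime p" "CHAR('k::field) = p" "odd p" and r: "r = p ^ s"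
    and P: "(P :: 'k mpoly) \<in> forms N d" "quad N ^ (r * (p - 1)) * P \<in> bigs (r * p)"
    and deg: "\<And>b j. b \<in> box N r \<Longrightarrow> int (mdeg b) + int r * j = d \<Longrightarrow>
      j > int (N * ((p - 1) div 2)) \<or> j \<le> int (N * ((p - 1) div 2)) - int (p - 1)"
  obtains R where "R \<in> forms N (d - 2 * int r)" "P - quad N ^ r * R \<in> bigs (r * p)"
proof -
  have r0: "r > 0" using p(1) r by (simp add: prime_gt_0_nat)
  have sq: "stretch r (quad N ^ k) = (quad N ^ (r * k) :: 'k mpoly)" for k
    unfolding r stretch_power stretch_quad[OF p(1,2)] by (simp add: power_mult)
  have "\<exists>R. mono b * stretch r R \<in> forms N (d - 2 * int r) \<and> slice r b P - quad N * R \<in> bigs p" if b: "b \<in> box N r" for b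
  proof (cases "\<exists>j. int (mdeg b) + int r * j = d")
    case False
    then have "slice r b P = 0" using slice_forms(2)[OF r0 b P(1)] by blast
    then show ?thesis by (intro exI[of _ 0]) (simp add: forms_0 bigs_0)
  next
    case True
    then obtain j where j: "int (mdeg b) + int r * j = d" by blast
    have f: "slice r b P \<in> forms N j" using slice_forms(1)[OF r0 b P(1), of j] j by blast
    have "quad N ^ (p - 1) * slice r b P = slice r b (quad N ^ (r * (p - 1)) * P)"
      unfolding sq[symmetric] by (rule slice_stretch_mult[symmetric]) (use b r0 in \<open>auto simp: box_def\<close>)
    then have "quad N ^ (p - 1) * slice r b P \<in> bigs p" using slice_bigs[OF r0 b P(2)] by simp
    from lefschetz_prime[OF p f this deg[OF b j]]
    obtain R where R: "R \<in> forms N (j - 2)" "slice r b P - quad N * R \<in> bigs p" by blast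
    have "mono b * stretch r R \<in> forms N (int (mdeg b) + int r * (j - 2))"
      by (rule forms_mult[OF mono_box_forms[OF b] stretch_forms[OF R(1) r0]])
    moreover have "int (mdeg b) + int r * (j - 2) = d - 2 * int r" using j by (simp add: algebra_simps)
    ultimately show ?thesis using R(2) by auto
  qed
  then obtain g where g: "\<And>b. b \<in> box N r \<Longrightarrow> mono b * stretch r (g b) \<in> forms N (d - 2 * int r) \<and> slice r b P - quad N * g b \<in> bigs p"
    by metis
  define R where "R = (\<Sum>b \<in> box N r. mono b * stretch r (g b))"
  show ?thesis
  proof
    show "R \<in> forms N (d - 2 * int r)" unfolding R_def using g by (intro forms_sum) auto
    have "quad N ^ r * R = (\<Sum>b \<in> box N r. mono b * stretch r (quad N * g b))"
      using sq[of 1] by (simp add: R_def sum_distrib_left stretch_mult mult.left_commute)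
    then have "P - quad N ^ r * R = (\<Sum>b \<in> box N r. mono b * stretch r (slice r b P - quad N * g b))"
      by (subst slice_expand[OF r0 P(1)]) (simp add: stretch_diff right_diff_distrib sum_subtractf)
    also have "\<dots> \<in> bigs (r * p)"
      using g by (intro bigs_sum bigs_mult(2) stretch_bigs) auto
    finally show "P - quad N ^ r * R \<in> bigs (r * p)" .
  qed
qed

lemma quad_pow_step:
  fixes p r :: nat
  assumes "p \<ge> 2" "r \<ge> 1" shows "r * p - 1 = r * (p - 1) + (r - 1)"
  using assms by (cases p; cases r) auto

lemma bigs_pow_mono:
  assumes "quad N ^ a * P \<in> bigs q" "a \<le> b" shows "quad N ^ b * P \<in> bigs q"
proof -
  have 1: "quad N ^ (b - a) * (quad N ^ a * P) \<in> bigs q" by (rule bigs_mult(2)[OF assms(1)])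
  have e: "quad N ^ b = quad N ^ (b - a) * (quad N ^ a :: 'a mpoly)" using assms(2) by (simp flip: power_add)
  show ?thesis unfolding e mult.assoc by (rule 1)
qed

text \<open>The first half of the descent: \<open>P\<close> may be altered by a multiple of \<open>Q\<close> such that \<open>Q\<^sup>r\<^sup>-\<^sup>1 P = 0\<close>.\<close>

lemma quad_descent_first:
  assumes p: "prime p" "CHAR('k::field) = p" "odd p" and r: "r = p ^ s"
    and P: "(P :: 'k mpoly) \<in> forms N d" "quad N ^ (r * p - 1) * P \<in> bigs (r * p)"
    and deg: "\<And>b j. b \<in> box N r \<Longrightarrow> int (mdeg b) + int r * j = d + 2 * int (r - 1) \<Longrightarrow>
      j > int (N * ((p - 1) div 2)) \<or> j \<le> int (N * ((p - 1) div 2)) - int (p - 1)"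
  obtains R where "R \<in> forms N (d - 2)" "quad N ^ (r - 1) * (P - quad N * R) \<in> bigs (r * p)"
proof -
  have r1: "r \<ge> 1" using p(1) r by (simp add: prime_gt_0_nat Suc_leI)
  have p2: "p \<ge> 2" using p(1) by (rule prime_ge_2_nat)
  have f: "quad N ^ (r - 1) * P \<in> forms N (d + 2 * int (r - 1))"
    using forms_mult[OF quad_pow_forms P(1)] by (simp add: add.commute)
  have "quad N ^ (r * (p - 1)) * (quad N ^ (r - 1) * P) \<in> bigs (r * p)"
    using P(2) unfolding quad_pow_step[OF p2 r1] power_add by (simp add: mult.assoc)
  then obtain R where R: "R \<in> forms N (d + 2 * int (r - 1) - 2 * int r)" "quad N ^ (r - 1) * P - quad N ^ r * R \<in> bigs (r * p)"
    using quad_frob_descent[OF p r f] deg by blast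
  show ?thesis
  proof
    show "R \<in> forms N (d - 2)" using R(1) r1 by (simp add: of_nat_diff algebra_simps)
    have "quad N ^ r = quad N ^ (r - 1) * (quad N :: 'k mpoly)" using r1 by (cases r) (simp_all add: mult.commute)
    then show "quad N ^ (r - 1) * (P - quad N * R) \<in> bigs (r * p)" using R(2) by (simp add: algebra_simps)
  qed
qed

text \<open>After the first half of the descent one may assume that \<open>Q\<^bsup>r-1\<^esup>\<close> kills \<open>P\<close>. Then so does \<open>Q\<^bsup>r(p-1)\<^esup>\<close>, and a
  second descent shows that \<open>P\<close> is a multiple of \<open>Q\<^sup>r\<close>. In low degrees all slices have low degree, so
  both descents are possible.\<close>

lemma lefschetz_low:
  assumes p: "prime p" "CHAR('k::field) = p" "odd p" and r: "r = p ^ s"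
    and P: "(P :: 'k mpoly) \<in> forms N d" "quad N ^ (r * p - 1) * P \<in> bigs (r * p)"
    and d: "d + 2 * int (r - 1) < int r * (int (N * ((p - 1) div 2)) - int p + 2)"
  shows "P \<in> qrel N (r * p) d"
proof -
  have r1: "r \<ge> 1" using p(1) r by (simp add: prime_gt_0_nat Suc_leI)
  have p2: "p \<ge> 2" using p(1) by (rule prime_ge_2_nat)
  have deg: "j \<le> int (N * ((p - 1) div 2)) - int (p - 1)" if "int (mdeg b) + int r * j \<le> d + 2 * int (r - 1)" for b j
  proof -
    have "int r * j < int r * (int (N * ((p - 1) div 2)) - int p + 2)" using that d by linarith
    then have "j < int (N * ((p - 1) div 2)) - int p + 2" using r1 by (simp add: mult_less_cancel_left)
    then show ?thesis using p2 by simp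
  qed
  obtain R where R: "R \<in> forms N (d - 2)" "quad N ^ (r - 1) * (P - quad N * R) \<in> bigs (r * p)"
    using quad_descent_first[OF p r P] deg by (metis order_refl)
  have f: "P - quad N * R \<in> forms N d"
    using forms_mult[OF quad_forms R(1)] by (intro forms_diff P) simp
  have "r - 1 \<le> r * (p - 1)" using p2 by (cases "p - 1") auto
  from bigs_pow_mono[OF R(2) this]
  obtain S where S: "S \<in> forms N (d - 2 * int r)" "P - quad N * R - quad N ^ r * S \<in> bigs (r * p)"
    using quad_frob_descent[OF p r f] deg by (metis add.commute add_increasing2 of_nat_0_le_iff order_refl mult_nonneg_nonneg zero_le_numeral)
  have "quad N ^ (r - 1) * S \<in> forms N (d - 2)"
    using forms_mult[OF quad_pow_forms[of N "r - 1"] S(1)] r1 by (simp add: of_nat_diff algebra_simps)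
  then have "R + quad N ^ (r - 1) * S \<in> forms N (d - 2)" by (rule forms_add[OF R(1)])
  moreover have e: "P - quad N * (R + quad N ^ (r - 1) * S) = P - quad N * R - quad N ^ r * S"
    using r1 by (cases r) (simp_all add: algebra_simps)
  have "P - quad N * (R + quad N ^ (r - 1) * S) \<in> bigs (r * p)" unfolding e by (rule S(2))
  ultimately show ?thesis unfolding qrel_def using P(1) by blast
qed

lemma bigs_forms_decomp:
  assumes "r > 0" "(P :: 'k::field mpoly) \<in> bigs r" "P \<in> forms N a"
  shows "\<exists>g. (\<forall>i<N. g i \<in> forms N (a - int r)) \<and> P = (\<Sum>i<N. mvar i ^ r * g i)"
proof (rule pdom_induct[where P = P and A = "big r \<inter> mons N a"])
  show "P \<in> pdom (big r \<inter> mons N a)" using assms unfolding bigs_def forms_def by (simp flip: pdom_Int)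
  show "mp.subspace {P :: 'k mpoly. \<exists>g. (\<forall>i<N. g i \<in> forms N (a - int r)) \<and> P = (\<Sum>i<N. mvar i ^ r * g i)}"
  proof (rule mp.subspaceI; safe)
    show "\<exists>g :: nat \<Rightarrow> 'k mpoly. (\<forall>i<N. g i \<in> forms N (a - int r)) \<and> 0 = (\<Sum>i<N. mvar i ^ r * g i)"
      by (intro exI[of _ "\<lambda>_. 0"]) (simp add: forms_0)
  next
    fix g h :: "nat \<Rightarrow> 'k mpoly" assume "\<forall>i<N. g i \<in> forms N (a - int r)" "\<forall>i<N. h i \<in> forms N (a - int r)"
    then show "\<exists>f. (\<forall>i<N. f i \<in> forms N (a - int r)) \<and>
        (\<Sum>i<N. mvar i ^ r * g i) + (\<Sum>i<N. mvar i ^ r * h i) = (\<Sum>i<N. mvar i ^ r * f i)"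
      by (intro exI[of _ "\<lambda>i. g i + h i"]) (auto simp: forms_add distrib_left sum.distrib)
  next
    fix c and g :: "nat \<Rightarrow> 'k mpoly" assume "\<forall>i<N. g i \<in> forms N (a - int r)"
    then show "\<exists>f. (\<forall>i<N. f i \<in> forms N (a - int r)) \<and> mconst c * (\<Sum>i<N. mvar i ^ r * g i) = (\<Sum>i<N. mvar i ^ r * f i)"
      by (intro exI[of _ "\<lambda>i. mconst c * g i"]) (auto simp: forms_scale sum_distrib_left mult.left_commute[of "mconst c"])
  qed
  fix m assume m: "m \<in> big r \<inter> mons N a"
  then obtain i where i: "r \<le> Poly_Mapping.lookup m i" by (auto simp: big_def)
  then have "i \<in> Poly_Mapping.keys m" using assms(1) by (simp add: in_keys_iff)
  then have iN: "i < N" using m by (auto simp: mons_def)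
  let ?m = "m - Poly_Mapping.single i r"
  have me: "m = Poly_Mapping.single i r + ?m"
    using i by (intro poly_mapping_eqI) (auto simp: lookup_add lookup_minus lookup_single when_def)
  have "?m \<in> mons N (a - int r)"
  proof -
    have "int (mdeg m) = int r + int (mdeg ?m)" by (subst me) (simp add: mdeg_add)
    moreover have "Poly_Mapping.keys ?m \<subseteq> Poly_Mapping.keys m" by (auto simp: in_keys_iff lookup_minus)
    ultimately show ?thesis using m by (auto simp: mons_def)
  qed
  then have "mono ?m \<in> forms N (a - int r)" unfolding forms_def by (rule mono_pdom)
  then show "\<exists>g. (\<forall>i<N. g i \<in> forms N (a - int r)) \<and> mono m = (\<Sum>i<N. mvar i ^ r * g i)"
    by (intro exI[of _ "\<lambda>k. if k = i then mono ?m else 0"])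
      (use iN in \<open>auto simp: forms_0 mvar_power mono_mult me[symmetric] if_distrib[of "(*) _"] cong: if_cong\<close>)
qed

text \<open>In high degrees only the first half of the descent is available: the slices of \<open>P\<close> itself may have
  degrees near the middle. Each term is a product \<open>g \<cdot> w(x\<^sup>r)\<close> with \<open>Q w = 0\<close>. If \<open>w\<close> has large
  degree, it is a multiple of \<open>Q\<close>; otherwise \<open>g\<close> has so large a degree that it is a combination of \<open>Q\<close> and the
  \<open>x\<^sub>i\<^sup>r\<close>, and the factors \<open>x\<^sub>i\<^sup>r\<close> can be moved into \<open>w\<close>, which lowers the degree of \<open>g\<close>.\<close>

lemma lefschetz_high_step:
  assumes p: "prime p" "CHAR('k::field) = p" "odd p" and r: "r = p ^ s"
    and top: "\<And>a (g :: 'k mpoly). a > int n * int (r - 1) \<Longrightarrow> g \<in> forms (n + 2) a \<Longrightarrow> g \<in> qrel (n + 2) r a"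
    and P: "(P :: 'k mpoly) \<in> forms (n + 2) d" "quad (n + 2) ^ (r * p - 1) * P \<in> bigs (r * p)"
    and d: "d > int n * int (r - 1) + int r * int ((n + 2) * ((p - 1) div 2))"
  shows "P \<in> qrel (n + 2) (r * p) d"
proof -
  let ?N = "n + 2" and ?h = "int ((n + 2) * ((p - 1) div 2))"
  have r1: "r \<ge> 1" and r0: "r > 0" using p(1) r by (simp_all add: prime_gt_0_nat Suc_leI)
  have p2: "p \<ge> 2" using p(1) by (rule prime_ge_2_nat)
  have deg: "j > ?h" if "b \<in> box ?N r" "int (mdeg b) + int r * j = d + 2 * int (r - 1)" for b j
  proof -
    have "int (mdeg b) \<le> int (?N * (r - 1))" using box_mdeg[OF that(1)] by (simp only: of_nat_le_iff)
    also have "\<dots> = int n * int (r - 1) + 2 * int (r - 1)" by (simp only: of_nat_mult of_nat_add distrib_right of_nat_numeral)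
    finally have "int r * ?h < int r * j" using that(2) d by linarith
    then show ?thesis using r1 by (simp add: mult_less_cancel_left)
  qed
  obtain R where R: "R \<in> forms ?N (d - 2)" "quad ?N ^ (r - 1) * (P - quad ?N * R) \<in> bigs (r * p)"
    using quad_descent_first[OF p r P] deg by metis
  have f: "P - quad ?N * R \<in> forms ?N d"
    using forms_mult[OF quad_forms R(1)] by (intro forms_diff P) simp
  have bnd: "quad ?N ^ r * (P - quad ?N * R) \<in> bigs (r * p)" by (rule bigs_pow_mono[OF R(2)]) simp
  have sq: "stretch r (quad N) = (quad N ^ r :: 'k mpoly)" for N
    unfolding r stretch_quad[OF p(1,2)] ..
  have key: "g * stretch r w \<in> qrel ?N (r * p) d"
    if "g \<in> forms ?N a" "w \<in> forms ?N j" "quad ?N * w \<in> bigs p" "a + int r * j = d" for g w :: "'k mpoly" and a j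
    using that
  proof (induction "nat a" arbitrary: a g w j rule: less_induct)
    case less
    note g = less.prems(1) and w = less.prems(2,3) and aj = less.prems(4)
    show ?case
    proof (cases "j > ?h")
      case True
      have "quad ?N ^ (p - 1) * w \<in> bigs p" using bigs_pow_mono[of ?N 1 w p "p - 1"] w(2) p2 by simp
      from lefschetz_prime[OF p w(1) this] True
      obtain y where y: "y \<in> forms ?N (j - 2)" "w - quad ?N * y \<in> bigs p" by blast
      have "stretch r w = stretch r (w - quad ?N * y) + quad ?N ^ r * stretch r y"
        by (simp add: stretch_diff stretch_mult sq)
      moreover have "quad ?N ^ r = quad ?N * (quad ?N ^ (r - 1) :: 'k mpoly)" using r1 by (cases r) simp_all
      ultimately have e: "g * stretch r w = g * stretch r (w - quad ?N * y) + quad ?N * (quad ?N ^ (r - 1) * (g * stretch r y))"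
        by (simp add: algebra_simps)
      have "w - quad ?N * y \<in> forms ?N j" using forms_mult[OF quad_forms y(1)] by (intro forms_diff w) simp
      then have "g * stretch r (w - quad ?N * y) \<in> forms ?N d"
        using forms_mult[OF g stretch_forms[OF _ r0]] aj by blast
      then have 1: "g * stretch r (w - quad ?N * y) \<in> qrel ?N (r * p) d"
        by (intro qrel_bigs bigs_mult(2) stretch_bigs y)
      have "quad ?N ^ (r - 1) * (g * stretch r y) \<in> forms ?N (2 * int (r - 1) + (a + int r * (j - 2)))"
        by (intro forms_mult quad_pow_forms g stretch_forms y r0)
      moreover have "2 * int (r - 1) + (a + int r * (j - 2)) = d - 2"
        using aj r1 by (simp add: of_nat_diff algebra_simps)
      ultimately show ?thesis unfolding e by (intro qrel_add 1 qrel_quad) simp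
    next
      case False
      have "int r * j \<le> int r * ?h" using False by (intro mult_left_mono) auto
      then have a: "a > int n * int (r - 1)" using aj d by linarith
      then have a0: "a > 0" by (smt (verit) of_nat_0_le_iff mult_nonneg_nonneg)
      obtain R' where R': "R' \<in> forms ?N (a - 2)" "g - quad ?N * R' \<in> bigs r"
        using top[OF a g] unfolding qrel_def by blast
      have "g - quad ?N * R' \<in> forms ?N a" using forms_mult[OF quad_forms R'(1)] by (intro forms_diff g) simp
      from bigs_forms_decomp[OF r0 R'(2) this]
      obtain G where G: "\<And>i. i < ?N \<Longrightarrow> G i \<in> forms ?N (a - int r)" "g - quad ?N * R' = (\<Sum>i<?N. mvar i ^ r * G i)"
        by blast
      have "g * stretch r w = (g - quad ?N * R') * stretch r w + quad ?N * (R' * stretch r w)"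
        by (simp add: algebra_simps)
      also have "\<dots> = (\<Sum>i<?N. G i * stretch r (mvar i * w)) + quad ?N * (R' * stretch r w)"
        unfolding G(2) sum_distrib_right
        by (intro arg_cong2[where f = "(+)"] sum.cong refl) (simp add: stretch_mult stretch_mvar mult_ac)
      finally have e: "g * stretch r w = (\<Sum>i<?N. G i * stretch r (mvar i * w)) + quad ?N * (R' * stretch r w)" .
      have "G i * stretch r (mvar i * w) \<in> qrel ?N (r * p) d" if i: "i < ?N" for i
      proof (rule less.hyps[OF _ G(1)[OF i]])
        show "nat (a - int r) < nat a" using a0 r1 by simp
        show "mvar i * w \<in> forms ?N (j + 1)" using forms_mult[OF mvar_forms[OF i] w(1)] by (simp add: add.commute)
        have "mvar i * (quad ?N * w) \<in> bigs p" by (rule bigs_mult(2)[OF w(2)])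
        then show "quad ?N * (mvar i * w) \<in> bigs p" by (simp add: mult.left_commute)
        show "a - int r + int r * (j + 1) = d" using aj by (simp add: algebra_simps)
      qed
      moreover have "R' * stretch r w \<in> forms ?N (d - 2)"
        using forms_mult[OF R'(1) stretch_forms[OF w(1) r0]] aj by (simp add: algebra_simps)
      ultimately show ?thesis unfolding e by (intro qrel_add qrel_sum qrel_quad) auto
    qed
  qed
  have "P - quad ?N * R \<in> qrel ?N (r * p) d"
  proof (subst slice_expand[OF r0 f], intro qrel_sum)
    fix b assume b: "b \<in> box ?N r"
    show "mono b * stretch r (slice r b (P - quad ?N * R)) \<in> qrel ?N (r * p) d"
    proof (cases "\<exists>j. int (mdeg b) + int r * j = d")
      case False
      then have "slice r b (P - quad ?N * R) = 0" using slice_forms(2)[OF r0 b f] by blast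
      then show ?thesis by (simp add: qrel_0)
    next
      case True
      then obtain j where j: "int (mdeg b) + int r * j = d" by blast
      have "slice r b (P - quad ?N * R) \<in> forms ?N j" using slice_forms(1)[OF r0 b f, of j] j by blast
      moreover have "quad ?N * slice r b (P - quad ?N * R) = slice r b (quad ?N ^ r * (P - quad ?N * R))"
        unfolding sq[symmetric] by (rule slice_stretch_mult[symmetric]) (use b r0 in \<open>auto simp: box_def\<close>)
      then have "quad ?N * slice r b (P - quad ?N * R) \<in> bigs p" using slice_bigs[OF r0 b bnd] by simp
      ultimately show ?thesis using key[OF mono_box_forms[OF b] _ _ j] by blast
    qed
  qed
  then have "(P - quad ?N * R) + quad ?N * R \<in> qrel ?N (r * p) d" by (intro qrel_add qrel_quad R)
  then show ?thesis by simp
qed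

lemma forms_deg_bigs:
  assumes "P \<in> forms N d" "d > int N * int (q - 1)" "q > 0" shows "P \<in> bigs q"
proof -
  have "m \<in> big q" if m: "m \<in> mons N d" for m
  proof (rule ccontr)
    assume "m \<notin> big q"
    then have "m \<in> box N q" using m by (auto simp: box_def mons_def big_def not_le)
    then have "int (mdeg m) \<le> int (N * (q - 1))" using box_mdeg by (simp only: of_nat_le_iff)
    then show False using m assms(2) by (simp add: mons_def)
  qed
  then show ?thesis using assms(1) unfolding forms_def bigs_def pdom_def by blast
qed

text \<open>Above degree \<open>n (q - 1)\<close> the power \<open>Q\<^bsup>q-1\<^esup>\<close> leads beyond the socle degree, so it kills everything; the
  Lefschetz property then says that everything is a multiple of \<open>Q\<close>. The Lefschetz property for \<open>q = r p\<close> in turn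
  uses the present statement for \<open>r\<close>.\<close>

lemma quad_top:
  assumes p: "prime p" "CHAR('k::field) = p" "odd p" and n: "n \<ge> 2"
    and P: "(P :: 'k mpoly) \<in> forms (n + 2) d" "d > int n * int (p ^ s - 1)"
  shows "P \<in> qrel (n + 2) (p ^ s) d"
  using P
proof (induction s arbitrary: P d)
  case 0
  then show ?case using forms_deg_bigs[of P "n + 2" d 1] by (intro qrel_bigs) auto
next
  case (Suc s)
  let ?r = "p ^ s"
  have r1: "?r \<ge> 1" and q0: "?r * p > 0" using p(1) by (simp_all add: prime_gt_0_nat Suc_leI)
  have p2: "p \<ge> 2" using p(1) by (rule prime_ge_2_nat)
  have q1: "int (?r * p - 1) = int ?r * int p - 1" using q0 by (simp add: of_nat_diff)
  have "quad (n + 2) ^ (?r * p - 1) * P \<in> bigs (?r * p)"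
    by (rule forms_deg_bigs[OF forms_mult[OF quad_pow_forms Suc.prems(1)] _ q0])
      (use Suc.prems(2) in \<open>simp add: algebra_simps\<close>)
  moreover have "d > int n * int (?r - 1) + int ?r * int ((n + 2) * ((p - 1) div 2))"
  proof -
    obtain h where h: "p = 2 * h + 1" using p(3) by (auto elim: oddE)
    have h': "(p - 1) div 2 = h" using h by simp
    have "(int n + 2) * int h \<le> 2 * int n * int h" using n by (intro mult_right_mono) auto
    then have "int ?r * ((int n + 2) * int h) \<le> int ?r * (2 * int n * int h)" by (rule mult_left_mono) simp
    moreover have "int ?r * (2 * int n * int h) + int n * int (?r - 1) = int n * int (?r * p - 1)"
    proof -
      have pp: "int p = 2 * int h + 1" using h by simp
      have rr: "int (?r - 1) = int ?r - 1" using r1 by (simp only: of_nat_diff of_nat_1)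
      show ?thesis unfolding q1 pp rr by (simp add: algebra_simps)
    qed
    moreover have "int ?r * int ((n + 2) * h) = int ?r * ((int n + 2) * int h)"
      by (simp only: of_nat_mult of_nat_add of_nat_numeral)
    moreover have "d > int n * int (?r * p - 1)" using Suc.prems(2) by (simp add: mult.commute)
    ultimately show ?thesis unfolding h' by linarith
  qed
  ultimately show ?case using lefschetz_high_step[OF p refl Suc.IH Suc.prems(1)] by (simp add: mult.commute)
qed

lemma lefschetz_high:
  assumes p: "prime p" "CHAR('k::field) = p" "odd p" and n: "n \<ge> 2"
    and P: "(P :: 'k mpoly) \<in> forms (n + 2) d" "quad (n + 2) ^ (p ^ s * p - 1) * P \<in> bigs (p ^ s * p)"
    and d: "d > int n * int (p ^ s - 1) + int (p ^ s) * int ((n + 2) * ((p - 1) div 2))"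
  shows "P \<in> qrel (n + 2) (p ^ s * p) d"
  by (rule lefschetz_high_step[OF p refl quad_top[OF p n] P d]) auto

section \<open>Dimensions and duality\<close>

text \<open>The dimension of the degree \<open>d\<close> part of \<open>S / (Q, x\<^sub>0\<^sup>q, x\<^sub>1\<^sup>q, ...)\<close>; the type argument carries
  the field.\<close>

definition hdim :: "'k::field itself \<Rightarrow> nat \<Rightarrow> nat \<Rightarrow> int \<Rightarrow> nat" where
  "hdim T N q d = mp.codim (forms N d :: 'k mpoly set) (qrel N q d)"

text \<open>The dimension of the degree \<open>d\<close> part of \<open>S / (x\<^sub>0\<^sup>q, x\<^sub>1\<^sup>q, ...)\<close>, which does not depend on the field.\<close>

definition adim :: "nat \<Rightarrow> nat \<Rightarrow> int \<Rightarrow> nat" where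
  "adim N q d = card (mons N d - big q)"

text \<open>The rank of multiplication by \<open>Q\<^sup>e\<close> on the degree \<open>d\<close> part of \<open>S / (x\<^sub>0\<^sup>q, x\<^sub>1\<^sup>q, ...)\<close>.\<close>

definition rk :: "'k::field itself \<Rightarrow> nat \<Rightarrow> nat \<Rightarrow> nat \<Rightarrow> int \<Rightarrow> nat" where
  "rk T N q e d = mp.codim (forms N d :: 'k mpoly set) {u \<in> forms N d. quad N ^ e * u \<in> bigs q}"

definition top_expo :: "nat \<Rightarrow> nat \<Rightarrow> expo" where
  "top_expo N q = (\<Sum>i<N. Poly_Mapping.single i (q - 1))"

lemma lookup_top: "Poly_Mapping.lookup (top_expo N q) i = (if i < N then q - 1 else 0)"
  by (simp add: top_expo_def lookup_sum lookup_single when_def)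

text \<open>The socle pairing of the truncated ring is perfect: \<open>top_expo\<close> is the exponent of its socle
  generator.\<close>

lemma top_pairing:
  assumes q: "q > 0" and P: "(P :: 'k::field mpoly) \<in> forms N d" and dd: "d + d' = int N * int (q - 1)"
  shows "(\<forall>v \<in> forms N d'. Poly_Mapping.lookup (P * v) (top_expo N q) = 0) \<longleftrightarrow> P \<in> bigs q"
proof
  assume "P \<in> bigs q"
  then have "P * v \<in> bigs q" for v by (rule bigs_mult(1))
  moreover have "top_expo N q \<notin> big q" using q by (auto simp: big_def lookup_top)
  ultimately show "\<forall>v \<in> forms N d'. Poly_Mapping.lookup (P * v) (top_expo N q) = 0"
    unfolding bigs_def pdom_iff by blast
next
  assume H: "\<forall>v \<in> forms N d'. Poly_Mapping.lookup (P * v) (top_expo N q) = 0"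
  have "Poly_Mapping.lookup P m = 0" if m: "m \<notin> big q" for m
  proof (cases "m \<in> mons N d")
    case True
    let ?c = "top_expo N q - m"
    have le: "Poly_Mapping.lookup m i \<le> Poly_Mapping.lookup (top_expo N q) i" for i
      using m True by (auto simp: lookup_top big_def mons_def not_le in_keys_iff subset_iff Suc_le_eq
          intro: order.trans[OF less_imp_le] Suc_leI le_diff_iff[THEN iffD1] dest: spec[of _ i])
    have t: "top_expo N q = ?c + m" using le by (intro poly_mapping_eqI) (simp add: lookup_add lookup_minus)
    have tm: "int (mdeg (top_expo N q)) = int N * int (q - 1)"
      using mdeg_eq[of "top_expo N q" N] by (simp add: lookup_top in_keys_iff subset_iff)
    have "?c \<in> mons N d'"
    proof -
      have "int (mdeg (top_expo N q)) = int (mdeg ?c) + int (mdeg m)" by (subst t) (simp add: mdeg_add)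
      moreover have "Poly_Mapping.keys ?c \<subseteq> {..<N}"
        by (auto simp: in_keys_iff lookup_minus lookup_top split: if_splits)
      ultimately show ?thesis using True tm dd by (simp add: mons_def)
    qed
    then have "Poly_Mapping.lookup (P * mono ?c) (top_expo N q) = 0"
      using H mono_pdom unfolding forms_def by blast
    then show ?thesis by (subst (asm) t) (simp add: mult.commute[of P])
  next
    case False
    then show ?thesis using P by (simp add: forms_def pdom_iff)
  qed
  then show "P \<in> bigs q" by (auto simp: bigs_def pdom_iff)
qed

text \<open>The bilinear form sending \<open>u, v\<close> to the socle coefficient of \<open>Q\<^sup>e u v\<close> has the
  kernels of \<open>Q\<^sup>e\<close> in the two degrees as its radicals.\<close>

lemma rk_duality_le:
  assumes q: "q > 0" and dd: "d + d' + 2 * int e = int N * int (q - 1)"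
  shows "rk T N q e d \<le> rk (T :: 'k::field itself) N q e d'"
proof -
  let ?b = "\<lambda>u v :: 'k mpoly. Poly_Mapping.lookup (quad N ^ e * u * v) (top_expo N q)"
  have 1: "(\<forall>v \<in> forms N d'. ?b u v = 0) \<longleftrightarrow> quad N ^ e * u \<in> bigs q" if "u \<in> forms N d" for u
    by (rule top_pairing[OF q forms_mult[OF quad_pow_forms that]]) (use dd in simp)
  have 2: "(\<forall>u \<in> forms N d. ?b u v = 0) \<longleftrightarrow> quad N ^ e * v \<in> bigs q" if "v \<in> forms N d'" for v
    using top_pairing[OF q forms_mult[OF quad_pow_forms[of N e] that], of d] dd by (simp add: mult_ac)
  have "mp.codim (forms N d) {u \<in> forms N d. \<forall>v \<in> forms N d'. ?b u v = 0}
      \<le> mp.codim (forms N d') {v \<in> forms N d'. \<forall>u \<in> forms N d. ?b u v = 0}"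
    by (rule mp.codim_bilinear_le[OF forms_fin_dim forms_sub forms_fin_dim forms_sub])
      (simp_all add: distrib_left distrib_right lookup_add lookup_mconst mult.left_commute[of _ "mconst _"] mult.assoc)
  then show ?thesis using 1 2 unfolding rk_def by (simp cong: conj_cong)
qed

lemma rk_duality:
  assumes "q > 0" "d + d' + 2 * int e = int N * int (q - 1)"
  shows "rk T N q e d = rk T N q e d'"
proof (rule order.antisym)
  have "d' + d + 2 * int e = int N * int (q - 1)" using assms(2) by simp
  then show "rk T N q e d' \<le> rk T N q e d" by (rule rk_duality_le[OF assms(1)])
qed (rule rk_duality_le[OF assms])

lemma rk_0: "rk T N q 0 d = adim N q d"
proof -
  have "{u \<in> forms N d. quad N ^ 0 * u \<in> bigs q} = (pdom (mons N d \<inter> big q) :: 'a mpoly set)"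
    by (auto simp: forms_def bigs_def pdom_def)
  then show ?thesis unfolding rk_def adim_def forms_def
    by (simp add: codim_pdom mons_finite) (metis Diff_Int_distrib Diff_Int Diff_cancel Un_empty_left)
qed

lemma adim_symm: "q > 0 \<Longrightarrow> d + d' = int N * int (q - 1) \<Longrightarrow> adim N q d = adim N q d'"
  using rk_duality[of q d d' 0 N "TYPE(rat)"] by (simp add: rk_0)

lemma qrel_eq_image:
  "(qrel N q d :: 'k::field mpoly set) = {quad N * v + l | v l. v \<in> forms N (d - 2) \<and> l \<in> bigs q \<inter> forms N d}"
  (is "?A = ?B")
proof
  show "?A \<subseteq> ?B"
  proof
    fix P :: "'k mpoly" assume "P \<in> ?A"
    then obtain R where R: "R \<in> forms N (d - 2)" "P - quad N * R \<in> bigs q" "P \<in> forms N d"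
      by (auto simp: qrel_def)
    have "P - quad N * R \<in> forms N d" using forms_mult[OF quad_forms R(1)] by (intro forms_diff R) simp
    then have "quad N * R + (P - quad N * R) \<in> ?B" using R by blast
    then show "P \<in> ?B" by simp
  qed
  show "?B \<subseteq> ?A"
  proof
    fix P assume "P \<in> ?B"
    then obtain v l where *: "P = quad N * v + l" "v \<in> forms N (d - 2)" "l \<in> bigs q" "l \<in> forms N d" by auto
    show "P \<in> ?A" unfolding *(1) by (rule qrel_add[OF qrel_quad[OF *(2)] qrel_bigs[OF *(4,3)]])
  qed
qed

lemma adim_eq: "adim N q d = hdim (T :: 'k::field itself) N q d + rk T N q 1 (d - 2)"
proof -
  let ?V = "forms N d :: 'k mpoly set"
  have J: "{u \<in> forms N (d - 2). quad N * u \<in> bigs q} = {u \<in> forms N (d - 2). quad N * u \<in> bigs q \<inter> ?V}"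
  proof -
    have "quad N * u \<in> ?V" if "u \<in> forms N (d - 2)" for u :: "'k mpoly"
      using forms_mult[OF quad_forms that] by simp
    then show ?thesis by auto
  qed
  have "adim N q d = mp.codim ?V (bigs q \<inter> ?V)"
    unfolding rk_0[symmetric, of _ _ _ T] rk_def by (simp add: Int_def conj_commute)
  also have "\<dots> = mp.codim ?V (qrel N q d) + mp.codim (qrel N q d :: 'k mpoly set) (bigs q \<inter> ?V)"
    by (rule mp.codim_trans[OF forms_fin_dim]) (auto intro: qrel_bigs qrel_forms)
  also have "mp.codim (qrel N q d :: 'k mpoly set) (bigs q \<inter> ?V) = rk T N q 1 (d - 2)"
    unfolding rk_def power_one_right J qrel_eq_image
    by (rule mp.codim_image[OF forms_fin_dim forms_sub mp.fin_dim_subset[OF forms_fin_dim[of N d]]])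
      (auto intro: mp.subspace_inter bigs_sub forms_sub simp: distrib_left mult.left_commute)
  finally show ?thesis by (simp add: hdim_def)
qed

text \<open>The two values of \<open>hdim\<close> are the coranks of multiplication by \<open>Q\<close> on the degrees \<open>d - 2\<close> and \<open>\<sigma> - d\<close>,
  where \<open>\<sigma> = N (q - 1)\<close>, and the two ranks agree by \<open>rk_duality\<close>.\<close>

lemma hdim_duality:
  assumes q: "q > 0"
  shows "hdim T N q d + adim N q (d - 2) = adim N q d + hdim T N q (int N * int (q - 1) - d + 2)"
proof -
  let ?s = "int N * int (q - 1)"
  have "rk T N q 1 (d - 2) = rk T N q 1 (?s - d)" by (rule rk_duality[OF q]) simp
  moreover have "adim N q (d - 2) = adim N q (?s - d + 2)" by (rule adim_symm[OF q]) simp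
  ultimately show ?thesis using adim_eq[of N q d T] adim_eq[of N q "?s - d + 2" T] by simp
qed

lemma qrel_killed:
  assumes p: "prime p" "CHAR('k::field) = p" and P: "(P :: 'k mpoly) \<in> qrel N (p ^ s) d"
  shows "quad N ^ (p ^ s - 1) * P \<in> bigs (p ^ s)"
proof -
  obtain R where R: "P - quad N * R \<in> bigs (p ^ s)" using P by (auto simp: qrel_def)
  have "p ^ s > 0" using p by (simp add: prime_gt_0_nat)
  then have "quad N ^ (p ^ s) = quad N ^ (p ^ s - 1) * (quad N :: 'k mpoly)" by (metis power_minus_mult)
  then have "quad N ^ (p ^ s - 1) * P = quad N ^ (p ^ s - 1) * (P - quad N * R) + quad N ^ (p ^ s) * R"
    by (simp add: algebra_simps)
  also have "\<dots> \<in> bigs (p ^ s)"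
    by (intro bigs_add bigs_mult(2)[OF R] bigs_mult(1)[OF quad_pow_bigs[OF p]])
  finally show ?thesis .
qed

text \<open>Since \<open>Q\<^sup>q\<close> lies in the ideal of the \<open>q\<close>-th powers of the variables, \<open>Q\<^bsup>q-1\<^esup>\<close> kills every multiple of \<open>Q\<close>.\<close>

lemma rk_le_hdim:
  assumes p: "prime p" "CHAR('k::field) = p"
  shows "rk (T :: 'k itself) N (p ^ s) (p ^ s - 1) d \<le> hdim T N (p ^ s) d"
  unfolding rk_def hdim_def
  by (rule mp.codim_antimono[OF forms_fin_dim]) (use qrel_killed[OF p] qrel_forms in blast)+

lemma rk_eq_hdim:
  assumes p: "prime p" "CHAR('k::field) = p"
    and L: "\<And>P :: 'k mpoly. P \<in> forms N d \<Longrightarrow> quad N ^ (p ^ s - 1) * P \<in> bigs (p ^ s) \<Longrightarrow> P \<in> qrel N (p ^ s) d"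
  shows "hdim (T :: 'k itself) N (p ^ s) d = rk T N (p ^ s) (p ^ s - 1) d"
proof -
  have "{u \<in> forms N d. quad N ^ (p ^ s - 1) * u \<in> bigs (p ^ s)} = (qrel N (p ^ s) d :: 'k mpoly set)"
    using L qrel_killed[OF p, of _ N s d] qrel_forms[of _ N "p ^ s" d] by blast
  then show ?thesis unfolding rk_def hdim_def by simp
qed

lemma hdim_high:
  assumes p: "prime p" "CHAR('k::field) = p" "odd p" and n: "n \<ge> 2"
    and d: "d > int n * int (p ^ s - 1) + int (p ^ s) * int ((n + 2) * ((p - 1) div 2))"
  shows "hdim (T :: 'k itself) (n + 2) (p ^ Suc s) d = rk T (n + 2) (p ^ Suc s) (p ^ Suc s - 1) d"
  by (rule rk_eq_hdim[OF p(1,2)])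
    (use lefschetz_high[OF p n _ _ d] in \<open>simp add: mult.commute\<close>)

lemma hdim_low:
  assumes p: "prime p" "CHAR('k::field) = p" "odd p"
    and d: "d + 2 * int (p ^ s - 1) < int (p ^ s) * (int (N * ((p - 1) div 2)) - int p + 2)"
  shows "hdim (T :: 'k itself) N (p ^ Suc s) d = rk T N (p ^ Suc s) (p ^ Suc s - 1) d"
  by (rule rk_eq_hdim[OF p(1,2)])
    (use lefschetz_low[OF p refl _ _ d] in \<open>simp add: mult.commute\<close>)

lemma hdim_top:
  assumes p: "prime p" "CHAR('k::field) = p" "odd p" and n: "n \<ge> 2" and d: "d > int n * int (p ^ s - 1)"
  shows "hdim (T :: 'k itself) (n + 2) (p ^ s) d = 0"
proof -
  have "qrel (n + 2) (p ^ s) d = (forms (n + 2) d :: 'k mpoly set)"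
    using quad_top[OF p n _ d] qrel_forms by blast
  then show ?thesis by (simp add: hdim_def)
qed

lemma hdim_neg: "d < 0 \<Longrightarrow> hdim (T :: 'k::field itself) N q d = 0"
proof -
  assume "d < 0"
  then have "qrel N q d = (forms N d :: 'k mpoly set)"
    using qrel_forms[of _ N q d] qrel_0[of N q d] by (auto simp: forms_neg_deg)
  then show ?thesis by (simp add: hdim_def)
qed

section \<open>Counting box monomials\<close>

lemma adim_neg: "d < 0 \<Longrightarrow> adim N q d = 0" by (simp add: adim_def mons_neg)

lemma adim_0: "adim 0 q d = (if d = 0 \<and> q > 0 then 1 else 0)"
proof -
  have "mons 0 d - big q = (if d = 0 \<and> q > 0 then {0} else {})"
    by (auto simp: mons_def big_def)
  then show ?thesis by (simp add: adim_def)
qed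

lemma adim_Suc: "adim (Suc N) q d = (\<Sum>j<q. adim N q (d - int j))"
proof -
  have "mons (Suc N) d - big q = (\<Union>j<q. (\<lambda>m. m + Poly_Mapping.single N j) ` (mons N (d - int j) - big q))"
    (is "?A = ?B")
  proof
    show "?B \<subseteq> ?A" using shift_mem[of _ N] by (auto simp: mons_def)
    show "?A \<subseteq> ?B"
    proof
      fix m assume m: "m \<in> ?A"
      let ?j = "Poly_Mapping.lookup m N" and ?m = "m - Poly_Mapping.single N (Poly_Mapping.lookup m N)"
      have e: "?m + Poly_Mapping.single N ?j = m"
        by (intro poly_mapping_eqI) (auto simp: lookup_add lookup_minus lookup_single when_def)
      have k: "Poly_Mapping.keys ?m \<subseteq> {..<N}"
      proof
        fix i assume i: "i \<in> Poly_Mapping.keys ?m"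
        then have "i \<in> Poly_Mapping.keys m" "i \<noteq> N" by (auto simp: in_keys_iff lookup_minus)
        then show "i \<in> {..<N}" using m by (auto simp: mons_def)
      qed
      have "?m \<in> mons N (d - int ?j) - big q" using shift_mem[OF k, of ?j] m unfolding e by blast
      moreover have "?j < q" using m by (auto simp: big_def not_le)
      ultimately show "m \<in> ?B" using e by (metis (no_types, lifting) UN_I image_eqI lessThan_iff)
    qed
  qed
  moreover have "card ?B = (\<Sum>j<q. card ((\<lambda>m. m + Poly_Mapping.single N j) ` (mons N (d - int j) - big q)))"
  proof (rule card_UN_disjoint)
    show "\<forall>i\<in>{..<q}. \<forall>j\<in>{..<q}. i \<noteq> j \<longrightarrow>
      (\<lambda>m. m + Poly_Mapping.single N i) ` (mons N (d - int i) - big q) \<inter> (\<lambda>m. m + Poly_Mapping.single N j) ` (mons N (d - int j) - big q) = {}"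
    proof (intro ballI impI equals0I)
      fix i j x assume ij: "i \<noteq> j"
        and "x \<in> (\<lambda>m. m + Poly_Mapping.single N i) ` (mons N (d - int i) - big q) \<inter> (\<lambda>m. m + Poly_Mapping.single N j) ` (mons N (d - int j) - big q)"
      then obtain a b where ab: "a \<in> mons N (d - int i)" "b \<in> mons N (d - int j)" "x = a + Poly_Mapping.single N i" "x = b + Poly_Mapping.single N j"
        by auto
      have "Poly_Mapping.lookup a N = 0" "Poly_Mapping.lookup b N = 0" using ab(1,2) by (auto simp: mons_def in_keys_iff)
      then have "Poly_Mapping.lookup (a + Poly_Mapping.single N i) N = i" "Poly_Mapping.lookup (b + Poly_Mapping.single N j) N = j"
        by (simp_all add: lookup_add)
      then show False using ij unfolding ab(3)[symmetric] ab(4)[symmetric] by simp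
    qed
  qed (simp_all add: mons_finite)
  moreover have "card ((\<lambda>m. m + Poly_Mapping.single N j) ` (mons N (d - int j) - big q)) = adim N q (d - int j)" for j
    unfolding adim_def by (rule card_image) (auto intro: inj_onI)
  ultimately show ?thesis by (simp add: adim_def)
qed

lemma adim_diff: "int (adim (Suc N) q d) - int (adim (Suc N) q (d - 1)) = int (adim N q d) - int (adim N q (d - int q))"
proof -
  have "(\<Sum>j<q. f (d - int j) :: int) - (\<Sum>j<q. f (d - 1 - int j)) = f d - f (d - int q)" for f
    by (induction q) (simp_all add: algebra_simps)
  from this[of "\<lambda>d. int (adim N q d)"] show ?thesis unfolding adim_Suc by simp
qed

text \<open>The exponents of all but one variable determine the last one.\<close>

lemma adim_bound: "adim (Suc N) q d \<le> q ^ N"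
proof (induction N arbitrary: d)
  case 0
  have "(\<Sum>j<q. adim 0 q (d - int j)) \<le> (\<Sum>j<q. if j = nat d then 1 else 0)"
    by (intro sum_mono) (auto simp: adim_0)
  then show ?case unfolding adim_Suc[of 0] by (simp split: if_splits)
next
  case (Suc N)
  have "(\<Sum>j<q. adim (Suc N) q (d - int j)) \<le> (\<Sum>j<q. q ^ N)" by (intro sum_mono Suc.IH)
  then show ?case unfolding adim_Suc[of "Suc N"] by simp
qed

definition adiff :: "nat \<Rightarrow> nat \<Rightarrow> int \<Rightarrow> int" where
  "adiff N q d = int (adim N q d) - int (adim N q (d - 2))"

text \<open>By \<open>adim_diff\<close> each difference in the degree removes one variable, so a second difference for \<open>N + 3\<close> variables
  is bounded like \<open>adim\<close> for \<open>N + 1\<close> variables.\<close>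

lemma adiff_step: "\<bar>adiff (Suc (Suc (Suc N))) q (d + 1) - adiff (Suc (Suc (Suc N))) q d\<bar> \<le> 4 * int (q ^ N)"
proof -
  let ?a = "\<lambda>M d. int (adim M q d)"
  let ?N = "Suc N"
  have D: "?a (Suc M) d - ?a (Suc M) (d - 1) = ?a M d - ?a M (d - int q)" for M d by (rule adim_diff)
  have "adiff (Suc (Suc ?N)) q (d + 1) - adiff (Suc (Suc ?N)) q d
      = (?a (Suc ?N) (d + 1) - ?a (Suc ?N) (d + 1 - int q)) - (?a (Suc ?N) (d - 1) - ?a (Suc ?N) (d - 1 - int q))"
    using D[of "Suc ?N" "d + 1"] D[of "Suc ?N" "d - 1"] by (simp add: adiff_def)
  also have "\<dots> = ?a ?N (d + 1) - ?a ?N (d + 1 - int q) + ?a ?N d - ?a ?N (d - int q)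
      - (?a ?N (d + 1 - int q) - ?a ?N (d + 1 - int q - int q) + ?a ?N (d - int q) - ?a ?N (d - int q - int q))"
    using D[of ?N "d + 1"] D[of ?N d] D[of ?N "d + 1 - int q"] D[of ?N "d - int q"] by (simp add: algebra_simps)
  also have "\<bar>\<dots>\<bar> \<le> 4 * int (q ^ N)"
  proof -
    have b: "0 \<le> ?a ?N x" "?a ?N x \<le> int (q ^ N)" for x using adim_bound[of N q x] by (simp_all only: of_nat_le_iff of_nat_0_le_iff)
    show ?thesis using b[of "d + 1"] b[of "d + 1 - int q"] b[of d] b[of "d - int q"] b[of "d + 1 - int q - int q"] b[of "d - int q - int q"]
      by linarith
  qed
  finally show ?thesis .
qed

section \<open>Lipschitz estimate in the degree\<close>

lemma mono_reduce:
  assumes W: "mp.subspace (W :: 'k::field mpoly set)" and m: "m \<in> mons N d" and j: "j < N" "2 \<le> Poly_Mapping.lookup m j"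
    and q: "\<And>R. R \<in> forms N (d - 2) \<Longrightarrow> quad N * R \<in> W"
    and s: "\<And>i. i < N \<Longrightarrow> i \<noteq> j \<Longrightarrow> mono (m - Poly_Mapping.single j 2 + Poly_Mapping.single i 2) \<in> W"
  shows "mono m \<in> W"
proof -
  let ?m = "m - Poly_Mapping.single j 2"
  have me: "m = ?m + Poly_Mapping.single j 2"
    using j by (intro poly_mapping_eqI) (auto simp: lookup_add lookup_minus lookup_single when_def)
  have "?m \<in> mons N (d - 2)"
  proof -
    have "int (mdeg m) = int (mdeg ?m) + 2" by (subst me) (simp add: mdeg_add)
    moreover have "Poly_Mapping.keys ?m \<subseteq> Poly_Mapping.keys m" by (auto simp: in_keys_iff lookup_minus)
    ultimately show ?thesis using m by (auto simp: mons_def)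
  qed
  then have "quad N * mono ?m \<in> W" by (intro q) (simp add: forms_def mono_pdom)
  moreover have "quad N * mono ?m = (\<Sum>i<N. mono (?m + Poly_Mapping.single i 2) :: 'k mpoly)"
    by (simp add: quad_def sum_distrib_right mvar_power mono_mult add.commute)
  moreover have "\<dots> = mono m + (\<Sum>i\<in>{..<N} - {j}. mono (?m + Poly_Mapping.single i 2) :: 'k mpoly)"
    using j by (subst sum.remove[of _ j]) (simp_all flip: me)
  ultimately have "mono m = quad N * mono ?m - (\<Sum>i\<in>{..<N} - {j}. mono (?m + Poly_Mapping.single i 2) :: 'k mpoly)" by simp
  also have "\<dots> \<in> W" using s by (intro mp.subspace_diff[OF W] mp.subspace_sum[OF W] \<open>quad N * mono ?m \<in> W\<close>) auto
  finally show ?thesis .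
qed

lemma reduce_mem:
  assumes "m \<in> mons N d" "i < N" "2 \<le> Poly_Mapping.lookup m j"
  shows "m - Poly_Mapping.single j 2 + Poly_Mapping.single i 2 \<in> mons N d"
proof -
  let ?m = "m - Poly_Mapping.single j 2"
  have me: "m = ?m + Poly_Mapping.single j 2"
    using assms by (intro poly_mapping_eqI) (auto simp: lookup_add lookup_minus lookup_single when_def)
  have "int (mdeg m) = int (mdeg ?m) + 2" by (subst me) (simp add: mdeg_add)
  moreover have "Poly_Mapping.keys ?m \<subseteq> Poly_Mapping.keys m" by (auto simp: in_keys_iff lookup_minus)
  ultimately show ?thesis using assms by (auto simp: mons_def mdeg_add keys_expo_add)
qed

text \<open>Modulo the quadric, \<open>x\<^sub>1\<^sup>2\<close> can be expressed by the other squares. So these monomials span the forms modulo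
  \<open>x\<^sub>0\<^sup>c\<close> and \<open>qrel\<close>, and for bounded \<open>c\<close> there are only \<open>O(q\<^bsup>n-1\<^esup>)\<close> of them.\<close>

definition thin :: "nat \<Rightarrow> nat \<Rightarrow> nat \<Rightarrow> int \<Rightarrow> expo set" where
  "thin N q c d = {m \<in> mons N d - big q. Poly_Mapping.lookup m 0 < c \<and> Poly_Mapping.lookup m 1 \<le> 1}"

lemma thin_finite: "finite (thin N q c d)"
  by (rule finite_subset[OF _ mons_finite[of N d]]) (auto simp: thin_def)

lemma thin_card:
  assumes "n \<ge> 1" shows "card (thin (n + 2) q c d) \<le> 2 * c * q ^ (n - 1)"
proof -
  let ?T = "{..<c} \<times> {..<2 :: nat} \<times> ({2..<n + 1} \<rightarrow>\<^sub>E {..<q})"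
  let ?f = "\<lambda>m :: expo. (Poly_Mapping.lookup m 0, Poly_Mapping.lookup m 1, restrict (Poly_Mapping.lookup m) {2..<n + 1})"
  have "?f ` thin (n + 2) q c d \<subseteq> ?T"
    by (auto simp: thin_def big_def not_le)
  moreover have "inj_on ?f (thin (n + 2) q c d)"
  proof (rule inj_onI)
    fix a b assume ab: "a \<in> thin (n + 2) q c d" "b \<in> thin (n + 2) q c d" "?f a = ?f b"
    have eq: "Poly_Mapping.lookup a i = Poly_Mapping.lookup b i" if i: "i < n + 1" for i
    proof -
      consider "i = 0" | "i = 1" | "i \<in> {2..<n + 1}" using i by fastforce
      then show ?thesis using ab(3) by cases (auto simp: fun_eq_iff restrict_def dest: spec[of _ i])
    qed
    have "int (mdeg x) = int (\<Sum>i<n + 1. Poly_Mapping.lookup x i) + int (Poly_Mapping.lookup x (n + 1))"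
      if "x \<in> thin (n + 2) q c d" for x
      using mdeg_eq[of x "n + 2"] that by (simp add: thin_def mons_def)
    note deg = this[OF ab(1)] this[OF ab(2)]
    have "(\<Sum>i<n + 1. Poly_Mapping.lookup a i) = (\<Sum>i<n + 1. Poly_Mapping.lookup b i)"
      by (rule sum.cong) (use eq in auto)
    moreover have "int (mdeg a) = int (mdeg b)" using ab(1,2) by (simp add: thin_def mons_def)
    ultimately have "Poly_Mapping.lookup a (n + 1) = Poly_Mapping.lookup b (n + 1)" using deg by simp
    then have "Poly_Mapping.lookup a i = Poly_Mapping.lookup b i" for i
    proof (cases "i < n + 2")
      case True
      then show ?thesis using eq[of i] \<open>Poly_Mapping.lookup a (n + 1) = _\<close> by (cases "i = n + 1") auto
    next
      case False
      then have "i \<notin> Poly_Mapping.keys a" "i \<notin> Poly_Mapping.keys b" using ab(1,2) by (auto simp: thin_def mons_def)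
      then show ?thesis by (simp add: in_keys_iff)
    qed
    then show "a = b" by (rule poly_mapping_eqI)
  qed
  moreover have "finite ?T" by (intro finite_cartesian_product finite_PiE) auto
  ultimately have "card (thin (n + 2) q c d) \<le> card ?T"
    by - (rule card_inj_on_le; assumption)
  also have "card ?T = c * (2 * q ^ (n - 1))"
    using assms by (simp add: card_cartesian_product card_PiE)
  finally show ?thesis by simp
qed

lemma forms_thin:
  assumes N: "2 \<le> N"
  shows "forms N d \<subseteq> mp.span (mono ` thin N q c d \<union>
    {mvar 0 ^ c * v + l | v l. v \<in> forms N (d - int c) \<and> l \<in> qrel N q d} :: 'k::field mpoly set)"
    (is "_ \<subseteq> mp.span (?X \<union> ?U)")
proof -
  let ?W = "mp.span (?X \<union> ?U)"
  have U1: "l \<in> ?W" if "l \<in> qrel N q d" for l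
  proof -
    have "l \<in> ?U" using that forms_0[of N "d - int c"]
      by (intro CollectI exI[of _ 0] exI[of _ l]) simp
    then show ?thesis by (intro mp.span_base) simp
  qed
  have U2: "mvar 0 ^ c * v \<in> ?W" if "v \<in> forms N (d - int c)" for v
  proof -
    have "mvar 0 ^ c * v \<in> ?U" using that qrel_0[of N q d]
      by (intro CollectI exI[of _ v] exI[of _ 0]) simp
    then show ?thesis by (intro mp.span_base) simp
  qed
  have "mono m \<in> ?W" if "m \<in> mons N d" for m
    using that
  proof (induction "Poly_Mapping.lookup m 1" arbitrary: m rule: less_induct)
    case less
    consider "m \<in> big q" | "c \<le> Poly_Mapping.lookup m 0" | "m \<in> thin N q c d" | "2 \<le> Poly_Mapping.lookup m 1"
      using less.prems by (force simp: thin_def)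
    then show ?case
    proof cases
      case 1
      then show ?thesis using less.prems by (intro U1 qrel_bigs) (simp_all add: forms_def bigs_def mono_pdom)
    next
      case 2
      let ?m = "m - Poly_Mapping.single 0 c"
      have me: "m = Poly_Mapping.single 0 c + ?m"
        using 2 by (intro poly_mapping_eqI) (auto simp: lookup_add lookup_minus lookup_single when_def)
      have "?m \<in> mons N (d - int c)"
      proof -
        have "int (mdeg m) = int c + int (mdeg ?m)" by (subst me) (simp add: mdeg_add)
        moreover have "Poly_Mapping.keys ?m \<subseteq> Poly_Mapping.keys m" by (auto simp: in_keys_iff lookup_minus)
        ultimately show ?thesis using less.prems by (auto simp: mons_def)
      qed
      then have "mvar 0 ^ c * mono ?m \<in> ?W" by (intro U2) (simp add: forms_def mono_pdom)
      then show ?thesis by (simp add: mvar_power mono_mult flip: me)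
    next
      case 3
      then show ?thesis by (intro mp.span_base) simp
    next
      case 4
      show ?thesis
      proof (rule mono_reduce[OF mp.subspace_span less.prems _ 4])
        show "1 < N" using N by simp
        show "quad N * R \<in> ?W" if "R \<in> forms N (d - 2)" for R by (intro U1 qrel_quad that)
        show "mono (m - Poly_Mapping.single 1 2 + Poly_Mapping.single i 2) \<in> ?W" if "i < N" "i \<noteq> 1" for i
          by (rule less.hyps[OF _ reduce_mem[OF less.prems that(1) 4]])
            (use 4 that in \<open>simp add: lookup_add lookup_minus lookup_single when_def\<close>)
      qed
    qed
  qed
  then show ?thesis unfolding forms_def[of N d] pdom_span
    by (intro mp.span_minimal mp.subspace_span) auto
qed

text \<open>Multiplication by \<open>x\<^sub>0\<close> maps onto the next degree up to the span of the thin monomials.\<close>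

lemma hdim_step_upper:
  assumes n: "n \<ge> 1"
  shows "hdim (T :: 'k::field itself) (n + 2) q d \<le> 2 * q ^ (n - 1) + hdim T (n + 2) q (d - 1)"
proof -
  let ?V = "forms (n + 2) d :: 'k mpoly set" and ?J = "qrel (n + 2) q d :: 'k mpoly set"
  let ?U = "{mvar 0 ^ 1 * v + l | v l. v \<in> forms (n + 2) (d - int 1) \<and> l \<in> ?J}"
  have v: "mvar 0 ^ 1 * v \<in> ?V" if "v \<in> forms (n + 2) (d - int 1)" for v :: "'k mpoly"
    using forms_mult[OF mvar_forms[of 0 "n + 2"] that] by simp
  have UV: "?U \<subseteq> ?V"
  proof
    fix P assume "P \<in> ?U"
    then obtain w l where *: "P = mvar 0 ^ 1 * w + l" "w \<in> forms (n + 2) (d - int 1)" "l \<in> ?J" by blast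
    show "P \<in> ?V" unfolding *(1) by (rule forms_add[OF v[OF *(2)] qrel_forms[OF *(3)]])
  qed
  have JU: "?J \<subseteq> ?U"
  proof
    fix l assume "l \<in> ?J"
    then show "l \<in> ?U" using forms_0[of "n + 2" "d - int 1"]
      by (intro CollectI exI[of _ 0] exI[of _ l]) simp
  qed
  have fJ: "mp.fin_dim ?J" by (rule mp.fin_dim_subset[OF forms_fin_dim]) (auto intro: qrel_forms)
  have "mp.codim ?V ?U \<le> card (mono ` thin (n + 2) q 1 d :: 'k mpoly set)"
    by (rule mp.codim_le[OF forms_thin _ mp.fin_dim_subset[OF forms_fin_dim UV]]) (simp_all add: thin_finite)
  also have "\<dots> \<le> card (thin (n + 2) q 1 d)" by (rule card_image_le[OF thin_finite])
  also have "\<dots> \<le> 2 * q ^ (n - 1)" using thin_card[OF n, of q 1 d] by simp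
  finally have 1: "mp.codim ?V ?U \<le> 2 * q ^ (n - 1)" .
  have "mp.codim ?U ?J = mp.codim (forms (n + 2) (d - int 1)) {v \<in> forms (n + 2) (d - int 1). mvar 0 ^ 1 * v \<in> ?J}"
    by (rule mp.codim_image[OF forms_fin_dim forms_sub fJ qrel_sub]) (simp_all add: distrib_left mult.left_commute)
  also have "\<dots> \<le> mp.codim (forms (n + 2) (d - int 1)) (qrel (n + 2) q (d - int 1) :: 'k mpoly set)"
  proof (rule mp.codim_antimono[OF forms_fin_dim])
    show "qrel (n + 2) q (d - int 1) \<subseteq> {v \<in> forms (n + 2) (d - int 1). mvar 0 ^ 1 * v \<in> ?J}"
      using qrel_forms qrel_mult[OF _ mvar_forms[of 0 "n + 2"], of _ q "d - 1"] by auto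
  qed auto
  finally have 2: "mp.codim ?U ?J \<le> hdim T (n + 2) q (d - 1)" by (simp add: hdim_def)
  have "hdim T (n + 2) q d = mp.codim ?V ?U + mp.codim ?U ?J"
    unfolding hdim_def by (rule mp.codim_trans[OF forms_fin_dim JU UV])
  then show ?thesis using 1 2 by simp
qed

text \<open>The upper bound is \<open>hdim_step_upper\<close>; the duality \<open>hdim_duality\<close> turns it into a lower bound.\<close>

lemma hdim_step:
  assumes n: "n \<ge> 1" and q: "q > 0"
  shows "\<bar>int (hdim (T :: 'k::field itself) (n + 2) q (d + 1)) - int (hdim T (n + 2) q d)\<bar> \<le> 6 * int (q ^ (n - 1))"
proof -
  let ?h = "\<lambda>d. int (hdim T (n + 2) q d)" and ?s = "int (n + 2) * int (q - 1)" and ?Q = "int (q ^ (n - 1))"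
  have up: "?h e \<le> 2 * ?Q + ?h (e - 1)" for e
  proof -
    have "int (hdim T (n + 2) q e) \<le> int (2 * q ^ (n - 1) + hdim T (n + 2) q (e - 1))"
      by (rule of_nat_mono[OF hdim_step_upper[OF n]])
    then show ?thesis by (simp only: of_nat_add of_nat_mult of_nat_numeral)
  qed
  have dual: "?h e = adiff (n + 2) q e + ?h (?s - e + 2)" for e
  proof -
    have "int (hdim T (n + 2) q e + adim (n + 2) q (e - 2)) = int (adim (n + 2) q e + hdim T (n + 2) q (?s - e + 2))"
      using hdim_duality[OF q, of T "n + 2" e] by simp
    then show ?thesis by (simp only: adiff_def of_nat_add)
  qed
  have "n + 2 = Suc (Suc (Suc (n - 1)))" using n by simp
  then have a: "\<bar>adiff (n + 2) q (d + 1) - adiff (n + 2) q d\<bar> \<le> 4 * ?Q" using adiff_step[of "n - 1" q d] by simp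
  have "?s - (d + 1) + 2 = (?s - d + 2) - 1" by simp
  then have "?h (?s - d + 2) \<le> 2 * ?Q + ?h (?s - (d + 1) + 2)" using up[of "?s - d + 2"] by simp
  moreover have "?h (d + 1) \<le> 2 * ?Q + ?h d" using up[of "d + 1"] by simp
  moreover have "0 \<le> ?Q" by simp
  ultimately show ?thesis using dual[of d] dual[of "d + 1"] a by linarith
qed

lemma hdim_lipschitz:
  assumes n: "n \<ge> 1" and q: "q > 0"
  shows "\<bar>int (hdim (T :: 'k::field itself) (n + 2) q d) - int (hdim T (n + 2) q e)\<bar> \<le> 6 * int (q ^ (n - 1)) * \<bar>d - e\<bar>"
proof -
  have *: "\<bar>int (hdim T (n + 2) q (e + int k)) - int (hdim T (n + 2) q e)\<bar> \<le> 6 * int (q ^ (n - 1)) * int k" for k e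
  proof (induction k)
    case (Suc k)
    have "e + int (Suc k) = e + int k + 1" by simp
    then have "\<bar>int (hdim T (n + 2) q (e + int (Suc k))) - int (hdim T (n + 2) q (e + int k))\<bar> \<le> 6 * int (q ^ (n - 1))"
      using hdim_step[OF n q, of T "e + int k"] by (simp only:)
    moreover have "6 * int (q ^ (n - 1)) * int (Suc k) = 6 * int (q ^ (n - 1)) * int k + 6 * int (q ^ (n - 1))"
      by (simp only: of_nat_Suc distrib_left mult_1_right add.commute)
    ultimately show ?case using Suc.IH by linarith
  qed simp
  show ?thesis
  proof (cases "e \<le> d")
    case True
    then show ?thesis using *[of e "nat (d - e)"] by simp
  next
    case False
    then show ?thesis using *[of d "nat (e - d)"] by (simp add: abs_minus_commute)
  qed
qed

section \<open>Growth under Frobenius\<close>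

text \<open>A form divisible by \<open>x\<^sub>0\<^bsup>p-1\<^esup>\<close> only needs exponents of \<open>x\<^sub>0\<close> that are 0 or \<open>p\<close>: the quadric expresses an even power
  of \<open>x\<^sub>0\<close> by the other variables, and an odd power contains \<open>x\<^sub>0\<^sup>p\<close>. So box monomials without \<open>x\<^sub>0\<close> generate such
  forms over the polynomials in the \<open>p\<close>-th powers, and the degree modulo \<open>p\<close> determines one more exponent.\<close>

definition frob_box :: "nat \<Rightarrow> nat \<Rightarrow> int \<Rightarrow> expo set" where
  "frob_box N p d = {b \<in> box N p. Poly_Mapping.lookup b 0 = 0 \<and> int p dvd d - int (mdeg b)}"

lemma frob_box_finite: "finite (frob_box N p d)"
  by (rule finite_subset[OF _ box_finite[of N p]]) (auto simp: frob_box_def)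

lemma frob_box_card: "card (frob_box (n + 2) p d) \<le> p ^ n"
proof -
  let ?T = "{1..<n + 1} \<rightarrow>\<^sub>E {..<p}"
  let ?f = "\<lambda>m :: expo. restrict (Poly_Mapping.lookup m) {1..<n + 1}"
  have 1: "?f ` frob_box (n + 2) p d \<subseteq> ?T" by (auto simp: frob_box_def box_def)
  have 2: "inj_on ?f (frob_box (n + 2) p d)"
  proof (rule inj_onI)
    fix a b assume ab: "a \<in> frob_box (n + 2) p d" "b \<in> frob_box (n + 2) p d" "?f a = ?f b"
    have eq: "Poly_Mapping.lookup a i = Poly_Mapping.lookup b i" if i: "i < n + 1" for i
    proof (cases "i = 0")
      case True
      then show ?thesis using ab by (simp add: frob_box_def)
    next
      case False
      then show ?thesis using fun_cong[OF ab(3), of i] i by simp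
    qed
    have "mdeg x = (\<Sum>i<n + 1. Poly_Mapping.lookup x i) + Poly_Mapping.lookup x (n + 1)"
      if "x \<in> frob_box (n + 2) p d" for x
      using mdeg_eq[of x "n + 2"] that by (simp add: frob_box_def box_def)
    note deg = this[OF ab(1)] this[OF ab(2)]
    have s: "(\<Sum>i<n + 1. Poly_Mapping.lookup a i) = (\<Sum>i<n + 1. Poly_Mapping.lookup b i)"
      by (rule sum.cong) (use eq in auto)
    have "int p dvd (d - int (mdeg a)) - (d - int (mdeg b))"
      by (rule dvd_diff) (use ab(1,2) in \<open>simp_all add: frob_box_def\<close>)
    then have dv: "int p dvd int (Poly_Mapping.lookup b (n + 1)) - int (Poly_Mapping.lookup a (n + 1))"
      unfolding deg s by (simp add: algebra_simps)
    have "Poly_Mapping.lookup a (n + 1) < p" "Poly_Mapping.lookup b (n + 1) < p"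
      using ab(1,2) by (auto simp: frob_box_def box_def)
    then have "int (Poly_Mapping.lookup b (n + 1)) - int (Poly_Mapping.lookup a (n + 1)) = 0"
      using dvd_imp_le_int[OF _ dv] by linarith
    then have l: "Poly_Mapping.lookup a (n + 1) = Poly_Mapping.lookup b (n + 1)" by simp
    have "Poly_Mapping.lookup a i = Poly_Mapping.lookup b i" for i
    proof (cases "i < n + 2")
      case True
      then show ?thesis using eq[of i] l by (cases "i = n + 1") auto
    next
      case False
      then have "i \<notin> Poly_Mapping.keys a" "i \<notin> Poly_Mapping.keys b" using ab(1,2) by (auto simp: frob_box_def box_def)
      then show ?thesis by (simp add: in_keys_iff)
    qed
    then show "a = b" by (rule poly_mapping_eqI)
  qed
  have "finite ?T" by (intro finite_PiE) auto
  then have "card (frob_box (n + 2) p d) \<le> card ?T" by (rule card_inj_on_le[OF 2 1])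
  then show ?thesis by (simp add: card_PiE)
qed

text \<open>Up to \<open>O(q\<^bsup>n-1\<^esup>)\<close> thin monomials, the forms of degree \<open>D\<close> are spanned modulo \<open>qrel\<close> by products of
  box monomials with Frobenius stretched forms of lower degree, and stretching maps \<open>qrel\<close> at \<open>q\<close> into \<open>qrel\<close>
  at \<open>p q\<close>.\<close>

lemma hdim_frobenius:
  assumes p: "prime p" "CHAR('k::field) = p" "odd p" and n: "n \<ge> 1"
  shows "hdim (T :: 'k itself) (n + 2) (p * q) D \<le> 2 * (p - 1) * (p * q) ^ (n - 1) +
    (\<Sum>b \<in> frob_box (n + 2) p D. hdim T (n + 2) q ((D - int (mdeg b)) div int p))"
proof -
  let ?N = "n + 2"
  let ?e = "\<lambda>b. (D - int (mdeg b)) div int p"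
  let ?V = "forms ?N D :: 'k mpoly set" and ?J = "qrel ?N (p * q) D :: 'k mpoly set"
  have p0: "p > 0" using p(1) by (rule prime_gt_0_nat)
  have sq: "stretch p (quad N) = (quad N ^ p :: 'k mpoly)" for N
    using stretch_quad[OF p(1,2), of 1 N] by simp
  have "\<exists>B. finite B \<and> (forms ?N e :: 'k mpoly set) \<subseteq> mp.span (B \<union> qrel ?N q e) \<and> card B = hdim T ?N q e" for e
  proof -
    have "qrel ?N q e \<subseteq> (forms ?N e :: 'k mpoly set)" using qrel_forms by blast
    then show ?thesis
    proof (rule mp.codim_basis[OF forms_fin_dim])
      fix B :: "'k mpoly set"
      assume "finite B" "forms ?N e \<subseteq> mp.span (B \<union> qrel ?N q e)" "card B = mp.codim (forms ?N e :: 'k mpoly set) (qrel ?N q e)"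
      then show ?thesis unfolding hdim_def by - (rule exI[of _ B], intro conjI; assumption)
    qed
  qed
  then obtain Bs where Bs: "\<And>e. finite (Bs e)" "\<And>e. (forms ?N e :: 'k mpoly set) \<subseteq> mp.span (Bs e \<union> qrel ?N q e)"
    "\<And>e. card (Bs e) = hdim T ?N q e" by metis
  define G where "G = (\<Union>b \<in> frob_box ?N p D. (\<lambda>P. mono b * stretch p P) ` Bs (?e b))"
  let ?W = "mp.span (G \<union> ?J)"
  have JW: "P \<in> ?W" if "P \<in> ?J" for P using that by (intro mp.span_base) simp
  have c1: "mono m \<in> ?W" if m: "m \<in> mons ?N D" "p dvd Poly_Mapping.lookup m 0" for m
  proof -
    define b where "b = Poly_Mapping.map (\<lambda>c. c mod p) m"
    define g where "g = Poly_Mapping.map (\<lambda>c. c div p) m"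
    have l0: "Poly_Mapping.lookup b i = Poly_Mapping.lookup m i mod p" for i
      by (simp add: b_def Poly_Mapping.map.rep_eq when_def)
    have l1: "Poly_Mapping.lookup g i = Poly_Mapping.lookup m i div p" for i
      by (simp add: g_def Poly_Mapping.map.rep_eq when_def)
    have mm: "m = b + escale p g" by (rule poly_mapping_eqI) (simp add: lookup_add l0 l1)
    have "Poly_Mapping.keys m = Poly_Mapping.keys b \<union> Poly_Mapping.keys g"
      by (subst mm) (simp add: keys_expo_add keys_escale[OF p0])
    then have k: "Poly_Mapping.keys b \<subseteq> {..<?N}" "Poly_Mapping.keys g \<subseteq> {..<?N}" using m(1) by (auto simp: mons_def)
    have "int (mdeg m) = int (mdeg b) + int p * int (mdeg g)" by (subst mm) (simp add: mdeg_add mdeg_escale)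
    then have dg: "D - int (mdeg b) = int p * int (mdeg g)" using m(1) by (simp add: mons_def)
    then have e: "?e b = int (mdeg g)" using p0 by simp
    have b: "b \<in> frob_box ?N p D"
      using k(1) p0 m(2) dg by (auto simp: frob_box_def box_def l0)
    have bf: "mono b \<in> forms ?N (int (mdeg b))" using b by (intro mono_box_forms[of _ _ p]) (simp add: frob_box_def)
    have "mono g \<in> forms ?N (?e b)" unfolding e forms_def using k(2) by (intro mono_pdom) (simp add: mons_def)
    then have "mono g \<in> mp.span (Bs (?e b) \<union> qrel ?N q (?e b))" using Bs(2) by blast
    also have "\<dots> \<subseteq> {P. mono b * stretch p P \<in> ?W}"
    proof (rule mp.span_minimal)
      show "mp.subspace {P. mono b * stretch p P \<in> ?W}"
      proof (rule mp.subspaceI)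
        fix c x assume "x \<in> {P. mono b * stretch p P \<in> ?W}"
        then have "mconst c * (mono b * stretch p x) \<in> ?W" using mp.span_scale by blast
        then show "mconst c * x \<in> {P. mono b * stretch p P \<in> ?W}"
          by (simp add: stretch_scale mult.left_commute)
      qed (auto simp: stretch_add distrib_left mp.span_zero intro: mp.span_add)
      show "Bs (?e b) \<union> qrel ?N q (?e b) \<subseteq> {P. mono b * stretch p P \<in> ?W}"
      proof
        fix P assume "P \<in> Bs (?e b) \<union> qrel ?N q (?e b)"
        then consider "P \<in> Bs (?e b)" | "P \<in> qrel ?N q (?e b)" by blast
        then show "P \<in> {P. mono b * stretch p P \<in> ?W}"
        proof cases
          case 1
          then have "mono b * stretch p P \<in> G" unfolding G_def using b by blast
          then show ?thesis using mp.span_base[of _ "G \<union> ?J"] by blast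
        next
          case 2
          then obtain R where R: "R \<in> forms ?N (?e b - 2)" "P - quad ?N * R \<in> bigs q" "P \<in> forms ?N (?e b)"
            unfolding qrel_def by blast
          have pd: "int p * ?e b = D - int (mdeg b)" using dg e by simp
          have "P - quad ?N * R \<in> forms ?N (?e b)" using forms_mult[OF quad_forms R(1)] by (intro forms_diff R) simp
          from forms_mult[OF bf stretch_forms[OF this p0]]
          have 1: "mono b * stretch p (P - quad ?N * R) \<in> ?J"
            by (intro qrel_bigs bigs_mult(2) stretch_bigs R) (simp add: pd)
          have "quad ?N ^ (p - 1) * (mono b * stretch p R) \<in> forms ?N (2 * int (p - 1) + (int (mdeg b) + int p * (?e b - 2)))"
            by (intro forms_mult quad_pow_forms bf stretch_forms R p0)
          moreover have "2 * int (p - 1) + (int (mdeg b) + int p * (?e b - 2)) = D - 2"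
            using p0 unfolding right_diff_distrib pd by (simp add: of_nat_diff)
          ultimately have 2: "quad ?N * (quad ?N ^ (p - 1) * (mono b * stretch p R)) \<in> ?J"
            by (intro qrel_quad) simp
          have "quad ?N ^ p = quad ?N * (quad ?N ^ (p - 1) :: 'k mpoly)" using p0 by (cases p) simp_all
          then have "mono b * stretch p P = mono b * stretch p (P - quad ?N * R) + quad ?N * (quad ?N ^ (p - 1) * (mono b * stretch p R))"
            by (simp add: stretch_diff stretch_mult sq algebra_simps)
          then show ?thesis using JW[OF qrel_add[OF 1 2]] by simp
        qed
      qed
    qed
    finally have "mono b * stretch p (mono g) \<in> ?W" by simp
    then show ?thesis by (simp add: mono_mult flip: mm)
  qed
  have c2: "mono m \<in> ?W" if "m \<in> mons ?N D" "even (Poly_Mapping.lookup m 0) \<or> p \<le> Poly_Mapping.lookup m 0" for m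
    using that
  proof (induction "Poly_Mapping.lookup m 0" arbitrary: m rule: less_induct)
    case less
    show ?case
    proof (cases "p dvd Poly_Mapping.lookup m 0")
      case True
      then show ?thesis using c1 less.prems by blast
    next
      case False
      have p3: "p \<ge> 3" using p(1,3) prime_ge_2_nat[OF p(1)] by (cases "p = 2") auto
      have m2: "2 \<le> Poly_Mapping.lookup m 0"
        using False less.prems(2) p3 by (cases "Poly_Mapping.lookup m 0 \<le> 1") (auto simp: le_Suc_eq)
      have par: "even (Poly_Mapping.lookup m 0 - 2) \<or> p \<le> Poly_Mapping.lookup m 0 - 2"
      proof (cases "even (Poly_Mapping.lookup m 0)")
        case odd: False
        then have "p \<le> Poly_Mapping.lookup m 0" using less.prems(2) by simp
        moreover have "Poly_Mapping.lookup m 0 \<noteq> p" using False by auto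
        moreover have "Poly_Mapping.lookup m 0 \<noteq> p + 1" using odd p(3) by auto
        ultimately have "p \<le> Poly_Mapping.lookup m 0 - 2" by linarith
        then show ?thesis ..
      qed (use m2 in simp)
      show ?thesis
      proof (rule mono_reduce[OF mp.subspace_span less.prems(1) _ m2])
        show "quad ?N * R \<in> ?W" if "R \<in> forms ?N (D - 2)" for R by (intro JW qrel_quad that)
        show "mono (m - Poly_Mapping.single 0 2 + Poly_Mapping.single i 2) \<in> ?W" if i: "i < ?N" "i \<noteq> 0" for i
        proof (rule less.hyps[OF _ reduce_mem[OF less.prems(1) i(1) m2]])
          have e: "Poly_Mapping.lookup (m - Poly_Mapping.single 0 2 + Poly_Mapping.single i 2) 0 = Poly_Mapping.lookup m 0 - 2"
            using i by (simp add: lookup_add lookup_minus lookup_single del: single_numeral)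
          show "Poly_Mapping.lookup (m - Poly_Mapping.single 0 2 + Poly_Mapping.single i 2) 0 < Poly_Mapping.lookup m 0"
            unfolding e using m2 by simp
          show "even (Poly_Mapping.lookup (m - Poly_Mapping.single 0 2 + Poly_Mapping.single i 2) 0) \<or>
            p \<le> Poly_Mapping.lookup (m - Poly_Mapping.single 0 2 + Poly_Mapping.single i 2) 0" unfolding e by (rule par)
        qed
      qed simp
    qed
  qed
  have UW: "mvar 0 ^ (p - 1) * v \<in> ?W" if "v \<in> forms ?N (D - int (p - 1))" for v
  proof (rule pdom_induct[OF that[unfolded forms_def]])
    show "mp.subspace {v. mvar 0 ^ (p - 1) * v \<in> ?W}"
    proof (rule mp.subspaceI)
      fix c x assume "x \<in> {v. mvar 0 ^ (p - 1) * v \<in> ?W}"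
      then have "mconst c * (mvar 0 ^ (p - 1) * x) \<in> ?W" using mp.span_scale by blast
      then show "mconst c * x \<in> {v. mvar 0 ^ (p - 1) * v \<in> ?W}" by (simp add: mult.left_commute)
    qed (auto simp: distrib_left mp.span_zero intro: mp.span_add)
    fix m assume m: "m \<in> mons ?N (D - int (p - 1))"
    have "mono (Poly_Mapping.single 0 (p - 1) + m) \<in> ?W"
    proof (rule c2)
      have "Poly_Mapping.single 0 (p - 1) \<in> mons ?N (int (p - 1))" by (auto simp: mons_def)
      from mons_add[OF this m] show "Poly_Mapping.single 0 (p - 1) + m \<in> mons ?N D" by simp
      show "even (Poly_Mapping.lookup (Poly_Mapping.single 0 (p - 1) + m) 0) \<or>
          p \<le> Poly_Mapping.lookup (Poly_Mapping.single 0 (p - 1) + m) 0"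
        using p(3) p0 by (cases "Poly_Mapping.lookup m 0") (auto simp: lookup_add)
    qed
    then show "mvar 0 ^ (p - 1) * mono m \<in> ?W" by (simp add: mvar_power mono_mult)
  qed
  let ?X = "mono ` thin ?N (p * q) (p - 1) D :: 'k mpoly set"
  have "?V \<subseteq> mp.span ((?X \<union> G) \<union> ?J)"
  proof (rule subset_trans[OF forms_thin])
    have sub: "?W \<subseteq> mp.span ((?X \<union> G) \<union> ?J)" by (rule mp.span_mono) auto
    show "mp.span (?X \<union> {mvar 0 ^ (p - 1) * v + l | v l. v \<in> forms ?N (D - int (p - 1)) \<and> l \<in> ?J}) \<subseteq> mp.span ((?X \<union> G) \<union> ?J)"
    proof (rule mp.span_minimal[OF _ mp.subspace_span], safe)
      fix m assume "m \<in> thin ?N (p * q) (p - 1) D"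
      then show "mono m \<in> mp.span ((?X \<union> G) \<union> ?J)" by (intro mp.span_base) auto
    next
      fix v l :: "'k mpoly" assume "v \<in> forms ?N (D - int (p - 1))" "l \<in> ?J"
      then show "mvar 0 ^ (p - 1) * v + l \<in> mp.span ((?X \<union> G) \<union> ?J)"
        using sub UW JW by (intro mp.span_add) blast+
    qed
  qed simp
  then have "mp.codim ?V ?J \<le> card (?X \<union> G)"
    by (rule mp.codim_le)
      (use Bs(1) in \<open>auto simp: G_def thin_finite frob_box_finite intro!: mp.fin_dim_subset[OF forms_fin_dim[of ?N D]] qrel_forms\<close>)
  also have "\<dots> \<le> card ?X + card G" by (rule card_Un_le)
  also have "card ?X \<le> card (thin ?N (p * q) (p - 1) D)" by (rule card_image_le[OF thin_finite])
  also have "\<dots> \<le> 2 * (p - 1) * (p * q) ^ (n - 1)" by (rule thin_card[OF n])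
  also have "card G \<le> (\<Sum>b \<in> frob_box ?N p D. card ((\<lambda>P. mono b * stretch p P) ` Bs (?e b)))"
    unfolding G_def by (rule card_UN_le[OF frob_box_finite])
  also have "\<dots> \<le> (\<Sum>b \<in> frob_box ?N p D. hdim T ?N q (?e b))"
    unfolding Bs(3)[symmetric] by (intro sum_mono card_image_le Bs(1))
  finally show ?thesis by (simp add: hdim_def)
qed

text \<open>At most \<open>p\<^sup>n\<close> box monomials contribute to the sum in \<open>hdim_frobenius\<close>, and by \<open>hdim_lipschitz\<close> each term is close to
  the dimension in degree \<open>d\<close>.\<close>

lemma hdim_growth:
  assumes p: "prime p" "CHAR('k::field) = p" "odd p" and n: "n \<ge> 1" and q: "q > 0" and r: "0 \<le> r" "r < int p"
  shows "int (hdim (T :: 'k itself) (n + 2) (p * q) (int p * d + r)) \<le>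
    int p ^ n * int (hdim T (n + 2) q d) + (2 * int p ^ n + 6 * int p ^ n * (int n + 2)) * int (q ^ (n - 1))"
proof -
  let ?D = "int p * d + r" and ?h = "\<lambda>d. int (hdim T (n + 2) q d)" and ?Q = "int (q ^ (n - 1))"
  have p0: "p > 0" using p(1) by (rule prime_gt_0_nat)
  have b: "?h ((?D - int (mdeg b)) div int p) \<le> ?h d + 6 * ?Q * (int n + 2)" if b: "b \<in> frob_box (n + 2) p ?D" for b
  proof -
    let ?e = "(?D - int (mdeg b)) div int p"
    have "int (mdeg b) \<le> int ((n + 2) * (p - 1))"
      using box_mdeg[of b "n + 2" p] b by (simp only: of_nat_le_iff frob_box_def mem_Collect_eq)
    also have "\<dots> \<le> (int n + 2) * int p" by (simp only: of_nat_mult of_nat_add of_nat_numeral) (intro mult_left_mono; simp)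
    finally have "int (mdeg b) \<le> (int n + 2) * int p" .
    then have l: "int p * (d - (int n + 2)) \<le> ?D - int (mdeg b)" using r by (simp add: algebra_simps)
    have u: "?D - int (mdeg b) < int p * (d + 1)" using r by (simp add: algebra_simps)
    have "d - (int n + 2) \<le> ?e" using zdiv_mono1[OF l, of "int p"] p0 by simp
    moreover have "?e \<le> d"
    proof -
      have "int p * ?e \<le> ?D - int (mdeg b)" using p0 by (simp add: minus_mod_eq_mult_div[symmetric])
      then have "int p * ?e < int p * (d + 1)" using u by linarith
      then show ?thesis using p0 by (simp add: mult_less_cancel_left)
    qed
    ultimately have "\<bar>?e - d\<bar> \<le> int n + 2" by simp
    then have "6 * ?Q * \<bar>?e - d\<bar> \<le> 6 * ?Q * (int n + 2)" by (intro mult_left_mono) auto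
    then show ?thesis using hdim_lipschitz[OF n q, of T ?e d] by linarith
  qed
  have "int (hdim T (n + 2) (p * q) ?D) \<le> int (2 * (p - 1) * (p * q) ^ (n - 1) +
    (\<Sum>b \<in> frob_box (n + 2) p ?D. hdim T (n + 2) q ((?D - int (mdeg b)) div int p)))"
    by (rule of_nat_mono[OF hdim_frobenius[OF p n]])
  also have "\<dots> = int (2 * (p - 1) * (p * q) ^ (n - 1)) + (\<Sum>b \<in> frob_box (n + 2) p ?D. ?h ((?D - int (mdeg b)) div int p))"
    by (simp only: of_nat_add of_nat_sum)
  also have "(\<Sum>b \<in> frob_box (n + 2) p ?D. ?h ((?D - int (mdeg b)) div int p)) \<le> (\<Sum>b \<in> frob_box (n + 2) p ?D. ?h d + 6 * ?Q * (int n + 2))"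
    by (rule sum_mono) (rule b)
  also have "\<dots> = int (card (frob_box (n + 2) p ?D)) * (?h d + 6 * ?Q * (int n + 2))" by simp
  also have "\<dots> \<le> int (p ^ n) * (?h d + 6 * ?Q * (int n + 2))"
    by (intro mult_right_mono of_nat_mono frob_box_card) simp
  also have "int (2 * (p - 1) * (p * q) ^ (n - 1)) \<le> 2 * int p ^ n * ?Q"
  proof -
    have "(p - 1) * p ^ (n - 1) \<le> p * p ^ (n - 1)" by (intro mult_right_mono) auto
    also have "\<dots> = p ^ n" using n by (cases n) auto
    finally have "2 * ((p - 1) * p ^ (n - 1)) * q ^ (n - 1) \<le> 2 * p ^ n * q ^ (n - 1)"
      by (intro mult_right_mono mult_left_mono) auto
    then have "2 * (p - 1) * (p * q) ^ (n - 1) \<le> 2 * p ^ n * q ^ (n - 1)" by (simp only: power_mult_distrib mult.assoc)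
    then have "int (2 * (p - 1) * (p * q) ^ (n - 1)) \<le> int (2 * p ^ n * q ^ (n - 1))" by (rule of_nat_mono)
    then show ?thesis by (simp only: of_nat_mult of_nat_power of_nat_numeral)
  qed
  finally show ?thesis by (simp add: algebra_simps)
qed

section \<open>Lengths of the Frobenius components\<close>

definition polys :: "nat \<Rightarrow> 'k::field mpoly set" where
  "polys N = pdom {m. Poly_Mapping.keys m \<subseteq> {..<N}}"

lemma forms_polys: "P \<in> forms N d \<Longrightarrow> P \<in> polys N"
  by (auto simp: forms_def polys_def pdom_iff mons_def)

lemma polys_sub: "mp.subspace (polys N)" unfolding polys_def by (rule pdom_sub)

lemmas polys_add = mp.subspace_add[OF polys_sub] and polys_diff = mp.subspace_diff[OF polys_sub]
  and polys_0 = mp.subspace_0[OF polys_sub] and polys_neg = mp.subspace_neg[OF polys_sub]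
  and polys_sum = mp.subspace_sum[OF polys_sub]

lemma polys_mult: "P \<in> polys N \<Longrightarrow> R \<in> polys N \<Longrightarrow> P * R \<in> polys N"
  unfolding polys_def by (erule (1) pdom_mult) (auto simp: keys_expo_add)

lemma polys_1: "1 \<in> polys N" using forms_polys[OF forms_1] .

lemma polys_mconst: "mconst c \<in> polys N" using mp.subspace_scale[OF polys_sub polys_1, of c N] by simp

lemma polys_power: "P \<in> polys N \<Longrightarrow> P ^ k \<in> polys N"
  by (induction k) (auto intro: polys_1 polys_mult)

lemma mpoly_ring_simps:
  "carrier (mpoly_ring N) = polys N" "x \<otimes>\<^bsub>mpoly_ring N\<^esub> y = x * y" "\<one>\<^bsub>mpoly_ring N\<^esub> = 1"
  "\<zero>\<^bsub>mpoly_ring N\<^esub> = 0" "x \<oplus>\<^bsub>mpoly_ring N\<^esub> y = x + y"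
  by (auto simp: mpoly_ring_def ring_of_type_algebra_def polys_def pdom_def)

lemma mpoly_ring_cring: "cring (mpoly_ring N :: 'k::field mpoly ring)"
proof (rule cringI)
  show "abelian_group (mpoly_ring N :: 'k mpoly ring)"
  proof (rule abelian_groupI)
    show "\<exists>y \<in> carrier (mpoly_ring N). y \<oplus>\<^bsub>mpoly_ring N\<^esub> x = \<zero>\<^bsub>mpoly_ring N\<^esub>"
      if "x \<in> carrier (mpoly_ring N)" for x :: "'k mpoly"
      using that by (intro bexI[of _ "- x"]) (auto simp: mpoly_ring_simps intro: polys_neg)
  qed (auto simp: mpoly_ring_simps add_ac intro: polys_add polys_0)
  show "Group.comm_monoid (mpoly_ring N :: 'k mpoly ring)"
    by (rule comm_monoidI) (auto simp: mpoly_ring_simps mult_ac intro: polys_mult polys_1)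
qed (auto simp: mpoly_ring_simps distrib_right)

lemma mpoly_ideal:
  assumes "J \<subseteq> polys N" "0 \<in> J" "\<And>x y. x \<in> J \<Longrightarrow> y \<in> J \<Longrightarrow> x + y \<in> J"
    "\<And>x y. x \<in> J \<Longrightarrow> y \<in> polys N \<Longrightarrow> y * x \<in> J"
  shows "ideal J (mpoly_ring N :: 'k::field mpoly ring)"
proof -
  interpret P: cring "mpoly_ring N :: 'k mpoly ring" by (rule mpoly_ring_cring)
  have inv: "\<ominus>\<^bsub>mpoly_ring N\<^esub> x = - x" if "x \<in> polys N" for x :: "'k mpoly"
    using that P.minus_equality[of "- x" x] polys_neg[of x N] by (simp add: mpoly_ring_simps)
  show ?thesis
  proof (rule idealI[OF P.ring_axioms])
    show "subgroup J (add_monoid (mpoly_ring N))"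
    proof (rule subgroup.intro)
      fix x assume x: "x \<in> J"
      then have "inv\<^bsub>add_monoid (mpoly_ring N)\<^esub> x = - x" using inv[of x] assms(1) by (auto simp: a_inv_def)
      moreover have "- 1 \<in> (polys N :: 'k mpoly set)" by (rule polys_neg[OF polys_1])
      then have "- 1 * x \<in> J" by (rule assms(4)[OF x])
      ultimately show "inv\<^bsub>add_monoid (mpoly_ring N)\<^esub> x \<in> J" by simp
    qed (use assms in \<open>auto simp: mpoly_ring_simps\<close>)
  qed (use assms in \<open>auto simp: mpoly_ring_simps mult.commute\<close>)
qed

text \<open>The preimage in the polynomial ring of the Frobenius power of the maximal ideal of the quadric ring.\<close>

definition jideal :: "nat \<Rightarrow> nat \<Rightarrow> 'k::field mpoly set" where
  "jideal N q = {P \<in> polys N. \<exists>R \<in> polys N. P - quad N * R \<in> bigs q}"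

lemma quad_polys: "quad N \<in> polys N" using forms_polys[OF quad_forms] .

lemma jideal_forms:
  assumes "P \<in> forms N d" shows "P \<in> jideal N q \<longleftrightarrow> P \<in> qrel N q d"
proof
  assume "P \<in> jideal N q"
  then obtain R where R: "R \<in> polys N" "P - quad N * R \<in> bigs q" by (auto simp: jideal_def)
  define R' where "R' = restr {m. int (mdeg m) = d - 2} R"
  have "R' \<in> forms N (d - 2)"
    using R(1) by (auto simp: R'_def forms_def polys_def pdom_iff lookup_restr mons_def)
  moreover have "P - quad N * R' \<in> bigs q"
    unfolding bigs_def pdom_iff
  proof (intro allI impI)
    fix k assume k: "k \<notin> big q"
    show "Poly_Mapping.lookup (P - quad N * R') k = 0"
    proof (cases "int (mdeg k) = d")
      case True
      have "Poly_Mapping.lookup R' (k - Poly_Mapping.single i 2) = Poly_Mapping.lookup R (k - Poly_Mapping.single i 2)"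
        if "2 \<le> Poly_Mapping.lookup k i" for i
      proof -
        have "k = (k - Poly_Mapping.single i 2) + Poly_Mapping.single i 2"
          using that by (intro poly_mapping_eqI) (auto simp: lookup_add lookup_minus lookup_single when_def)
        then have "mdeg k = mdeg (k - Poly_Mapping.single i 2) + 2" by (metis mdeg_add mdeg_single)
        then show ?thesis using True by (simp add: R'_def lookup_restr)
      qed
      then have "Poly_Mapping.lookup (quad N * R') k = Poly_Mapping.lookup (quad N * R) k"
        unfolding lookup_quad_mult by (intro sum.cong refl) simp
      moreover have "Poly_Mapping.lookup (P - quad N * R) k = 0" using R(2) k by (simp add: bigs_def pdom_iff)
      ultimately show ?thesis by (simp add: lookup_minus)
    next
      case False
      have "P - quad N * R' \<in> forms N d"
        using assms forms_mult[OF quad_forms \<open>R' \<in> _\<close>] by (intro forms_diff) simp_all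
      then show ?thesis using False by (auto simp: forms_def pdom_iff mons_def)
    qed
  qed
  ultimately show "P \<in> qrel N q d" using assms by (auto simp: qrel_def)
qed (use assms forms_polys in \<open>auto simp: qrel_def jideal_def\<close>)

lemma jideal_ideal: "ideal (jideal N q) (mpoly_ring N :: 'k::field mpoly ring)"
proof (rule mpoly_ideal)
  show "0 \<in> (jideal N q :: 'k mpoly set)" using polys_0[of N] bigs_0[of q] by (auto simp: jideal_def intro!: bexI[of _ 0])
next
  fix x y :: "'k mpoly" assume "x \<in> jideal N q" "y \<in> jideal N q"
  then obtain R S where *: "R \<in> polys N" "x - quad N * R \<in> bigs q" "S \<in> polys N" "y - quad N * S \<in> bigs q"
    "x \<in> polys N" "y \<in> polys N" unfolding jideal_def by blast
  have "(x - quad N * R) + (y - quad N * S) \<in> bigs q" by (intro bigs_add *)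
  then have "x + y - quad N * (R + S) \<in> bigs q" by (simp add: algebra_simps)
  moreover have "R + S \<in> polys N" "x + y \<in> polys N" by (intro polys_add *)+
  ultimately show "x + y \<in> jideal N q" unfolding jideal_def by blast
next
  fix x y :: "'k mpoly" assume "x \<in> jideal N q" and y: "y \<in> polys N"
  then obtain R where *: "R \<in> polys N" "x - quad N * R \<in> bigs q" "x \<in> polys N" unfolding jideal_def by blast
  have "y * (x - quad N * R) \<in> bigs q" by (rule bigs_mult(2)[OF *(2)])
  then have "y * x - quad N * (y * R) \<in> bigs q" by (simp add: algebra_simps)
  moreover have "y * R \<in> polys N" "y * x \<in> polys N" by (intro polys_mult y *)+
  ultimately show "y * x \<in> jideal N q" unfolding jideal_def by blast
qed (auto simp: jideal_def)

context
  fixes n s p q :: nat and T :: "'k::field itself"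
  assumes p: "prime p" "CHAR('k) = p" and q: "q = p ^ s"
  notes [simp del] = add_2_eq_Suc add_2_eq_Suc'
begin

interpretation P: cring "mpoly_ring (n + 2) :: 'k mpoly ring" by (rule mpoly_ring_cring)

lemma quad_eq: "(\<Sum>i\<le>n + 1. mvar i ^ 2) = (quad (n + 2) :: 'k mpoly)"
  unfolding quad_def by (rule sum.cong) auto

lemma quadric_ideal_eq: "(quadric_ideal n :: 'k mpoly set) = {r * quad (n + 2) | r. r \<in> polys (n + 2)}"
proof -
  have "quad (n + 2) \<in> carrier (mpoly_ring (n + 2) :: 'k mpoly ring)"
    using quad_polys[of "n + 2"] by (simp only: mpoly_ring_simps)
  from P.cgenideal_eq_genideal[OF this] show ?thesis unfolding quadric_ideal_def quad_eq
    by (simp only: cgenideal_def mpoly_ring_simps)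
qed

lemma quadric_ideal: "ideal (quadric_ideal n :: 'k mpoly set) (mpoly_ring (n + 2))"
proof -
  have "{quad (n + 2)} \<subseteq> carrier (mpoly_ring (n + 2) :: 'k mpoly ring)"
    using quad_polys[of "n + 2"] by (simp only: mpoly_ring_simps) simp
  then show ?thesis unfolding quadric_ideal_def quad_eq by (rule P.genideal_ideal)
qed

interpretation QI: ideal "quadric_ideal n :: 'k mpoly set" "mpoly_ring (n + 2)" by (rule quadric_ideal)

lemma quadric_ring_cring: "cring (quadric_ring n :: 'k mpoly set ring)"
  unfolding quadric_ring_def by (rule QI.quotient_is_cring[OF mpoly_ring_cring])

interpretation R: cring "quadric_ring n :: 'k mpoly set ring" by (rule quadric_ring_cring)

interpretation qh: ring_hom_cring "mpoly_ring (n + 2)" "quadric_ring n" "quadric_class n :: 'k mpoly \<Rightarrow> _"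
  using QI.rcos_ring_hom_cring[OF mpoly_ring_cring] unfolding quadric_class_def quadric_ring_def by (simp add: eta_contract_eq)

lemma mpoly_minus: "a \<in> polys (n + 2) \<Longrightarrow> b \<in> polys (n + 2) \<Longrightarrow> a \<ominus>\<^bsub>mpoly_ring (n + 2)\<^esub> b = a - (b :: 'k mpoly)"
  using P.minus_equality[of "- b" b] polys_neg[of b "n + 2"] by (simp add: a_minus_def mpoly_ring_simps)

lemma quadric_class_eq:
  assumes "a \<in> polys (n + 2)" "b \<in> polys (n + 2)"
  shows "quadric_class n a = quadric_class n b \<longleftrightarrow> a - (b :: 'k mpoly) \<in> quadric_ideal n"
  using P.quotient_eq_iff_same_a_r_cos[OF quadric_ideal, of a b] assms
  unfolding mpoly_minus[OF assms] quadric_class_def mpoly_ring_simps by blast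

lemma quadric_ring_carrier: "carrier (quadric_ring n) = quadric_class n ` (polys (n + 2) :: 'k mpoly set)"
  by (auto simp: quadric_ring_def FactRing_def A_RCOSETS_def RCOSETS_def quadric_class_def a_r_coset_def mpoly_ring_simps)

lemma quadric_class_power: "a \<in> polys (n + 2) \<Longrightarrow> quadric_class n a [^]\<^bsub>quadric_ring n\<^esub> (k::nat) = quadric_class n (a ^ k :: 'k mpoly)"
proof (induction k)
  case 0
  then show ?case using qh.hom_one by (simp add: mpoly_ring_simps)
next
  case (Suc k)
  then show ?case using qh.hom_mult[of "a ^ k" a] polys_power[of a "n + 2" k]
    by (simp add: mpoly_ring_simps mult.commute)
qed

lemma q_pos: "q > 0" unfolding q using p(1) by (simp add: prime_gt_0_nat)

lemma class_ideal:
  assumes "ideal J (mpoly_ring (n + 2) :: 'k mpoly ring)"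
  shows "ideal (quadric_class n ` J) (quadric_ring n)"
  using P.ring_ideal_imp_quot_ideal[OF quadric_ideal assms] unfolding quadric_class_def quadric_ring_def by simp

lemma max_ideal_sub: "max_ideal n \<subseteq> quadric_class n ` {g \<in> polys (n + 2) :: 'k mpoly set. Poly_Mapping.lookup g 0 = 0}"
  unfolding max_ideal_def
proof (rule R.genideal_minimal[OF class_ideal[OF mpoly_ideal]])
  show "(\<lambda>i. quadric_class n (mvar i)) ` {..n + 1} \<subseteq> quadric_class n ` {g \<in> polys (n + 2) :: 'k mpoly set. Poly_Mapping.lookup g 0 = 0}"
  proof safe
    fix i assume "i \<le> n + 1"
    then have "(mvar i :: 'k mpoly) \<in> polys (n + 2)" using mvar_forms[THEN forms_polys, of i "n + 2"] by simp
    moreover have "Poly_Mapping.single i 1 \<noteq> (0 :: expo)" by (metis lookup_single_eq lookup_zero one_neq_zero)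
    then have "Poly_Mapping.lookup (mvar i :: 'k mpoly) 0 = 0" by (simp add: mvar_def lookup_single when_def)
    ultimately show "quadric_class n (mvar i) \<in> quadric_class n ` {g \<in> polys (n + 2) :: 'k mpoly set. Poly_Mapping.lookup g 0 = 0}" by blast
  qed
next
  fix x y :: "'k mpoly" assume "x \<in> {g \<in> polys (n + 2). Poly_Mapping.lookup g 0 = 0}" and y: "y \<in> polys (n + 2)"
  then have x: "x \<in> polys (n + 2)" "Poly_Mapping.lookup x 0 = 0" by auto
  have "x \<in> pdom (- {0})" using x(2) by (auto simp: pdom_iff)
  then have "y * x \<in> pdom (- {0})"
  proof (rule pdom_mult[OF in_pdom_UNIV])
    fix a b :: expo assume "b \<in> - {0}"
    then obtain i where "Poly_Mapping.lookup b i \<noteq> 0" by (auto simp: poly_mapping_eq_iff fun_eq_iff)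
    then have "Poly_Mapping.lookup (a + b) i \<noteq> 0" by (simp add: lookup_add)
    then show "a + b \<in> - {0}" by (metis Compl_iff lookup_zero singletonD)
  qed
  then show "y * x \<in> {g \<in> polys (n + 2). Poly_Mapping.lookup g 0 = 0}"
    using polys_mult[OF y x(1)] by (auto simp: pdom_iff)
qed (auto simp: lookup_add intro: polys_add polys_0)

lemma max_gens: "(\<lambda>i. quadric_class n (mvar i :: 'k mpoly)) ` {..n + 1} \<subseteq> carrier (quadric_ring n)"
proof safe
  fix i assume "i \<le> n + 1"
  then show "quadric_class n (mvar i :: 'k mpoly) \<in> carrier (quadric_ring n)"
    unfolding quadric_ring_carrier by (intro imageI forms_polys[OF mvar_forms]) simp
qed

lemma max_ideal_ideal: "ideal (max_ideal n) (quadric_ring n :: 'k mpoly set ring)"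
  unfolding max_ideal_def
  by (rule R.genideal_ideal[OF max_gens])

text \<open>In characteristic \<open>p\<close> the \<open>q\<close>-th power of a polynomial is the sum of the \<open>q\<close>-th powers of its terms.\<close>

lemma power_q_bigs:
  assumes "(g :: 'k mpoly) \<in> polys N" "Poly_Mapping.lookup g 0 = 0"
  shows "g ^ q \<in> bigs q"
proof -
  have "g ^ q = (\<Sum>m \<in> Poly_Mapping.keys g. mconst (Poly_Mapping.lookup g m) * mono m) ^ q"
    by (subst poly_expand[of g]) simp
  also have "\<dots> = (\<Sum>m \<in> Poly_Mapping.keys g. (mconst (Poly_Mapping.lookup g m) * mono m) ^ q)"
    by (rule freshmans_dream_sum'[where n = s]) (use p q in \<open>simp_all add: char_mpoly\<close>)
  also have "\<dots> \<in> bigs q"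
  proof (rule bigs_sum)
    fix m assume "m \<in> Poly_Mapping.keys g"
    then have "m \<noteq> 0" using assms(2) by (auto simp: in_keys_iff)
    then obtain i where i: "Poly_Mapping.lookup m i \<noteq> 0" by (auto simp: poly_mapping_eq_iff fun_eq_iff)
    have pw: "mono m ^ k = (mono (escale k m) :: 'k mpoly)" for k
    proof (induction k)
      case 0
      have "escale 0 m = 0" by (intro poly_mapping_eqI) simp
      then show ?case by simp
    next
      case (Suc k)
      have "m + escale k m = escale (Suc k) m" by (intro poly_mapping_eqI) (simp add: lookup_add)
      then show ?case using Suc by (simp add: mono_mult)
    qed
    have "mono m ^ q \<in> (bigs q :: 'k mpoly set)" unfolding pw bigs_def
      by (rule mono_pdom) (use i in \<open>auto simp: big_def intro!: exI[of _ i]\<close>)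
    then show "(mconst (Poly_Mapping.lookup g m) * mono m) ^ q \<in> bigs q"
      unfolding power_mult_distrib by (rule bigs_mult(2))
  qed
  finally show ?thesis .
qed

lemma frob_ideal_eq: "frobenius_power (quadric_ring n) (max_ideal n) q = quadric_class n ` (jideal (n + 2) q :: 'k mpoly set)"
proof
  show "frobenius_power (quadric_ring n) (max_ideal n) q \<subseteq> quadric_class n ` (jideal (n + 2) q :: 'k mpoly set)"
    unfolding frobenius_power_def
  proof (rule R.genideal_minimal[OF class_ideal[OF jideal_ideal]], safe)
    fix a assume "a \<in> (max_ideal n :: 'k mpoly set set)"
    then obtain g :: "'k mpoly" where g: "a = quadric_class n g" "g \<in> polys (n + 2)" "Poly_Mapping.lookup g 0 = 0"
      using max_ideal_sub by blast
    have "g ^ q \<in> jideal (n + 2) q"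
      unfolding jideal_def using power_q_bigs[OF g(2,3)] polys_power[OF g(2)] polys_0 by (auto intro!: bexI[of _ 0])
    then show "a [^]\<^bsub>quadric_ring n\<^esub> q \<in> quadric_class n ` (jideal (n + 2) q :: 'k mpoly set)"
      unfolding g(1) quadric_class_power[OF g(2)] by blast
  qed
  let ?F = "frobenius_power (quadric_ring n) (max_ideal n) q :: 'k mpoly set set"
  have Fi: "ideal ?F (quadric_ring n)" unfolding frobenius_power_def
    using ideal.Icarr[OF max_ideal_ideal] by (intro R.genideal_ideal) auto
  interpret F: ideal ?F "quadric_ring n" by (rule Fi)
  show "quadric_class n ` (jideal (n + 2) q :: 'k mpoly set) \<subseteq> ?F"
  proof safe
    fix P :: "'k mpoly" assume "P \<in> jideal (n + 2) q"
    then obtain R where R: "P \<in> polys (n + 2)" "R \<in> polys (n + 2)" "P - quad (n + 2) * R \<in> bigs q"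
      by (auto simp: jideal_def)
    define B where "B = P - quad (n + 2) * R"
    have B: "B \<in> polys (n + 2)" unfolding B_def by (intro polys_diff polys_mult R quad_polys)
    have "P - B = R * quad (n + 2)" unfolding B_def by (simp add: mult.commute)
    then have "P - B \<in> quadric_ideal n" unfolding quadric_ideal_eq using R(2) by blast
    then have "quadric_class n P = quadric_class n B" using quadric_class_eq[OF R(1) B] by blast
    moreover have "B \<in> pdom ({m. Poly_Mapping.keys m \<subseteq> {..<n + 2}} \<inter> big q)"
      using B R(3) unfolding B_def[symmetric] polys_def bigs_def by (simp flip: pdom_Int)
    then have "B \<in> polys (n + 2) \<and> quadric_class n B \<in> ?F"
    proof (rule pdom_induct)
      show "mp.subspace {P :: 'k mpoly. P \<in> polys (n + 2) \<and> quadric_class n P \<in> ?F}"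
      proof (rule mp.subspaceI)
        show "0 \<in> {P :: 'k mpoly. P \<in> polys (n + 2) \<and> quadric_class n P \<in> ?F}"
          using polys_0 qh.hom_zero F.zero_closed by (simp add: mpoly_ring_simps)
      next
        fix x y :: "'k mpoly"
        assume "x \<in> {P. P \<in> polys (n + 2) \<and> quadric_class n P \<in> ?F}" "y \<in> {P. P \<in> polys (n + 2) \<and> quadric_class n P \<in> ?F}"
        then show "x + y \<in> {P. P \<in> polys (n + 2) \<and> quadric_class n P \<in> ?F}"
          using qh.hom_add[of x y] F.a_closed polys_add[of x "n + 2" y] by (simp add: mpoly_ring_simps)
      next
        fix c :: 'k and x :: "'k mpoly"
        assume x: "x \<in> {P. P \<in> polys (n + 2) \<and> quadric_class n P \<in> ?F}"
        have "quadric_class n (mconst c) \<in> carrier (quadric_ring n)"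
          unfolding quadric_ring_carrier by (intro imageI polys_mconst)
        then show "mconst c * x \<in> {P. P \<in> polys (n + 2) \<and> quadric_class n P \<in> ?F}"
          using x qh.hom_mult[of "mconst c" x] F.I_l_closed polys_mconst[of c "n + 2"] polys_mult[of "mconst c" "n + 2" x]
          by (simp add: mpoly_ring_simps)
      qed
      fix m :: expo assume m: "m \<in> {m. Poly_Mapping.keys m \<subseteq> {..<n + 2}} \<inter> big q"
      then obtain i where i: "q \<le> Poly_Mapping.lookup m i" by (auto simp: big_def)
      then have "Poly_Mapping.lookup m i \<noteq> 0" using q_pos by linarith
      then have "i \<in> Poly_Mapping.keys m" by (simp add: in_keys_iff)
      then have iN: "i < n + 2" using m by auto
      let ?m = "m - Poly_Mapping.single i q"
      have me: "m = ?m + Poly_Mapping.single i q"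
        using i by (intro poly_mapping_eqI) (auto simp: lookup_add lookup_minus lookup_single when_def)
      have "Poly_Mapping.keys ?m \<subseteq> Poly_Mapping.keys m" by (auto simp: in_keys_iff lookup_minus)
      then have mp: "(mono ?m :: 'k mpoly) \<in> polys (n + 2)" "(mono m :: 'k mpoly) \<in> polys (n + 2)"
        using m unfolding polys_def by (auto intro!: mono_pdom)
      have vp: "(mvar i :: 'k mpoly) \<in> polys (n + 2)" using mvar_forms[OF iN, THEN forms_polys] .
      have "quadric_class n (mvar i :: 'k mpoly) \<in> max_ideal n"
        unfolding max_ideal_def by (rule subsetD[OF R.genideal_self[OF max_gens]]) (use iN in auto)
      then have "quadric_class n (mvar i :: 'k mpoly) [^]\<^bsub>quadric_ring n\<^esub> q \<in> ?F"
        unfolding frobenius_power_def using ideal.Icarr[OF max_ideal_ideal] by (intro subsetD[OF R.genideal_self]) auto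
      then have "quadric_class n (mono ?m) \<otimes>\<^bsub>quadric_ring n\<^esub> quadric_class n (mvar i ^ q :: 'k mpoly) \<in> ?F"
        unfolding quadric_class_power[OF vp] using mp(1) by (intro F.I_l_closed) (auto simp: quadric_ring_carrier)
      also have "quadric_class n (mono ?m) \<otimes>\<^bsub>quadric_ring n\<^esub> quadric_class n (mvar i ^ q :: 'k mpoly) = quadric_class n (mono ?m * mvar i ^ q)"
        using qh.hom_mult[of "mono ?m" "mvar i ^ q"] mp(1) polys_power[OF vp] by (simp add: mpoly_ring_simps)
      finally show "(mono m :: 'k mpoly) \<in> polys (n + 2) \<and> quadric_class n (mono m :: 'k mpoly) \<in> ?F"
        using mp(2) by (simp add: mvar_power mono_mult flip: me)
    qed
    ultimately show "quadric_class n P \<in> ?F" by simp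
  qed
qed

lemma frob_ideal: "ideal (frobenius_power (quadric_ring n) (max_ideal n) q) (quadric_ring n :: 'k mpoly set ring)"
  unfolding frob_ideal_eq by (rule class_ideal[OF jideal_ideal])

interpretation FI: ideal "frobenius_power (quadric_ring n) (max_ideal n) q" "quadric_ring n :: 'k mpoly set ring"
  by (rule frob_ideal)

interpretation FQ: cring "frobenius_quotient n q :: 'k mpoly set set ring"
  unfolding frobenius_quotient_def by (rule FI.quotient_is_cring[OF quadric_ring_cring])

interpretation fh: ring_hom_cring "quadric_ring n" "frobenius_quotient n q"
    "a_r_coset (quadric_ring n) (frobenius_power (quadric_ring n) (max_ideal n) q) :: 'k mpoly set \<Rightarrow> _"
  using FI.rcos_ring_hom_cring[OF quadric_ring_cring] unfolding frobenius_quotient_def by simp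

lemma frobenius_class_eq:
  assumes a: "a \<in> polys (n + 2)" and b: "b \<in> polys (n + 2)"
  shows "frobenius_class n q a = frobenius_class n q b \<longleftrightarrow> a - (b :: 'k mpoly) \<in> jideal (n + 2) q"
proof -
  have ab: "a - b \<in> polys (n + 2)" by (rule polys_diff[OF a b])
  have cc: "quadric_class n x \<in> carrier (quadric_ring n)" if "x \<in> polys (n + 2)" for x :: "'k mpoly"
    using that by (auto simp: quadric_ring_carrier)
  have "quadric_class n a \<ominus>\<^bsub>quadric_ring n\<^esub> quadric_class n b = quadric_class n (a - b)"
    using qh.hom_sub[of a b] a b mpoly_minus[OF a b] by (simp add: mpoly_ring_simps)
  then have "frobenius_class n q a = frobenius_class n q b \<longleftrightarrow> quadric_class n (a - b) \<in> quadric_class n ` jideal (n + 2) q"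
    using R.quotient_eq_iff_same_a_r_cos[OF frob_ideal cc[OF a] cc[OF b]] unfolding frobenius_class_def frob_ideal_eq by simp
  also have "\<dots> \<longleftrightarrow> a - b \<in> jideal (n + 2) q"
  proof
    assume "quadric_class n (a - b) \<in> quadric_class n ` jideal (n + 2) q"
    then obtain j where j: "j \<in> jideal (n + 2) q" "quadric_class n (a - b) = quadric_class n j" by blast
    have jp: "j \<in> polys (n + 2)" using j(1) by (simp add: jideal_def)
    obtain r where r: "r \<in> polys (n + 2)" "a - b - j = r * quad (n + 2)"
      using j(2) unfolding quadric_class_eq[OF ab jp] quadric_ideal_eq by blast
    have "r * quad (n + 2) \<in> jideal (n + 2) q"
      unfolding jideal_def using r polys_mult[OF r(1) quad_polys] bigs_0
      by (auto intro!: bexI[of _ r] simp: mult.commute)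
    then have "j \<oplus>\<^bsub>mpoly_ring (n + 2)\<^esub> (r * quad (n + 2)) \<in> jideal (n + 2) q"
      using additive_subgroup.a_closed[OF ideal.axioms(1)[OF jideal_ideal] j(1)] by blast
    then show "a - b \<in> jideal (n + 2) q" unfolding mpoly_ring_simps r(2)[symmetric] by simp
  qed auto
  finally show ?thesis .
qed

lemma frobenius_class_add: "a \<in> polys (n + 2) \<Longrightarrow> b \<in> polys (n + 2) \<Longrightarrow>
    frobenius_class n q a \<oplus>\<^bsub>frobenius_quotient n q\<^esub> frobenius_class n q b = frobenius_class n q (a + b :: 'k mpoly)"
  using qh.hom_add[of a b] fh.hom_add[of "quadric_class n a" "quadric_class n b"]
  by (simp add: frobenius_class_def quadric_ring_carrier mpoly_ring_simps)

lemma frobenius_class_mult: "a \<in> polys (n + 2) \<Longrightarrow> b \<in> polys (n + 2) \<Longrightarrow>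
    frobenius_class n q a \<otimes>\<^bsub>frobenius_quotient n q\<^esub> frobenius_class n q b = frobenius_class n q (a * b :: 'k mpoly)"
  using qh.hom_mult[of a b] fh.hom_mult[of "quadric_class n a" "quadric_class n b"]
  by (simp add: frobenius_class_def quadric_ring_carrier mpoly_ring_simps)

lemma frobenius_class_0: "frobenius_class n q (0 :: 'k mpoly) = \<zero>\<^bsub>frobenius_quotient n q\<^esub>"
  using qh.hom_zero fh.hom_zero by (simp add: frobenius_class_def mpoly_ring_simps)

abbreviation "fcls \<equiv> frobenius_class n q :: 'k mpoly \<Rightarrow> _"

abbreviation "base_ring \<equiv> ring_of_type_algebra :: 'k ring"

lemma component_simps:
  "carrier (frobenius_component n q d) = fcls ` forms (n + 2) (int d)"
  "\<zero>\<^bsub>frobenius_component n q d\<^esub> = fcls 0"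
  "\<lbrakk>a \<in> polys (n + 2); b \<in> polys (n + 2)\<rbrakk> \<Longrightarrow> fcls a \<oplus>\<^bsub>frobenius_component n q d\<^esub> fcls b = fcls (a + b)"
  "a \<in> polys (n + 2) \<Longrightarrow> c \<odot>\<^bsub>frobenius_component n q d\<^esub> fcls a = fcls (mconst c * a)"
  by (simp_all add: frobenius_component_def homogeneous_forms frobenius_class_0 frobenius_class_add
      frobenius_class_mult polys_mconst)

lemma base_ring_simps: "carrier base_ring = UNIV" "x \<otimes>\<^bsub>base_ring\<^esub> y = x * y" "\<one>\<^bsub>base_ring\<^esub> = 1" "x \<oplus>\<^bsub>base_ring\<^esub> y = x + y"
  by (simp_all add: ring_of_type_algebra_def)

lemma component_module: "Module.module base_ring (frobenius_component n q d :: ('k, _) module)"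
proof -
  let ?M = "frobenius_component n q d :: ('k, _) module" and ?S = "forms (n + 2) (int d) :: 'k mpoly set"
  note fp = forms_polys[of _ "n + 2" "int d"]
  have "abelian_group ?M"
  proof (rule abelian_groupI)
    show "\<exists>y \<in> carrier ?M. y \<oplus>\<^bsub>?M\<^esub> x = \<zero>\<^bsub>?M\<^esub>" if x: "x \<in> carrier ?M" for x
    proof -
      obtain a where a: "x = fcls a" "a \<in> ?S" using x unfolding component_simps by blast
      have "fcls (- a) \<oplus>\<^bsub>?M\<^esub> fcls a = fcls (- a + a)"
        using a(2) by (intro component_simps fp forms_neg)
      then have "fcls (- a) \<oplus>\<^bsub>?M\<^esub> x = \<zero>\<^bsub>?M\<^esub>" unfolding a(1) component_simps(2) by simp
      moreover have "fcls (- a) \<in> carrier ?M" unfolding component_simps(1) using a(2) by (intro imageI forms_neg)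
      ultimately show ?thesis by blast
    qed
  qed (auto simp: component_simps fp forms_add polys_add add_ac forms_0)
  then show ?thesis
  proof (intro module.intro module_axioms.intro)
    show "cring base_ring" by (rule cring_from_type_algebra)
    fix a b x y assume x: "x \<in> carrier ?M" and y: "y \<in> carrier ?M"
    obtain f where f: "x = fcls f" "f \<in> ?S" using x unfolding component_simps by blast
    obtain g where g: "y = fcls g" "g \<in> ?S" using y unfolding component_simps by blast
    note sp = fp[OF f(2)] fp[OF g(2)] fp[OF forms_scale[OF f(2)]] fp[OF forms_scale[OF g(2)]] fp[OF forms_add[OF f(2) g(2)]]
    show "a \<odot>\<^bsub>?M\<^esub> x \<in> carrier ?M"
      unfolding f(1) component_simps(4)[OF sp(1)] component_simps(1) by (intro imageI forms_scale f)
    show "(a \<oplus>\<^bsub>base_ring\<^esub> b) \<odot>\<^bsub>?M\<^esub> x = a \<odot>\<^bsub>?M\<^esub> x \<oplus>\<^bsub>?M\<^esub> b \<odot>\<^bsub>?M\<^esub> x"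
      unfolding f(1) component_simps(4)[OF sp(1)] component_simps(3)[OF sp(3) sp(3)] base_ring_simps
      by (simp only: mconst_add distrib_right)
    show "a \<odot>\<^bsub>?M\<^esub> (x \<oplus>\<^bsub>?M\<^esub> y) = a \<odot>\<^bsub>?M\<^esub> x \<oplus>\<^bsub>?M\<^esub> a \<odot>\<^bsub>?M\<^esub> y"
      unfolding f(1) g(1) component_simps(3)[OF sp(1,2)] component_simps(4)[OF sp(1)] component_simps(4)[OF sp(2)]
        component_simps(4)[OF sp(5)] component_simps(3)[OF sp(3) sp(4)]
      by (simp only: distrib_left)
    show "(a \<otimes>\<^bsub>base_ring\<^esub> b) \<odot>\<^bsub>?M\<^esub> x = a \<odot>\<^bsub>?M\<^esub> (b \<odot>\<^bsub>?M\<^esub> x)"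
      unfolding f(1) component_simps(4)[OF sp(1)] component_simps(4)[OF sp(3)] base_ring_simps
      by (simp only: mconst_mult[symmetric] mult.assoc)
    show "\<one>\<^bsub>base_ring\<^esub> \<odot>\<^bsub>?M\<^esub> x = x"
      unfolding f(1) component_simps(4)[OF sp(1)] base_ring_simps by (simp only: mconst_1 mult_1_left)
  qed
qed

lemma class_eq_forms:
  assumes "a \<in> forms (n + 2) d" "b \<in> forms (n + 2) d"
  shows "fcls a = fcls b \<longleftrightarrow> a - b \<in> qrel (n + 2) q d"
  using frobenius_class_eq[OF forms_polys[OF assms(1)] forms_polys[OF assms(2)]]
    jideal_forms[OF forms_diff[OF assms], of q] by simp

text \<open>Submodules of the component are the images of the subspaces between \<open>qrel\<close> and the forms of that degree,
  so chains of submodules have length at most the codimension, and this length is attained.\<close>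

theorem module_length_component:
  "module_length base_ring (frobenius_component n q d :: ('k, _) module) = enat (hdim T (n + 2) q (int d))"
proof -
  let ?M = "frobenius_component n q d :: ('k, 'k mpoly set set) module"
  let ?V = "forms (n + 2) (int d) :: 'k mpoly set" and ?J = "qrel (n + 2) q (int d) :: 'k mpoly set"
  let ?A = "{r. \<exists>N. (\<forall>i\<le>r. submodule (N i) base_ring ?M) \<and> (\<forall>i<r. N i \<subset> N (Suc i))}"
  note fp = forms_polys[of _ "n + 2" "int d"]
  interpret M: Module.module base_ring ?M by (rule component_module)
  have JV: "?J \<subseteq> ?V" using qrel_forms by blast
  have le: "r \<le> hdim T (n + 2) q (int d)" if r: "r \<in> ?A" for r
  proof -
    obtain N where N: "\<And>i. i \<le> r \<Longrightarrow> submodule (N i) base_ring ?M" "\<And>i. i < r \<Longrightarrow> N i \<subset> N (Suc i)"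
      using r by blast
    define W where "W = (\<lambda>i. {P \<in> ?V. fcls P \<in> N i})"
    have "r \<le> mp.codim ?V ?J"
    proof (rule mp.codim_sub_chain[OF forms_fin_dim])
      fix i assume i: "i \<le> r"
      note sm = M.submoduleE[OF N(1)[OF i]]
      interpret H: submodule "N i" base_ring ?M by (rule N(1)[OF i])
      have "\<zero>\<^bsub>?M\<^esub> \<in> N i" using H.one_closed by simp
      then have z: "fcls 0 \<in> N i" unfolding component_simps(2) .
      have "mp.subspace (W i)"
      proof (rule mp.subspaceI)
        show "0 \<in> W i" using z forms_0 by (simp add: W_def)
        show "x + y \<in> W i" if "x \<in> W i" "y \<in> W i" for x y
          using that sm(5)[of "fcls x" "fcls y"] by (simp add: W_def forms_add component_simps fp)
        show "mconst c * x \<in> W i" if "x \<in> W i" for c x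
          using that sm(4)[of c "fcls x"] by (simp add: W_def forms_scale component_simps fp base_ring_simps)
      qed
      moreover have "?J \<subseteq> W i"
      proof
        fix P assume P: "P \<in> ?J"
        then have "fcls P = fcls 0" using class_eq_forms[of P "int d" 0] JV forms_0 by auto
        then show "P \<in> W i" using z P JV by (auto simp: W_def)
      qed
      ultimately show "mp.subspace (W i) \<and> ?J \<subseteq> W i \<and> W i \<subseteq> ?V" by (auto simp: W_def)
    next
      fix i assume i: "i < r"
      then have "N (Suc i) \<subseteq> fcls ` ?V" using M.submoduleE(1)[OF N(1)[of "Suc i"]] by (simp add: component_simps)
      then show "W i \<subset> W (Suc i)" using N(2)[OF i] unfolding W_def by blast
    qed
    then show ?thesis by (simp add: hdim_def)
  qed
  have ex: "hdim T (n + 2) q (int d) \<in> ?A"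
  proof -
    have "\<exists>W. (\<forall>i \<le> mp.codim ?V ?J. mp.subspace (W i) \<and> ?J \<subseteq> W i \<and> W i \<subseteq> ?V) \<and>
        (\<forall>i < mp.codim ?V ?J. W i \<subset> W (Suc i))"
    proof (rule mp.codim_sub_chain_exists[OF forms_fin_dim forms_sub qrel_sub JV])
      fix W :: "nat \<Rightarrow> 'k mpoly set"
      assume "\<And>i. i \<le> mp.codim ?V ?J \<Longrightarrow> mp.subspace (W i) \<and> ?J \<subseteq> W i \<and> W i \<subseteq> ?V"
        "\<And>i. i < mp.codim ?V ?J \<Longrightarrow> W i \<subset> W (Suc i)"
      then show ?thesis by (intro exI[of _ W]) simp
    qed
    then obtain W where W: "\<And>i. i \<le> mp.codim ?V ?J \<Longrightarrow> mp.subspace (W i) \<and> ?J \<subseteq> W i \<and> W i \<subseteq> ?V"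
      "\<And>i. i < mp.codim ?V ?J \<Longrightarrow> W i \<subset> W (Suc i)" by blast
    define N where "N = (\<lambda>i. fcls ` W i)"
    have 1: "submodule (N i) base_ring ?M" if i: "i \<le> mp.codim ?V ?J" for i
    proof (rule M.submoduleI)
      have Wi: "mp.subspace (W i)" "?J \<subseteq> W i" "W i \<subseteq> ?V" using W(1)[OF i] by auto
      have wf: "x \<in> ?V" if "x \<in> W i" for x using that Wi(3) by blast
      show "N i \<subseteq> carrier ?M" using Wi by (auto simp: N_def component_simps)
      show "\<zero>\<^bsub>?M\<^esub> \<in> N i" using mp.subspace_0[OF Wi(1)] by (auto simp: N_def component_simps)
      show "a \<oplus>\<^bsub>?M\<^esub> b \<in> N i" if "a \<in> N i" "b \<in> N i" for a b
        using that mp.subspace_add[OF Wi(1)] wf by (auto simp: N_def component_simps fp)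
      show sc: "c \<odot>\<^bsub>?M\<^esub> x \<in> N i" if "c \<in> carrier base_ring" "x \<in> N i" for c x
        using that mp.subspace_scale[OF Wi(1)] wf by (auto simp: N_def component_simps fp)
      show "\<ominus>\<^bsub>?M\<^esub> a \<in> N i" if a: "a \<in> N i" for a
      proof -
        obtain x where x: "a = fcls x" "x \<in> W i" using a by (auto simp: N_def)
        have nx: "- x \<in> W i" by (rule mp.subspace_neg[OF Wi(1) x(2)])
        have "fcls (- x) \<oplus>\<^bsub>?M\<^esub> fcls x = fcls (- x + x)" by (intro component_simps fp wf nx x)
        then have "fcls (- x) \<oplus>\<^bsub>?M\<^esub> a = \<zero>\<^bsub>?M\<^esub>" unfolding x(1) component_simps(2) by simp
        then have "\<ominus>\<^bsub>?M\<^esub> a = fcls (- x)"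
          using x nx wf by (intro M.minus_equality) (auto simp: component_simps)
        then show ?thesis using nx by (auto simp: N_def)
      qed
    qed
    have 2: "N i \<subset> N (Suc i)" if i: "i < mp.codim ?V ?J" for i
    proof -
      have s: "mp.subspace (W i)" "?J \<subseteq> W i" "W i \<subseteq> ?V" "W (Suc i) \<subseteq> ?V"
        using W(1)[of i] W(1)[of "Suc i"] i by auto
      obtain P where P: "P \<in> W (Suc i)" "P \<notin> W i" using W(2)[OF i] by blast
      have "fcls P \<notin> N i"
      proof
        assume "fcls P \<in> N i"
        then obtain R where R: "R \<in> W i" "fcls P = fcls R" by (auto simp: N_def)
        then have "P - R \<in> W i" using class_eq_forms[of P "int d" R] P(1) s by blast
        then have "P - R + R \<in> W i" using mp.subspace_add[OF s(1)] R(1) by blast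
        then show False using P(2) by simp
      qed
      then show ?thesis using W(2)[OF i] P(1) unfolding N_def by blast
    qed
    show ?thesis using 1 2 by (auto simp: hdim_def)
  qed
  have "(SUP r \<in> ?A. enat r) = enat (hdim T (n + 2) q (int d))"
  proof (rule antisym)
    show "(SUP r \<in> ?A. enat r) \<le> enat (hdim T (n + 2) q (int d))" by (rule SUP_least) (use le in simp)
    show "enat (hdim T (n + 2) q (int d)) \<le> (SUP r \<in> ?A. enat r)" by (rule SUP_upper[OF ex])
  qed
  then show ?thesis by (simp add: module_length_def)
qed

end

section \<open>The generating function of the coefficients L\<close>

definition bin_fps :: "nat \<Rightarrow> rat fps" where
  "bin_fps N = Abs_fps (\<lambda>k. of_nat ((N + k) choose N))"

lemma bin_fps_step: "(1 - fps_X) * bin_fps (Suc N) = bin_fps N"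
proof (rule fps_ext)
  fix k
  show "((1 - fps_X) * bin_fps (Suc N)) $ k = bin_fps N $ k"
    by (cases k) (simp_all add: bin_fps_def algebra_simps)
qed

lemma bin_fps_0: "(1 - fps_X) * bin_fps 0 = 1"
proof (rule fps_ext)
  fix k
  show "((1 - fps_X) * bin_fps 0) $ k = 1 $ k"
    by (cases k) (simp_all add: bin_fps_def algebra_simps)
qed

lemma bin_fps_inverse: "(1 - fps_X) ^ Suc N * bin_fps N = 1"
proof (induction N)
  case (Suc N)
  have "(1 - fps_X) ^ Suc (Suc N) * bin_fps (Suc N) = (1 - fps_X) ^ Suc N * ((1 - fps_X) * bin_fps (Suc N))"
    by (simp only: power_Suc2 mult.assoc)
  then show ?case using Suc by (simp only: bin_fps_step)
qed (simp add: bin_fps_0)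

lemma prod_fact: "(\<Prod>t = j + 1..j + m. of_nat t :: rat) = fact (j + m) / fact j"
proof (induction m)
  case (Suc m)
  have "(\<Prod>t = j + 1..j + Suc m. of_nat t :: rat) = (\<Prod>t = j + 1..j + m. of_nat t) * of_nat (j + Suc m)"
    by (simp add: prod.nat_ivl_Suc' mult.commute)
  then show ?case unfolding Suc.IH by simp
qed simp

lemma L_fact: "n \<ge> 1 \<Longrightarrow> L n j = of_nat (2 * j + n) * fact (j + n - 1) / (fact j * fact n)"
  using prod_fact[of j "n - 1"] by (simp add: L_def)

lemma L_binomial:
  assumes n: "n \<ge> 1"
  shows "L n j = of_nat ((n + 1 + j) choose (n + 1)) - (if j < 2 then 0 else of_nat ((n + 1 + (j - 2)) choose (n + 1)))"
proof -
  obtain m where m: "n = Suc m" using n by (cases n) auto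
  consider "j = 0" | "j = 1" | i where "j = Suc (Suc i)" by (metis One_nat_def not0_implies_Suc)
  then show ?thesis
  proof cases
    case 1
    then show ?thesis unfolding L_fact[OF n] by (simp add: m)
  next
    case 2
    then show ?thesis unfolding L_fact[OF n] by simp
  next
    case (3 i)
    have a: "of_nat ((n + 1 + j) choose (n + 1)) = (fact (n + 1 + j) / (fact (n + 1) * fact j) :: rat)"
      by (subst binomial_fact) simp_all
    have b: "of_nat ((n + 1 + i) choose (n + 1)) = (fact (n + 1 + i) / (fact (n + 1) * fact i) :: rat)"
      by (subst binomial_fact) simp_all
    define F where "F = (fact (m + i + 2) :: rat)"
    have f1: "fact (n + 1 + j) = (of_nat (m + i + 4) * of_nat (m + i + 3) * F)"
      and f2: "fact (n + 1 + i) = F" and f3: "fact (j + n - 1) = F"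
      unfolding F_def m 3 by (simp_all add: numeral_eq_Suc algebra_simps)
    have g: "fact j = (of_nat (i + 2) * of_nat (i + 1) * fact i :: rat)" "fact (n + 1) = (of_nat (m + 2) * fact n :: rat)"
      unfolding m 3 by (simp_all add: numeral_eq_Suc algebra_simps)
    have nz: "(of_nat (i + 2) :: rat) \<noteq> 0" "(of_nat (i + 1) :: rat) \<noteq> 0" "(of_nat (m + 2) :: rat) \<noteq> 0" "(fact i :: rat) \<noteq> 0" "(fact n :: rat) \<noteq> 0"
      by (simp_all only: of_nat_eq_0_iff fact_nonzero) auto
    have "of_nat (m + i + 4) * of_nat (m + i + 3) - of_nat (i + 2) * of_nat (i + 1) = (of_nat (m + 2) * of_nat (2 * j + n) :: rat)"
      unfolding 3 m by (simp add: algebra_simps)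
    then have "of_nat (m + 2) * of_nat (2 * j + n) * F = (of_nat (m + i + 4) * of_nat (m + i + 3) * F - of_nat (i + 2) * of_nat (i + 1) * F :: rat)"
      by (simp only: left_diff_distrib[symmetric])
    then have "of_nat (2 * j + n) * F / (of_nat (i + 2) * of_nat (i + 1) * fact i * fact n)
      = of_nat (m + i + 4) * of_nat (m + i + 3) * F / (of_nat (m + 2) * fact n * (of_nat (i + 2) * of_nat (i + 1) * fact i))
       - F / (of_nat (m + 2) * fact n * fact i)"
      using nz by (simp add: divide_simps del: of_nat_add of_nat_mult) (simp only: algebra_simps)
    then show ?thesis unfolding L_fact[OF n] a f1 f3 g
      using b unfolding f2 g by (simp only: 3) simp
  qed
qed

text \<open>The \<open>L\<^sub>j\<close> are the dimensions of the graded pieces of the quadric ring itself.\<close>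

lemma L_fps:
  assumes "n \<ge> 1" shows "Abs_fps (L n) * (1 - fps_X) ^ (n + 2) = 1 - fps_X ^ 2"
proof -
  have "Abs_fps (L n) = (1 - fps_X ^ 2) * bin_fps (n + 1)"
    by (rule fps_ext) (auto simp: L_binomial[OF assms] bin_fps_def left_diff_distrib fps_X_power_mult_nth)
  then show ?thesis using bin_fps_inverse[of "n + 1"] by (simp add: mult.assoc mult.commute[of "bin_fps _"])
qed

definition box_fps :: "nat \<Rightarrow> nat \<Rightarrow> rat fps" where
  "box_fps N q = Abs_fps (\<lambda>d. of_nat (adim N q (int d)))"

lemma box_fps_step:
  assumes "q > 0"
  shows "(1 - fps_X) * box_fps (Suc N) q = (1 - fps_X ^ q) * box_fps N q"
proof (rule fps_ext)
  fix k
  have "of_int (int (adim (Suc N) q (int k)) - int (adim (Suc N) q (int k - 1))) =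
      (of_int (int (adim N q (int k)) - int (adim N q (int k - int q))) :: rat)"
    unfolding adim_diff ..
  then have "of_nat (adim (Suc N) q (int k)) - of_nat (adim (Suc N) q (int k - 1)) =
      (of_nat (adim N q (int k)) - of_nat (adim N q (int k - int q)) :: rat)" by simp
  then show "((1 - fps_X) * box_fps (Suc N) q) $ k = ((1 - fps_X ^ q) * box_fps N q) $ k"
    by (cases k)
      (auto simp: box_fps_def left_diff_distrib fps_X_power_mult_nth adim_neg of_nat_diff not_less algebra_simps)
qed

lemma box_fps_0: "q > 0 \<Longrightarrow> box_fps 0 q = 1"
  by (rule fps_ext) (simp add: box_fps_def adim_0)

lemma box_fps: "q > 0 \<Longrightarrow> (1 - fps_X) ^ N * box_fps N q = (1 - fps_X ^ q) ^ N"
proof (induction N)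
  case (Suc N)
  have "(1 - fps_X) ^ Suc N * box_fps (Suc N) q = (1 - fps_X) ^ N * ((1 - fps_X) * box_fps (Suc N) q)"
    by (simp only: power_Suc2 mult.assoc)
  also have "\<dots> = (1 - fps_X ^ q) * ((1 - fps_X) ^ N * box_fps N q)"
    by (simp only: box_fps_step[OF Suc.prems] mult.left_commute)
  finally show ?case using Suc by simp
qed (simp add: box_fps_0)

text \<open>The value that \<open>hdim\<close> would have if the relation \<open>h(d) = dim A\<^sub>d - dim A\<^bsub>d-2\<^esub> + h(d - 2 q)\<close> held in all
  degrees.\<close>

function free_dim :: "nat \<Rightarrow> nat \<Rightarrow> nat \<Rightarrow> int" where
  "free_dim n q d = adiff (n + 2) q (int d) + (if 0 < q \<and> 2 * q \<le> d then free_dim n q (d - 2 * q) else 0)"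
  by auto
termination by (relation "Wellfounded.measure (\<lambda>(n, q, d). d)") auto

declare free_dim.simps [simp del]

text \<open>Both sides have the generating function \<open>(1 - t\<^sup>2) / (1 - t)\<^bsup>n+2\<^esup>\<close>, because the one of \<open>free_dim\<close> is the
  quotient of this series by the same series in \<open>t\<^sup>q\<close>.\<close>

lemma free_dim_recursion:
  assumes n: "n \<ge> 1" and q: "q > 0"
  shows "L n d = (\<Sum>j = 0..d div q. L n j * of_int (free_dim n q (d - j * q)))"
proof -
  define G where "G = Abs_fps (\<lambda>d. of_int (free_dim n q d) :: rat)"
  define H where "H = Abs_fps (L n) oo fps_X ^ q"
  have Hn: "H $ k = (if q dvd k then L n (k div q) else 0)" for k
    unfolding H_def using q by (simp add: fps_nth_compose_X_power)
  have G: "G * (1 - fps_X ^ (2 * q)) = box_fps (n + 2) q * (1 - fps_X ^ 2)"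
  proof (rule fps_ext)
    fix k
    have "G $ k = of_int (adiff (n + 2) q (int k)) + (if 2 * q \<le> k then G $ (k - 2 * q) else 0)"
      unfolding G_def using q by (simp add: free_dim.simps[of n q k])
    moreover have "(box_fps (n + 2) q * (1 - fps_X ^ 2)) $ k = of_int (adiff (n + 2) q (int k))"
      by (auto simp: box_fps_def right_diff_distrib fps_X_power_mult_right_nth adiff_def adim_neg of_nat_diff not_less)
    ultimately show "(G * (1 - fps_X ^ (2 * q))) $ k = (box_fps (n + 2) q * (1 - fps_X ^ 2)) $ k"
      by (auto simp: right_diff_distrib fps_X_power_mult_right_nth)
  qed
  have z: "(fps_X ^ q :: rat fps) $ 0 = 0" using q by simp
  have "H * (1 - fps_X ^ q) ^ (n + 2) = (Abs_fps (L n) * (1 - fps_X) ^ (n + 2)) oo fps_X ^ q"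
    unfolding H_def using z
    by (simp add: fps_compose_mult_distrib fps_compose_power[symmetric] fps_compose_sub_distrib)
  also have "\<dots> = 1 - fps_X ^ (2 * q)"
    unfolding L_fps[OF n] using z
    by (simp add: fps_compose_sub_distrib fps_compose_power[symmetric] power_mult[symmetric] mult.commute)
  finally have H: "H * (1 - fps_X ^ q) ^ (n + 2) = 1 - fps_X ^ (2 * q)" .
  have "(G * H) * (1 - fps_X ^ q) ^ (n + 2) = G * (1 - fps_X ^ (2 * q))" by (simp only: mult.assoc H)
  also have "\<dots> = box_fps (n + 2) q * (Abs_fps (L n) * (1 - fps_X) ^ (n + 2))" by (simp only: G L_fps[OF n])
  also have "\<dots> = Abs_fps (L n) * ((1 - fps_X) ^ (n + 2) * box_fps (n + 2) q)" by (simp only: mult_ac)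
  also have "\<dots> = Abs_fps (L n) * (1 - fps_X ^ q) ^ (n + 2)" by (simp only: box_fps[OF q])
  finally have "(G * H) * (1 - fps_X ^ q) ^ (n + 2) = Abs_fps (L n) * (1 - fps_X ^ q) ^ (n + 2)" .
  moreover have "(1 - fps_X ^ q :: rat fps) ^ (n + 2) \<noteq> 0"
  proof -
    have "(1 - fps_X ^ q :: rat fps) $ 0 = 1" using q by simp
    then have "(1 - fps_X ^ q :: rat fps) \<noteq> 0" by (metis fps_zero_nth zero_neq_one)
    then show ?thesis by (rule power_not_zero)
  qed
  ultimately have "H * G = Abs_fps (L n)" by (simp add: mult.commute)
  then have "L n d = (H * G) $ d" by simp
  also have "\<dots> = (\<Sum>i = 0..d. H $ i * G $ (d - i))" by (rule fps_mult_nth)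
  also have "\<dots> = (\<Sum>i \<in> (\<lambda>j. j * q) ` {0..d div q}. H $ i * G $ (d - i))"
  proof (rule sum.mono_neutral_right)
    show "(\<lambda>j. j * q) ` {0..d div q} \<subseteq> {0..d}"
      by (auto simp: less_eq_div_iff_mult_less_eq[OF q])
    show "\<forall>i \<in> {0..d} - (\<lambda>j. j * q) ` {0..d div q}. H $ i * G $ (d - i) = 0"
    proof
      fix i assume i: "i \<in> {0..d} - (\<lambda>j. j * q) ` {0..d div q}"
      have "\<not> q dvd i"
      proof
        assume "q dvd i"
        then have "i = (i div q) * q" by simp
        moreover have "i div q \<le> d div q" using i by (intro div_le_mono) auto
        ultimately show False using i by (metis DiffD2 atLeastAtMost_iff image_eqI le0)
      qed
      then show "H $ i * G $ (d - i) = 0" by (simp add: Hn)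
    qed
  qed simp
  also have "\<dots> = (\<Sum>j = 0..d div q. H $ (j * q) * G $ (d - j * q))"
    by (subst sum.reindex) (use q in \<open>auto intro!: inj_onI\<close>)
  also have "\<dots> = (\<Sum>j = 0..d div q. L n j * of_int (free_dim n q (d - j * q)))"
    using q by (intro sum.cong refl) (simp add: Hn G_def)
  finally show ?thesis .
qed

section \<open>The recursive polynomials\<close>

text \<open>The recursion for \<open>Y\<close> is the one for \<open>Z\<close> under the substitution \<open>x \<mapsto> n - x\<close>.\<close>

lemma Y_poly_reflect:
  assumes "i \<le> n - 1"
  shows "Y_poly n i = pcompose (Z_poly n (n - 1 - i)) [:of_nat n, -1:]"
  using assms
proof (induction "n - 1 - i" arbitrary: i rule: less_induct)
  case less
  have "pcompose (Y_poly n (i + j)) [:of_nat j, 1:] =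
      pcompose (pcompose (Z_poly n (n - 1 - i - j)) [:- of_nat j, 1:]) [:of_nat n, -1:]"
    if j: "j \<in> {1..n - 1 - i}" for j
  proof -
    have "Y_poly n (i + j) = pcompose (Z_poly n (n - 1 - (i + j))) [:of_nat n, -1:]"
      by (rule less.hyps) (use j less.prems in auto)
    moreover have "pcompose [:of_nat n, -1:] [:of_nat j, 1:] = pcompose [:- of_nat j, 1:] [:of_nat n, -1 :: rat:]"
      by (simp add: pcompose_pCons)
    ultimately show ?thesis by (simp flip: pcompose_assoc)
  qed
  moreover have "pcompose ([:0, 1:] ^ m) [:of_nat n, -1:] = [:of_nat n, -1 :: rat:] ^ m" for m
    by (induction m) (simp_all add: pcompose_mult pcompose_pCons pcompose_1)
  ultimately show ?case
    by (subst Y_poly.simps, subst Z_poly.simps) (simp add: pcompose_diff pcompose_smult pcompose_sum)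
qed

lemma Z_poly_degree_le: "Polynomial.degree (Z_poly n i) \<le> n"
proof (induction i rule: less_induct)
  case (less i)
  have "Polynomial.degree ([:0, 1:] ^ n :: rat poly) \<le> n"
    using degree_power_le[of "[:0, 1:] :: rat poly" n] by simp
  moreover have "Polynomial.degree (pcompose (Z_poly n (i - j)) [:- of_nat j, 1:]) \<le> n" if "j \<in> {1..i}" for j
    using less.IH[of "i - j"] that by (simp add: degree_pcompose)
  ultimately show ?case
    by (subst Z_poly.simps) (intro degree_diff_le degree_sum_le order.trans[OF degree_smult_le] finite_atLeastAtMost)
qed

lemma Z_lead: "coeff (Z_poly n i) n = 2 / fact n - (\<Sum>j = 1..i. L n j * coeff (Z_poly n (i - j)) n)"
proof -
  have 1: "coeff ([:0, 1:] ^ n :: rat poly) n = 1"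
    using coeff_linear_power[of "0 :: rat" n] by simp
  have 2: "coeff (pcompose P [:- of_nat j, 1:]) n = coeff P n" if "Polynomial.degree P \<le> n" for P :: "rat poly" and j
  proof (cases "Polynomial.degree P = n")
    case True
    then show ?thesis using lead_coeff_comp[of "[:- of_nat j, 1 :: rat:]" P] by (simp add: degree_pcompose)
  next
    case False
    then have "Polynomial.degree P < n" using that by simp
    then show ?thesis by (simp add: coeff_eq_0 degree_pcompose)
  qed
  show ?thesis by (subst Z_poly.simps) (simp add: coeff_sum 1 2[OF Z_poly_degree_le])
qed

text \<open>A recursion for the generating function of the leading coefficients is obtained from the recursion by ignoring the shifts:
  its product with the series of the \<open>L\<^sub>j\<close> is \<open>(2 / n!) / (1 - t)\<close>, so it equals
  \<open>(2 / n!) (1 - t)\<^sup>n / (1 + t)\<close>. The leading coefficients therefore do not vanish.\<close>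

lemma Z_lead_sum:
  assumes "n \<ge> 1"
  shows "(-1) ^ i * coeff (Z_poly n i) n = 2 / fact n * (\<Sum>k\<le>i. of_nat (n choose k))"
proof -
  define c :: "rat fps" where "c = Abs_fps (\<lambda>i. coeff (Z_poly n i) n)"
  have L0: "L n 0 = 1" using L_fact[OF assms, of 0] assms by (cases n) simp_all
  have "Abs_fps (L n) * c = fps_const (2 / fact n) * bin_fps 0"
  proof (rule fps_ext)
    fix i
    have "(Abs_fps (L n) * c) $ i = (\<Sum>j = 0..i. L n j * coeff (Z_poly n (i - j)) n)"
      by (simp add: fps_mult_nth c_def)
    also have "\<dots> = coeff (Z_poly n i) n + (\<Sum>j = 1..i. L n j * coeff (Z_poly n (i - j)) n)"
      by (simp add: sum.atLeast_Suc_atMost L0)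
    also have "\<dots> = 2 / fact n" by (subst Z_lead) simp
    finally show "(Abs_fps (L n) * c) $ i = (fps_const (2 / fact n) * bin_fps 0) $ i" by (simp add: bin_fps_def)
  qed
  then have "(Abs_fps (L n) * (1 - fps_X) ^ (n + 2)) * c = (fps_const (2 / fact n) * (1 - fps_X) ^ (n + 1)) * ((1 - fps_X) * bin_fps 0)"
    by (simp add: mult_ac)
  then have "(1 - fps_X) * ((1 + fps_X) * c) = (1 - fps_X) * (fps_const (2 / fact n) * (1 - fps_X) ^ n)"
    unfolding L_fps[OF assms] bin_fps_0 by (simp add: power2_eq_square algebra_simps)
  moreover have "(1 - fps_X :: rat fps) \<noteq> 0"
  proof
    assume "(1 - fps_X :: rat fps) = 0"
    then have "(1 - fps_X :: rat fps) $ 0 = 0 $ 0" by (rule arg_cong)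
    then show False by simp
  qed
  ultimately have e: "(1 + fps_X) * c = fps_const (2 / fact n) * (1 - fps_X) ^ n"
    by (metis mult_left_cancel)
  have b: "((1 - fps_X :: rat fps) ^ n) $ i = (-1) ^ i * of_nat (n choose i)" for i
  proof -
    have "(1 - fps_X :: rat fps) ^ n = (\<Sum>k\<le>n. of_nat (n choose k) * (- fps_X) ^ k)"
      using binomial_ring[of "- fps_X :: rat fps" 1 n] by simp
    also have "\<dots> = (\<Sum>k\<le>n. fps_const ((-1) ^ k * of_nat (n choose k)) * fps_X ^ k)"
      by (intro sum.cong refl) (simp add: power_minus[of fps_X] fps_of_nat[symmetric] fps_const_neg[symmetric] del: fps_const_neg
          flip: fps_const_power fps_const_mult)
    finally have "((1 - fps_X :: rat fps) ^ n) $ i = (\<Sum>k\<le>n. (-1) ^ k * of_nat (n choose k) * (if i = k then 1 else 0))"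
      by (simp add: fps_sum_nth)
    also have "\<dots> = (\<Sum>k\<le>n. if k = i then (-1) ^ i * of_nat (n choose i) else 0)"
      by (rule sum.cong) auto
    also have "\<dots> = (-1) ^ i * of_nat (n choose i)" by (cases "i \<le> n") (simp_all add: binomial_eq_0)
    finally show ?thesis .
  qed
  show ?thesis
  proof (induction i)
    case 0
    have "((1 + fps_X) * c) $ 0 = coeff (Z_poly n 0) n" by (simp add: c_def distrib_right)
    then show ?case using e b[of 0] by simp
  next
    case (Suc i)
    have "((1 + fps_X) * c) $ Suc i = coeff (Z_poly n (Suc i)) n + coeff (Z_poly n i) n" by (simp add: c_def distrib_right)
    moreover have "((1 + fps_X) * c) $ Suc i = 2 / fact n * ((-1) ^ Suc i * of_nat (n choose Suc i))"
      unfolding e by (simp add: b)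
    ultimately have "coeff (Z_poly n (Suc i)) n = 2 / fact n * ((-1) ^ Suc i * of_nat (n choose Suc i)) - coeff (Z_poly n i) n"
      by simp
    then have "(-1) ^ Suc i * coeff (Z_poly n (Suc i)) n
        = (-1) ^ Suc i * (2 / fact n * ((-1) ^ Suc i * of_nat (n choose Suc i)) - coeff (Z_poly n i) n)" by (simp only:)
    also have "\<dots> = ((-1) ^ i * (-1) ^ i) * (2 / fact n * of_nat (n choose Suc i)) + (-1) ^ i * coeff (Z_poly n i) n"
      by (simp add: algebra_simps)
    also have "((-1) ^ i * (-1) ^ i :: rat) = 1" by (simp flip: power_mult_distrib)
    finally have "(-1) ^ Suc i * coeff (Z_poly n (Suc i)) n = 2 / fact n * of_nat (n choose Suc i) + (-1) ^ i * coeff (Z_poly n i) n"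
      by (simp only: mult_1_left)
    then show ?case using Suc by (simp add: distrib_left)
  qed
qed

lemma Z_poly_degree:
  assumes "n \<ge> 1" shows "Polynomial.degree (Z_poly n i) = n"
proof -
  have "(\<Sum>k\<le>i. of_nat (n choose k) :: rat) \<ge> (\<Sum>k\<in>{0}. of_nat (n choose k))"
    by (rule sum_mono2) auto
  then have "(-1) ^ i * coeff (Z_poly n i) n \<noteq> 0" unfolding Z_lead_sum[OF assms] by simp
  then have "coeff (Z_poly n i) n \<noteq> 0" by auto
  then show ?thesis using le_degree Z_poly_degree_le by (metis order.antisym)
qed

lemma Y_poly_degree: "n \<ge> 1 \<Longrightarrow> i \<le> n - 1 \<Longrightarrow> Polynomial.degree (Y_poly n i) = n"
  by (simp add: Y_poly_reflect degree_pcompose Z_poly_degree)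

section \<open>The polynomials as real functions\<close>

abbreviation "rpoly \<equiv> (map_poly of_rat :: rat poly \<Rightarrow> real poly)"

lemma rpoly_hom: "rpoly (p - q) = rpoly p - rpoly q" "rpoly (smult c p) = smult (of_rat c) (rpoly p)"
    "rpoly (p * q) = rpoly p * rpoly q" "rpoly 1 = 1" "rpoly (p + q) = rpoly p + rpoly q"
  by (auto intro!: poly_eqI simp: coeff_map_poly of_rat_diff of_rat_mult of_rat_add coeff_mult of_rat_sum)

lemma rpoly_power: "rpoly (p ^ k) = rpoly p ^ k"
  by (induction k) (simp_all add: rpoly_hom)

lemma rpoly_sum: "rpoly (sum f A) = (\<Sum>a\<in>A. rpoly (f a))"
  by (induction A rule: infinite_finite_induct) (simp_all add: rpoly_hom)

lemma rpoly_pcompose: "rpoly (pcompose p r) = pcompose (rpoly p) (rpoly r)"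
proof (induction p rule: pCons_induct)
  case (pCons a p)
  have "rpoly (pCons a p) = pCons (of_rat a) (rpoly p)"
    by (rule poly_eqI) (simp add: coeff_map_poly coeff_pCons split: nat.splits)
  moreover have "rpoly [:a:] = [:of_rat a:]"
    by (rule poly_eqI) (simp add: coeff_map_poly coeff_pCons split: nat.splits)
  ultimately show ?case using pCons by (simp add: pcompose_pCons rpoly_hom)
qed simp

lemma rpoly_lin: "rpoly [:a, b:] = [:of_rat a, of_rat b:]"
  by (rule poly_eqI) (simp add: coeff_map_poly coeff_pCons split: nat.splits)

lemma of_rat_fact [simp]: "of_rat (fact n) = (fact n :: real)"
  by (metis of_nat_fact of_rat_of_nat_eq)

lemma Z_recursion: "Z n i x = 2 * x ^ n / fact n - (\<Sum>j = 1..i. of_rat (L n j) * Z n (i - j) (x - real j))"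
  unfolding Z_def
  by (subst Z_poly.simps)
    (simp add: rpoly_hom rpoly_power rpoly_sum rpoly_pcompose rpoly_lin poly_sum poly_pcompose of_rat_divide of_rat_minus add.commute)

lemma Y_eq_Z: "i \<le> n - 1 \<Longrightarrow> Y n i x = Z n (n - 1 - i) (real n - x)"
  unfolding Y_def Z_def by (simp add: Y_poly_reflect rpoly_pcompose rpoly_lin poly_pcompose)

lemma Z_continuous: "continuous_on A (Z n i)"
  unfolding Z_def[abs_def] by (intro continuous_intros)

text \<open>\<open>L n d\<close> is a polynomial in \<open>d\<close> of degree \<open>n\<close> with leading coefficient \<open>2 / n!\<close>.\<close>

lemma L_tendsto:
  assumes n: "n \<ge> 1" and x: "x \<ge> 0" and p: "p \<ge> 2"
  shows "(\<lambda>s. of_rat (L n (nat \<lfloor>x * real (p ^ s)\<rfloor>)) / real (p ^ s) ^ n) \<longlonglongrightarrow> 2 * x ^ n / fact n"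
proof -
  define d where "d = (\<lambda>s. real (nat \<lfloor>x * real (p ^ s)\<rfloor>) / real (p ^ s))"
  define e where "e = (\<lambda>s. 1 / real (p ^ s))"
  have e: "e \<longlonglongrightarrow> 0"
  proof -
    have "(\<lambda>s. (1 / real p) ^ s) \<longlonglongrightarrow> 0" using p by (intro LIMSEQ_power_zero) simp
    then show ?thesis by (simp add: e_def power_one_over)
  qed
  have p0: "real (p ^ s) > 0" for s using p by simp
  have div: "x - 1 / q \<le> y / q" if "x * q - 1 \<le> y" "q > 0" for q y :: real
    using that by (simp add: field_simps)
  have d: "d \<longlonglongrightarrow> x"
  proof (rule tendsto_sandwich)
    show "\<forall>\<^sub>F s in sequentially. x - e s \<le> d s"
    proof (intro always_eventually allI)
      fix s
      have "x * real (p ^ s) - 1 \<le> real (nat \<lfloor>x * real (p ^ s)\<rfloor>)" by linarith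
      then show "x - e s \<le> d s" unfolding d_def e_def by (rule div[OF _ p0])
    qed
    show "\<forall>\<^sub>F s in sequentially. d s \<le> x"
    proof (intro always_eventually allI)
      fix s
      have "0 \<le> x * real (p ^ s)" using x p0[of s] by simp
      then have "real (nat \<lfloor>x * real (p ^ s)\<rfloor>) \<le> x * real (p ^ s)" by linarith
      then show "d s \<le> x" unfolding d_def by (subst pos_divide_le_eq[OF p0])
    qed
    show "(\<lambda>s. x - e s) \<longlonglongrightarrow> x" using tendsto_diff[OF tendsto_const e, of x] by simp
  qed simp
  have "(\<lambda>s. (2 * d s + real n * e s) * (\<Prod>t = 1..n - 1. d s + real t * e s) / fact n)
      \<longlonglongrightarrow> (2 * x + real n * 0) * (\<Prod>t = 1..n - 1. x + real t * 0) / fact n"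
    by (intro tendsto_intros d e) simp
  moreover have "of_rat (L n (nat \<lfloor>x * real (p ^ s)\<rfloor>)) / real (p ^ s) ^ n =
      (2 * d s + real n * e s) * (\<Prod>t = 1..n - 1. d s + real t * e s) / fact n" for s
  proof -
    define q where "q = real (p ^ s)"
    define D where "D = nat \<lfloor>x * q\<rfloor>"
    have q: "q > 0" using p0 q_def by simp
    have ds: "d s = real D / q" "e s = 1 / q" by (simp_all add: d_def e_def D_def q_def)
    have "(\<Prod>t = D + 1..D + n - 1. real t) = (\<Prod>t = 1..n - 1. real D + real t)"
    proof -
      have "D + n - 1 = n - 1 + D" using n by simp
      then have "(\<Prod>t = D + 1..D + n - 1. real t) = (\<Prod>t = 1 + D..n - 1 + D. real t)" by (simp add: add.commute)
      also have "\<dots> = (\<Prod>t = 1..n - 1. real (t + D))" by (rule prod.shift_bounds_cl_nat_ivl)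
      finally show ?thesis by (simp add: add.commute)
    qed
    moreover have "(\<Prod>t = 1..n - 1. d s + real t * e s) = (\<Prod>t = 1..n - 1. real D + real t) / q ^ (n - 1)"
      unfolding ds using prod_dividef[of "\<lambda>t. real D + real t" "\<lambda>_. q" "{1..n - 1}"]
      by (simp add: add_divide_distrib)
    moreover have "2 * d s + real n * e s = (2 * real D + real n) / q" unfolding ds by (simp add: add_divide_distrib)
    moreover have "q ^ n = q * q ^ (n - 1)" using n by (cases n) auto
    moreover have "of_rat (L n D) = (2 * real D + real n) * (\<Prod>t = D + 1..D + n - 1. real t) / fact n"
      by (simp add: L_def of_rat_mult of_rat_divide of_rat_add of_rat_prod)
    ultimately show ?thesis unfolding D_def[symmetric] q_def[symmetric] by simp
  qed
  ultimately show ?thesis using n by (cases n) (simp_all add: algebra_simps)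
qed

text \<open>The recursion \<open>free_dim_recursion\<close> has a number of terms that is constant for \<open>x\<close> in a unit interval, and it becomes
  the recursion of the polynomials \<open>Z\<close> after division by \<open>q\<^sup>n\<close>.\<close>

lemma free_dim_tendsto:
  assumes n: "n \<ge> 1" and p: "p \<ge> 2" and x: "real i \<le> x" "x < real i + 1"
  shows "(\<lambda>s. of_int (free_dim n (p ^ s) (nat \<lfloor>x * real (p ^ s)\<rfloor>)) / real (p ^ s) ^ n) \<longlonglongrightarrow> Z n i x"
  using x
proof (induction i arbitrary: x rule: less_induct)
  case (less i)
  let ?d = "\<lambda>x s. nat \<lfloor>x * real (p ^ s)\<rfloor>"
  let ?F = "\<lambda>x s. of_int (free_dim n (p ^ s) (?d x s)) / real (p ^ s) ^ n"
  have x0: "x \<ge> 0" using less.prems by linarith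
  have p0: "real (p ^ s) > 0" for s using p by simp
  have L0: "L n 0 = 1" using L_fact[OF n, of 0] n by (cases n) simp_all
  have "(\<lambda>s. of_rat (L n (?d x s)) / real (p ^ s) ^ n - (\<Sum>j = 1..i. of_rat (L n j) * ?F (x - real j) s))
    \<longlonglongrightarrow> 2 * x ^ n / fact n - (\<Sum>j = 1..i. of_rat (L n j) * Z n (i - j) (x - real j))"
    by (intro tendsto_diff L_tendsto n x0 p tendsto_sum tendsto_mult tendsto_const less.IH) (use less.prems in auto)
  moreover have "of_rat (L n (?d x s)) / real (p ^ s) ^ n - (\<Sum>j = 1..i. of_rat (L n j) * ?F (x - real j) s) = ?F x s" for s
  proof -
    let ?q = "p ^ s"
    have q0: "?q > 0" using p by simp
    have di: "?d x s div ?q = i"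
    proof -
      have "real i * real ?q \<le> x * real ?q" using less.prems p0[of s] by (intro mult_right_mono) auto
      then have "i * ?q \<le> ?d x s" using x0 by (simp add: le_nat_iff le_floor_iff)
      moreover have "x * real ?q < (real i + 1) * real ?q" using less.prems p0[of s] by (intro mult_strict_right_mono) auto
      then have "\<lfloor>x * real ?q\<rfloor> < int ((i + 1) * ?q)" by (simp add: floor_less_iff algebra_simps)
      then have "?d x s < (i + 1) * ?q" using q0 by (subst nat_less_iff) (use x0 in auto)
      ultimately show ?thesis using q0 by (intro div_nat_eqI) (auto simp: mult.commute)
    qed
    have sh: "?d x s - j * ?q = ?d (x - real j) s" if "j \<le> i" for j
    proof -
      have "(x - real j) * real ?q = x * real ?q - of_int (int (j * ?q))" by (simp add: algebra_simps)
      then have "\<lfloor>(x - real j) * real ?q\<rfloor> = \<lfloor>x * real ?q\<rfloor> - int (j * ?q)" by (simp only: floor_diff_of_int)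
      then show ?thesis using x0 by (simp add: nat_diff_distrib' flip: of_nat_mult)
    qed
    have "L n (?d x s) = (\<Sum>j = 0..i. L n j * of_int (free_dim n ?q (?d x s - j * ?q)))"
      using free_dim_recursion[OF n q0, of "?d x s"] unfolding di .
    also have "\<dots> = of_int (free_dim n ?q (?d x s)) + (\<Sum>j = 1..i. L n j * of_int (free_dim n ?q (?d x s - j * ?q)))"
      by (subst sum.atLeast_Suc_atMost) (simp_all add: L0)
    also have "(\<Sum>j = 1..i. L n j * of_int (free_dim n ?q (?d x s - j * ?q))) = (\<Sum>j = 1..i. L n j * of_int (free_dim n ?q (?d (x - real j) s)))"
      by (intro sum.cong refl) (simp only: sh atLeastAtMost_iff)
    finally have "(of_rat (L n (?d x s)) :: real) = of_int (free_dim n ?q (?d x s)) +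
        (\<Sum>j = 1..i. of_rat (L n j) * of_int (free_dim n ?q (?d (x - real j) s)))"
      by (simp add: of_rat_add of_rat_sum of_rat_mult)
    then show ?thesis by (simp add: add_divide_distrib sum_divide_distrib)
  qed
  ultimately show ?case unfolding Z_recursion[of n i x] by simp
qed

section \<open>Hilbert functions of the Frobenius quotients\<close>

context
  fixes n p s q :: nat and T :: "'k::field itself" and R Q m :: int
  assumes p: "prime p" "CHAR('k) = p" "odd p" and n: "n \<ge> 2" and q: "q = p ^ Suc s"
    and R: "R = int (p ^ s)" and Q: "Q = int q" and m: "m = int n"
begin

private lemma half_p: obtains H :: int where "H \<ge> 1" "int ((p - 1) div 2) = H" "int p = 2 * H + 1" "Q = (2 * H + 1) * R"
proof
  obtain h where h: "p = 2 * h + 1" using p(3) by (rule oddE)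
  have "h \<noteq> 0"
  proof
    assume "h = 0"
    then have "p = 1" using h by simp
    then show False using p(1) by simp
  qed
  then show "int ((p - 1) div 2) \<ge> 1" using h by simp
  show "int ((p - 1) div 2) = int ((p - 1) div 2)" ..
  show P: "int p = 2 * int ((p - 1) div 2) + 1" using h by simp
  have "Q = int p * R" unfolding Q q R by simp
  then show "Q = (2 * int ((p - 1) div 2) + 1) * R" unfolding P .
qed

private lemma R_pos: "R \<ge> 1"
proof -
  have "p ^ s > 0" using prime_gt_0_nat[OF p(1)] by simp
  then show ?thesis unfolding R by linarith
qed

private lemma int_r1: "int (p ^ s - 1) = R - 1"
proof -
  have "p ^ s > 0" using prime_gt_0_nat[OF p(1)] by simp
  then have "1 \<le> p ^ s" by linarith
  then show ?thesis unfolding R by (simp only: of_nat_diff of_nat_1)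
qed

private lemma Q_large: "2 * R < Q"
proof -
  obtain H where "H \<ge> 1" and Q: "Q = (2 * H + 1) * R" by (rule half_p)
  then have "1 * R \<le> H * R" using R_pos by (intro mult_right_mono) auto
  then show ?thesis unfolding Q using R_pos by (simp add: algebra_simps)
qed

private lemma int_q1: "int (q - 1) = Q - 1"
  using Q_large R_pos unfolding Q by (simp add: of_nat_diff)

private lemma hdim_eq_rk_high:
  assumes "2 * d > (m + 2) * Q + (m - 2) * R - 2 * m"
  shows "hdim T (n + 2) q d = rk T (n + 2) q (q - 1) d"
proof -
  obtain H where H: "H \<ge> 1" "int ((p - 1) div 2) = H" "Q = (2 * H + 1) * R" by (rule half_p)
  have "int n * int (p ^ s - 1) + int (p ^ s) * int ((n + 2) * ((p - 1) div 2)) = m * (R - 1) + R * ((m + 2) * H)"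
    unfolding of_nat_mult of_nat_add int_r1 H(2) R[symmetric] m[symmetric] by simp
  also have "\<dots> < d" using assms unfolding H(3) by (simp add: algebra_simps)
  finally show ?thesis unfolding q by (rule hdim_high[OF p n])
qed

private lemma hdim_eq_rk_low:
  assumes "2 * d < m * Q - (m + 2) * R + 4"
  shows "hdim T (n + 2) q d = rk T (n + 2) q (q - 1) d"
proof -
  obtain H where H: "H \<ge> 1" "int ((p - 1) div 2) = H" "int p = 2 * H + 1" "Q = (2 * H + 1) * R" by (rule half_p)
  have "d + 2 * int (p ^ s - 1) = d + 2 * (R - 1)" unfolding int_r1 ..
  also have "\<dots> < R * ((m + 2) * H - (2 * H + 1) + 2)" using assms unfolding H(4) by (simp add: algebra_simps)
  also have "\<dots> = int (p ^ s) * (int ((n + 2) * ((p - 1) div 2)) - int p + 2)"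
    unfolding of_nat_mult of_nat_add H(2,3) R[symmetric] m[symmetric] by simp
  finally show ?thesis unfolding q by (rule hdim_low[OF p])
qed

private lemma minus_2Q: "2 * x < y \<Longrightarrow> 2 * (x - 2 * Q) < y"
  using Q_large R_pos by (simp add: right_diff_distrib)

private lemma rk_reflect: "rk T (n + 2) q (q - 1) d = rk T (n + 2) q (q - 1) (m * (Q - 1) - d)"
  by (rule rk_duality) (use Q_large R_pos int_q1 in \<open>simp_all add: Q m algebra_simps\<close>)

private lemma hdim_ge_rk: "rk T (n + 2) q (q - 1) d \<le> hdim T (n + 2) q d"
  unfolding q by (rule rk_le_hdim[OF p(1,2)])

private lemma hdim_dual: "int (hdim T (n + 2) q d) = adiff (n + 2) q d + int (hdim T (n + 2) q ((m + 2) * (Q - 1) - d + 2))"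
proof -
  have "q > 0" using Q_large R_pos Q by simp
  from hdim_duality[OF this, of T "n + 2" d]
  have "hdim T (n + 2) q d + adim (n + 2) q (d - 2) = adim (n + 2) q d + hdim T (n + 2) q ((m + 2) * (Q - 1) - d + 2)"
    unfolding int_q1 m by (simp only: of_nat_add of_nat_numeral)
  then show ?thesis unfolding adiff_def by linarith
qed

private lemma low_bound: "(m - 2) * Q - (m - 2) * R < m * Q - (m + 2) * R + 4"
  using Q_large by (simp add: algebra_simps)

text \<open>In low degrees the socle degree reflection and the Lefschetz property let one pass from
  degree \<open>d\<close> to degree \<open>d - 2 * q\<close>, which is the recursion defining \<^const>\<open>free_dim\<close>.\<close>

lemma hdim_eq_free_dim:
  assumes "2 * int d < (m + 2) * Q - (m - 2) * R"
  shows "int (hdim T (n + 2) q (int d)) = free_dim n q d"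
  using assms
proof (induction d rule: less_induct)
  case (less d)
  let ?e = "(m + 2) * (Q - 1) - int d + 2"
  have "2 * ?e > (m + 2) * Q + (m - 2) * R - 2 * m" using less.prems by (simp add: algebra_simps)
  then have "hdim T (n + 2) q ?e = rk T (n + 2) q (q - 1) ?e" by (rule hdim_eq_rk_high)
  also have "\<dots> = rk T (n + 2) q (q - 1) (m * (Q - 1) - ?e)" by (rule rk_reflect)
  also have "m * (Q - 1) - ?e = int d - 2 * Q" by (simp add: algebra_simps)
  also have "rk T (n + 2) q (q - 1) (int d - 2 * Q) = hdim T (n + 2) q (int d - 2 * Q)"
    by (rule hdim_eq_rk_low[symmetric], rule order.strict_trans[OF _ low_bound])
      (use less.prems in \<open>simp add: algebra_simps\<close>)
  finally have e: "hdim T (n + 2) q ?e = hdim T (n + 2) q (int d - 2 * Q)" .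
  have q0: "q > 0" using Q_large R_pos Q by simp
  show ?case
  proof (cases "2 * q \<le> d")
    case True
    then have dq: "int d - 2 * Q = int (d - 2 * q)" unfolding Q by (simp add: of_nat_diff)
    have "2 * int (d - 2 * q) < (m + 2) * Q - (m - 2) * R" unfolding dq[symmetric] by (rule minus_2Q[OF less.prems])
    then have "int (hdim T (n + 2) q (int (d - 2 * q))) = free_dim n q (d - 2 * q)"
      using True q0 by (intro less.IH) auto
    then show ?thesis using e unfolding hdim_dual[of "int d"] free_dim.simps[of n q d] dq using True q0 by simp
  next
    case False
    then have "int d - 2 * Q < 0" unfolding Q by simp
    from hdim_neg[OF this, of T] show ?thesis
      using e unfolding hdim_dual[of "int d"] free_dim.simps[of n q d] using False by simp
  qed
qed

text \<open>Beyond the low range the rank of \<open>Q\<^bsup>q-1\<^esup>\<close> is still a lower bound for the dimension in the reflected degree.\<close>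

lemma hdim_ge_free_dim:
  assumes "2 * (int d - 2 * Q) < m * Q - (m + 2) * R + 4"
  shows "int (hdim T (n + 2) q (int d)) \<ge> free_dim n q d"
proof -
  let ?e = "(m + 2) * (Q - 1) - int d + 2"
  have "hdim T (n + 2) q (int d - 2 * Q) = rk T (n + 2) q (q - 1) (int d - 2 * Q)"
    by (rule hdim_eq_rk_low) (rule assms)
  also have "int d - 2 * Q = m * (Q - 1) - ?e" by (simp add: algebra_simps)
  also have "rk T (n + 2) q (q - 1) (m * (Q - 1) - ?e) = rk T (n + 2) q (q - 1) ?e" by (rule rk_reflect[symmetric])
  also have "\<dots> \<le> hdim T (n + 2) q ?e" by (rule hdim_ge_rk)
  finally have "hdim T (n + 2) q (m * (Q - 1) - ?e) \<le> hdim T (n + 2) q ?e" .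
  moreover have eq: "m * (Q - 1) - ?e = int d - 2 * Q" by (simp add: algebra_simps)
  ultimately have e: "hdim T (n + 2) q (int d - 2 * Q) \<le> hdim T (n + 2) q ?e" by (simp only: eq)
  have q0: "q > 0" using Q_large R_pos Q by simp
  show ?thesis
  proof (cases "2 * q \<le> d")
    case True
    then have dq: "int d - 2 * Q = int (d - 2 * q)" unfolding Q by (simp add: of_nat_diff)
    have "m * Q - (m + 2) * R + 4 \<le> (m + 2) * Q - (m - 2) * R" using Q_large R_pos by (simp add: algebra_simps)
    then have "2 * int (d - 2 * q) < (m + 2) * Q - (m - 2) * R" unfolding dq[symmetric] by (rule order.strict_trans2[OF assms])
    from hdim_eq_free_dim[OF this] show ?thesis
      using e unfolding hdim_dual[of "int d"] free_dim.simps[of n q d] dq using True q0 by simp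
  next
    case False
    then show ?thesis unfolding hdim_dual[of "int d"] free_dim.simps[of n q d] by simp
  qed
qed

text \<open>Both dimensions equal the rank of \<open>Q\<^bsup>q-1\<^esup>\<close>, which is the same in degrees with sum \<open>n (q - 1)\<close>.\<close>

lemma hdim_reflect_high:
  assumes "2 * d > (m + 2) * Q + (m - 2) * R - 2 * m"
  shows "hdim T (n + 2) q d = hdim T (n + 2) q (m * (Q - 1) - d)"
proof -
  have "hdim T (n + 2) q (m * (Q - 1) - d) = rk T (n + 2) q (q - 1) (m * (Q - 1) - d)"
    by (rule hdim_eq_rk_low, rule order.strict_trans[OF _ low_bound])
      (use assms in \<open>simp add: algebra_simps\<close>)
  then show ?thesis using hdim_eq_rk_high[OF assms] rk_reflect[of d] by simp
qed

lemma hdim_reflect_low: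
  assumes "2 * d < m * Q - (m + 2) * R + 4"
  shows "hdim T (n + 2) q d \<le> hdim T (n + 2) q (m * (Q - 1) - d)"
  using hdim_eq_rk_low[OF assms] rk_reflect[of d] hdim_ge_rk[of "m * (Q - 1) - d"] by simp

end

section \<open>The limit function\<close>

text \<open>Unlike \<open>hk_function\<close> this does not truncate negative degrees, so reflections \<open>x \<mapsto> n - x\<close> are harmless for
  \<open>x > n\<close>.\<close>

definition hk_approx :: "'k::field itself \<Rightarrow> nat \<Rightarrow> nat \<Rightarrow> real \<Rightarrow> real" where
  "hk_approx T n q x = real (hdim T (n + 2) q \<lfloor>x * real q\<rfloor>) / real q ^ n"

lemma hk_function_eq_approx:
  assumes "prime p" "CHAR('k::field) = p" "x \<ge> 0"
  shows "hk_function TYPE('k) n (p ^ s) x = hk_approx TYPE('k) n (p ^ s) x"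
proof -
  have "int (nat \<lfloor>x * real (p ^ s)\<rfloor>) = \<lfloor>x * real (p ^ s)\<rfloor>" using assms(3) by simp
  then show ?thesis
    unfolding hk_function_def hk_approx_def module_length_component[OF assms(1,2) refl, where T = "TYPE('k)"]
    by (simp only: the_enat.simps)
qed

context
  fixes n p :: nat and T :: "'k::field itself"
  assumes p: "prime p" "CHAR('k) = p" "odd p" and n: "n \<ge> 2"
begin

private abbreviation "g s x \<equiv> hk_approx T n (p ^ s) x"

private lemma prime_ge_two: "p \<ge> 2" by (rule prime_ge_2_nat[OF p(1)])

private lemma prime_power_pos: "real (p ^ s) > 0" using prime_ge_two by simp

private lemma over_q_tendsto: "(\<lambda>s. c / real (p ^ s)) \<longlonglongrightarrow> 0"
  using LIMSEQ_divide_realpow_zero[of "real p" c] prime_ge_two by simp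

private lemma hdim_lipschitz_real:
  "\<bar>real (hdim T (n + 2) (p ^ s) d) / real (p ^ s) ^ n - real (hdim T (n + 2) (p ^ s) e) / real (p ^ s) ^ n\<bar>
    \<le> 6 * \<bar>of_int d - of_int e\<bar> / real (p ^ s)"
proof -
  define q where "q = p ^ s"
  have q: "q > 0" "real q > 0" using prime_ge_two by (auto simp: q_def)
  have "\<bar>int (hdim T (n + 2) q d) - int (hdim T (n + 2) q e)\<bar> \<le> 6 * int (q ^ (n - 1)) * \<bar>d - e\<bar>"
    using n q by (intro hdim_lipschitz) auto
  then have "of_int \<bar>int (hdim T (n + 2) q d) - int (hdim T (n + 2) q e)\<bar> \<le> (of_int (6 * int (q ^ (n - 1)) * \<bar>d - e\<bar>) :: real)"
    by (simp only: of_int_le_iff)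
  then have "\<bar>real (hdim T (n + 2) q d) - real (hdim T (n + 2) q e)\<bar> \<le> 6 * real q ^ (n - 1) * \<bar>of_int d - of_int e\<bar>" by simp
  then have "\<bar>real (hdim T (n + 2) q d) - real (hdim T (n + 2) q e)\<bar> / real q ^ n
      \<le> 6 * real q ^ (n - 1) * \<bar>of_int d - of_int e\<bar> / real q ^ n"
    using q by (intro divide_right_mono) auto
  also have "\<dots> = 6 * \<bar>of_int d - of_int e\<bar> / real q" using q n by (cases n) auto
  finally show ?thesis using q unfolding q_def[symmetric] by (simp add: diff_divide_distrib[symmetric])
qed

text \<open>Passing from the \<open>q\<close>-th to the \<open>p q\<close>-th powers, the normalised dimension can only grow by
  \<open>O(1/q)\<close>; since these errors are summable the sequence is decreasing up to a null sequence.\<close>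

private lemma approx_growth: "g (Suc s) x \<le> g s x + (2 + 6 * (real n + 2)) / real (p ^ s)"
proof -
  define q where "q = p ^ s"
  define d where "d = \<lfloor>x * real q\<rfloor>"
  define r where "r = \<lfloor>x * real (p * q)\<rfloor> - int p * d"
  have q: "q > 0" "real q > 0" and p0: "real p > 0" using prime_ge_two by (auto simp: q_def)
  have d: "of_int d \<le> x * real q" "x * real q < of_int d + 1" unfolding d_def by linarith+
  have "of_int d * real p \<le> x * real q * real p" "x * real q * real p < (of_int d + 1) * real p"
    using d p0 by (auto intro: mult_right_mono mult_strict_right_mono)
  then have "of_int (int p * d) \<le> x * real (p * q)" "x * real (p * q) < of_int (int p * d + int p)"
    by (simp_all add: algebra_simps)
  then have "int p * d \<le> \<lfloor>x * real (p * q)\<rfloor>" "\<lfloor>x * real (p * q)\<rfloor> < int p * d + int p"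
    by (simp_all only: le_floor_iff floor_less_iff)
  then have r: "0 \<le> r" "r < int p" unfolding r_def by linarith+
  let ?h = "real (hdim T (n + 2) q d)" and ?P = "real p ^ n" and ?C = "2 + 6 * (real n + 2)"
  have "int (hdim T (n + 2) (p * q) (int p * d + r)) \<le>
    int p ^ n * int (hdim T (n + 2) q d) + (2 * int p ^ n + 6 * int p ^ n * (int n + 2)) * int (q ^ (n - 1))"
    by (rule hdim_growth[OF p _ q(1) r]) (use n in simp)
  moreover have "int p * d + r = \<lfloor>x * real (p * q)\<rfloor>" by (simp add: r_def)
  ultimately have "int (hdim T (n + 2) (p * q) \<lfloor>x * real (p * q)\<rfloor>) \<le>
    int p ^ n * int (hdim T (n + 2) q d) + (2 * int p ^ n + 6 * int p ^ n * (int n + 2)) * int (q ^ (n - 1))" by (simp only:)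
  then have "real_of_int (int (hdim T (n + 2) (p * q) \<lfloor>x * real (p * q)\<rfloor>)) \<le>
    of_int (int p ^ n * int (hdim T (n + 2) q d) + (2 * int p ^ n + 6 * int p ^ n * (int n + 2)) * int (q ^ (n - 1)))"
    by (simp only: of_int_le_iff)
  then have "real (hdim T (n + 2) (p * q) \<lfloor>x * real (p * q)\<rfloor>) \<le> ?P * (?h + ?C * real q ^ (n - 1))"
    by (simp add: algebra_simps)
  then have "real (hdim T (n + 2) (p * q) \<lfloor>x * real (p * q)\<rfloor>) / real (p * q) ^ n \<le> ?P * (?h + ?C * real q ^ (n - 1)) / real (p * q) ^ n"
    by (intro divide_right_mono) auto
  also have "\<dots> = (?h + ?C * real q ^ (n - 1)) / real q ^ n" using p0 by (simp add: power_mult_distrib)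
  also have "\<dots> = ?h / real q ^ n + ?C / real q" using q n by (cases n) (auto simp: add_divide_distrib)
  finally show ?thesis unfolding hk_approx_def d_def q_def by simp
qed

lemma hk_approx_convergent: "convergent (\<lambda>s. hk_approx T n (p ^ s) x)"
proof -
  let ?C = "2 + 6 * (real n + 2)"
  let ?u = "\<lambda>s. g s x + 2 * ?C / real (p ^ s)"
  (* Doubling the error absorbs all later ones, which decay at least by a factor 2. *)
  have "decseq ?u"
  proof (rule decseq_SucI)
    fix s
    have "2 * ?C / real (p ^ Suc s) = (2 / real p) * (?C / real (p ^ s))" by simp
    also have "\<dots> \<le> 1 * (?C / real (p ^ s))"
      using prime_ge_two prime_power_pos[of s] by (intro mult_right_mono divide_nonneg_pos) auto
    finally show "?u (Suc s) \<le> ?u s" using approx_growth[of s x] by linarith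
  qed
  moreover have "\<forall>s. 0 \<le> ?u s"
    using prime_power_pos by (auto simp: hk_approx_def intro!: add_nonneg_nonneg divide_nonneg_nonneg)
  ultimately obtain l where "?u \<longlonglongrightarrow> l" by (rule decseq_convergent)
  then have "(\<lambda>s. ?u s - 2 * ?C / real (p ^ s)) \<longlonglongrightarrow> l - 0" by (intro tendsto_diff over_q_tendsto)
  then show ?thesis by (simp add: convergent_def) blast
qed

private abbreviation "f x \<equiv> lim (\<lambda>s. hk_approx T n (p ^ s) x)"

private lemma approx_tendsto: "(\<lambda>s. g s x) \<longlonglongrightarrow> f x"
  using hk_approx_convergent by (simp add: convergent_LIMSEQ_iff)

private lemma approx_tendsto_Suc: "(\<lambda>s. g (Suc s) x) \<longlonglongrightarrow> f x"
  by (rule LIMSEQ_Suc[OF approx_tendsto])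

private lemma f_lipschitz: "\<bar>f x - f y\<bar> \<le> 6 * \<bar>x - y\<bar>"
proof (rule LIMSEQ_le)
  show "(\<lambda>s. \<bar>g s x - g s y\<bar>) \<longlonglongrightarrow> \<bar>f x - f y\<bar>" by (intro tendsto_rabs tendsto_diff approx_tendsto)
  have "(\<lambda>s. 6 * \<bar>x - y\<bar> + 6 / real (p ^ s)) \<longlonglongrightarrow> 6 * \<bar>x - y\<bar> + 0" by (intro tendsto_add tendsto_const over_q_tendsto)
  then show "(\<lambda>s. 6 * \<bar>x - y\<bar> + 6 / real (p ^ s)) \<longlonglongrightarrow> 6 * \<bar>x - y\<bar>" by simp
  have "\<bar>g s x - g s y\<bar> \<le> 6 * \<bar>x - y\<bar> + 6 / real (p ^ s)" for s
  proof -
    let ?q = "real (p ^ s)"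
    have "\<bar>g s x - g s y\<bar> \<le> 6 * \<bar>of_int \<lfloor>x * ?q\<rfloor> - of_int \<lfloor>y * ?q\<rfloor>\<bar> / ?q"
      unfolding hk_approx_def by (rule hdim_lipschitz_real)
    also have "\<bar>of_int \<lfloor>x * ?q\<rfloor> - of_int \<lfloor>y * ?q\<rfloor>\<bar> \<le> \<bar>x * ?q - y * ?q\<bar> + 1" by linarith
    also have "\<bar>x * ?q - y * ?q\<bar> = \<bar>x - y\<bar> * ?q" by (simp add: abs_mult flip: left_diff_distrib)
    finally have "\<bar>g s x - g s y\<bar> \<le> 6 * (\<bar>x - y\<bar> * ?q + 1) / ?q" using prime_power_pos[of s] by (simp add: divide_right_mono)
    also have "\<dots> = 6 * \<bar>x - y\<bar> + 6 / ?q" using prime_power_pos[of s] by (simp add: field_simps)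
    finally show ?thesis .
  qed
  then show "\<exists>N. \<forall>s\<ge>N. \<bar>g s x - g s y\<bar> \<le> 6 * \<bar>x - y\<bar> + 6 / real (p ^ s)" by blast
qed

lemma hk_limit_continuous: "continuous_on A (\<lambda>x. lim (\<lambda>s. hk_approx T n (p ^ s) x))"
proof -
  have "\<exists>d>0. \<forall>y\<in>A. dist y x < d \<longrightarrow> dist (f y) (f x) < e" if "e > 0" for x e
  proof (intro exI[of _ "e / 6"] conjI ballI impI)
    fix y
    assume "dist y x < e / 6"
    then have "6 * \<bar>y - x\<bar> < e" by (simp add: dist_real_def)
    with f_lipschitz show "dist (f y) (f x) < e" unfolding dist_real_def by (rule order.strict_trans1)
  qed (use that in simp)
  then show ?thesis unfolding continuous_on_iff by blast
qed

private lemma scaled_by_Q: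
  fixes a b x :: real
  assumes "a - b / real p = y"
  shows "y * real (p ^ Suc s) = a * real (p ^ Suc s) - b * real (p ^ s)"
proof -
  have "y * real (p ^ Suc s) = (a - b / real p) * (real p * real (p ^ s))" using assms by simp
  also have "\<dots> = a * (real p * real (p ^ s)) - b / real p * (real p * real (p ^ s))" by (rule left_diff_distrib)
  also have "b / real p * (real p * real (p ^ s)) = b * real (p ^ s)" using prime_ge_two by simp
  finally show ?thesis by simp
qed

lemma hk_limit_eq_Z:
  assumes i: "real i \<le> x" "x < real i + 1" and x: "2 * x < real n + 2 - (real n - 2) / real p"
  shows "lim (\<lambda>s. hk_approx T n (p ^ s) x) = Z n i x"
proof (rule LIMSEQ_unique[OF approx_tendsto_Suc])
  have "(\<lambda>s. of_int (free_dim n (p ^ Suc s) (nat \<lfloor>x * real (p ^ Suc s)\<rfloor>)) / real (p ^ Suc s) ^ n) \<longlonglongrightarrow> Z n i x"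
    by (rule LIMSEQ_Suc[OF free_dim_tendsto[OF _ prime_ge_two i]]) (use n in simp)
  moreover have "of_int (free_dim n (p ^ Suc s) (nat \<lfloor>x * real (p ^ Suc s)\<rfloor>)) / real (p ^ Suc s) ^ n = g (Suc s) x" for s
  proof -
    let ?q = "p ^ Suc s"
    define d where "d = nat \<lfloor>x * real ?q\<rfloor>"
    have d: "int d = \<lfloor>x * real ?q\<rfloor>" unfolding d_def using i by simp
    have "2 * real d = 2 * of_int \<lfloor>x * real ?q\<rfloor>" using d by linarith
    also have "\<dots> \<le> (2 * x) * real ?q" by linarith
    also have "\<dots> < (real n + 2 - (real n - 2) / real p) * real ?q" using x prime_power_pos by (rule mult_strict_right_mono)
    also have "\<dots> = (real n + 2) * real ?q - (real n - 2) * real (p ^ s)" by (rule scaled_by_Q[OF refl])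
    finally have "real_of_int (2 * int d) < real_of_int ((int n + 2) * int ?q - (int n - 2) * int (p ^ s))" by simp
    then have "2 * int d < (int n + 2) * int ?q - (int n - 2) * int (p ^ s)" by (simp only: of_int_less_iff)
    from hdim_eq_free_dim[OF p n refl refl refl refl this, of T]
    have "of_int (free_dim n ?q d) = real_of_int (int (hdim T (n + 2) ?q (int d)))" by (simp only:)
    then show ?thesis unfolding hk_approx_def d_def[symmetric] d[symmetric] by simp
  qed
  ultimately show "(\<lambda>s. g (Suc s) x) \<longlonglongrightarrow> Z n i x" by simp
qed

lemma hk_limit_ge_Z:
  assumes i: "real i \<le> x" "x < real i + 1" and x: "2 * x \<le> real n + 4 - (real n + 2) / real p"
  shows "Z n i x \<le> lim (\<lambda>s. hk_approx T n (p ^ s) x)"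
proof (rule LIMSEQ_le[OF _ approx_tendsto_Suc])
  show "(\<lambda>s. of_int (free_dim n (p ^ Suc s) (nat \<lfloor>x * real (p ^ Suc s)\<rfloor>)) / real (p ^ Suc s) ^ n) \<longlonglongrightarrow> Z n i x"
    by (rule LIMSEQ_Suc[OF free_dim_tendsto[OF _ prime_ge_two i]]) (use n in simp)
  have "of_int (free_dim n (p ^ Suc s) (nat \<lfloor>x * real (p ^ Suc s)\<rfloor>)) / real (p ^ Suc s) ^ n \<le> g (Suc s) x" for s
  proof -
    let ?q = "p ^ Suc s"
    define d where "d = nat \<lfloor>x * real ?q\<rfloor>"
    have d: "int d = \<lfloor>x * real ?q\<rfloor>" unfolding d_def using i by simp
    have "2 * real d = 2 * of_int \<lfloor>x * real ?q\<rfloor>" using d by linarith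
    also have "\<dots> \<le> (2 * x) * real ?q" by linarith
    also have "\<dots> \<le> (real n + 4 - (real n + 2) / real p) * real ?q" using x prime_power_pos[of "Suc s"] by (intro mult_right_mono) auto
    also have "\<dots> = (real n + 4) * real ?q - (real n + 2) * real (p ^ s)" by (rule scaled_by_Q[OF refl])
    finally have "real_of_int (2 * int d) \<le> real_of_int ((int n + 4) * int ?q - (int n + 2) * int (p ^ s))" by simp
    then have "2 * int d \<le> (int n + 4) * int ?q - (int n + 2) * int (p ^ s)" by (simp only: of_int_le_iff)
    then have "2 * (int d - 2 * int ?q) < int n * int ?q - (int n + 2) * int (p ^ s) + 4" by (simp add: algebra_simps)
    from hdim_ge_free_dim[OF p n refl refl refl refl this, of T]
    have "real_of_int (free_dim n ?q d) \<le> real_of_int (int (hdim T (n + 2) ?q (int d)))" by (simp only: of_int_le_iff)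
    then show ?thesis unfolding hk_approx_def d_def[symmetric] d[symmetric] by (intro divide_right_mono) auto
  qed
  then show "\<exists>N. \<forall>s\<ge>N. of_int (free_dim n (p ^ Suc s) (nat \<lfloor>x * real (p ^ Suc s)\<rfloor>)) / real (p ^ Suc s) ^ n \<le> g (Suc s) x"
    by blast
qed

text \<open>The degrees \<open>n (q - 1) - \<lfloor>x q\<rfloor>\<close> and \<open>\<lfloor>(n - x) q\<rfloor>\<close> differ by a bounded amount, so
  they give the same limit.\<close>

private lemma reflected_approx:
  "\<bar>real (hdim T (n + 2) (p ^ s) (int n * (int (p ^ s) - 1) - \<lfloor>x * real (p ^ s)\<rfloor>)) / real (p ^ s) ^ n - g s (real n - x)\<bar>
    \<le> 6 * (real n + 1) / real (p ^ s)"
proof -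
  let ?q = "real (p ^ s)"
  have e: "\<bar>(real n * (?q - 1) - of_int \<lfloor>x * ?q\<rfloor>) - of_int \<lfloor>(real n - x) * ?q\<rfloor>\<bar> \<le> real n + 1"
  proof -
    have "(real n - x) * ?q = real n * ?q - x * ?q" "real n * (?q - 1) = real n * ?q - real n" by (simp_all add: algebra_simps)
    moreover have "real n \<ge> 2" using n by simp
    ultimately show ?thesis by linarith
  qed
  have "\<bar>real (hdim T (n + 2) (p ^ s) (int n * (int (p ^ s) - 1) - \<lfloor>x * ?q\<rfloor>)) / ?q ^ n - g s (real n - x)\<bar>
      \<le> 6 * \<bar>of_int (int n * (int (p ^ s) - 1) - \<lfloor>x * ?q\<rfloor>) - of_int \<lfloor>(real n - x) * ?q\<rfloor>\<bar> / ?q"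
    unfolding hk_approx_def by (rule hdim_lipschitz_real)
  also have "\<dots> \<le> 6 * (real n + 1) / ?q"
    using e prime_power_pos[of s] by (intro divide_right_mono mult_left_mono) auto
  finally show ?thesis .
qed

lemma hk_limit_symmetric:
  assumes x: "2 * x \<ge> real n + 2 + (real n - 2) / real p"
  shows "lim (\<lambda>s. hk_approx T n (p ^ s) x) = lim (\<lambda>s. hk_approx T n (p ^ s) (real n - x))"
proof -
  have "\<bar>g (Suc s) x - g (Suc s) (real n - x)\<bar> \<le> 6 * (real n + 1) / real (p ^ Suc s)" for s
  proof -
    let ?q = "p ^ Suc s"
    define d where "d = \<lfloor>x * real ?q\<rfloor>"
    have "(real n + 2) * real ?q - (2 - real n) * real (p ^ s) = (real n + 2 - (2 - real n) / real p) * real ?q"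
      by (rule scaled_by_Q[OF refl, symmetric])
    also have "real n + 2 - (2 - real n) / real p = real n + 2 + (real n - 2) / real p"
      by (simp add: diff_divide_distrib)
    also have "\<dots> * real ?q \<le> (2 * x) * real ?q" using x prime_power_pos[of "Suc s"] by (intro mult_right_mono) auto
    also have "\<dots> < 2 * of_int d + 2" unfolding d_def by linarith
    finally have "(real n + 2) * real ?q + (real n - 2) * real (p ^ s) - 2 * real n < 2 * of_int d"
      using n by (simp add: algebra_simps)
    then have "real_of_int ((int n + 2) * int ?q + (int n - 2) * int (p ^ s) - 2 * int n) < real_of_int (2 * d)" by simp
    then have "(int n + 2) * int ?q + (int n - 2) * int (p ^ s) - 2 * int n < 2 * d" by (simp only: of_int_less_iff)
    from hdim_reflect_high[OF p n refl refl refl refl this, of T]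
    have "g (Suc s) x = real (hdim T (n + 2) ?q (int n * (int ?q - 1) - d)) / real ?q ^ n"
      unfolding hk_approx_def d_def by (simp only:)
    then show ?thesis using reflected_approx[of "Suc s" x] unfolding d_def by (simp only:)
  qed
  moreover have "(\<lambda>s. \<bar>g (Suc s) x - g (Suc s) (real n - x)\<bar>) \<longlonglongrightarrow> \<bar>f x - f (real n - x)\<bar>"
    by (intro tendsto_rabs tendsto_diff approx_tendsto_Suc)
  ultimately have "\<bar>f x - f (real n - x)\<bar> \<le> 0"
    by (intro LIMSEQ_le[OF _ LIMSEQ_Suc[OF over_q_tendsto]]) auto
  then show ?thesis by simp
qed

lemma hk_limit_ge_reflected:
  assumes x: "2 * x \<ge> real n + (real n + 2) / real p"
  shows "lim (\<lambda>s. hk_approx T n (p ^ s) (real n - x)) \<le> lim (\<lambda>s. hk_approx T n (p ^ s) x)"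
proof -
  have "g (Suc s) (real n - x) \<le> g (Suc s) x + 6 * (real n + 1) / real (p ^ Suc s)" for s
  proof -
    let ?q = "p ^ Suc s"
    define d where "d = \<lfloor>(real n - x) * real ?q\<rfloor>"
    have "2 * of_int d \<le> (2 * (real n - x)) * real ?q" unfolding d_def by linarith
    also have "\<dots> \<le> (real n - (real n + 2) / real p) * real ?q" using x prime_power_pos[of "Suc s"] by (intro mult_right_mono) auto
    also have "\<dots> = real n * real ?q - (real n + 2) * real (p ^ s)" by (rule scaled_by_Q[OF refl])
    finally have "real_of_int (2 * d) < real_of_int (int n * int ?q - (int n + 2) * int (p ^ s) + 4)" by simp
    then have "2 * d < int n * int ?q - (int n + 2) * int (p ^ s) + 4" by (simp only: of_int_less_iff)
    from hdim_reflect_low[OF p n refl refl refl refl this, of T]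
    have "real (hdim T (n + 2) ?q d) / real ?q ^ n \<le> real (hdim T (n + 2) ?q (int n * (int ?q - 1) - d)) / real ?q ^ n"
      by (intro divide_right_mono) auto
    moreover have "g (Suc s) (real n - x) = real (hdim T (n + 2) ?q d) / real ?q ^ n"
      unfolding hk_approx_def d_def ..
    moreover have "\<bar>real (hdim T (n + 2) ?q (int n * (int ?q - 1) - d)) / real ?q ^ n - g (Suc s) x\<bar> \<le> 6 * (real n + 1) / real ?q"
      using reflected_approx[of "Suc s" "real n - x"] unfolding d_def diff_diff_eq2 add_diff_cancel_left' .
    ultimately show ?thesis by linarith
  qed
  moreover have "(\<lambda>s. g (Suc s) x + 6 * (real n + 1) / real (p ^ Suc s)) \<longlonglongrightarrow> f x + 0"
    by (intro tendsto_add approx_tendsto_Suc LIMSEQ_Suc[OF over_q_tendsto])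
  then have "(\<lambda>s. g (Suc s) x + 6 * (real n + 1) / real (p ^ Suc s)) \<longlonglongrightarrow> f x" by (simp only: add_0_right)
  ultimately show ?thesis by (intro LIMSEQ_le[OF approx_tendsto_Suc]) blast+
qed

lemma hk_limit_eq_0:
  assumes x: "x \<ge> real n"
  shows "lim (\<lambda>s. hk_approx T n (p ^ s) x) = 0"
proof -
  have "g s x = 0" for s
  proof -
    have "p ^ s > 0" using prime_ge_two by simp
    then have "int (p ^ s - 1) < int (p ^ s)" by linarith
    then have "int n * int (p ^ s - 1) < int n * int (p ^ s)" using n by simp
    also have "\<dots> \<le> \<lfloor>x * real (p ^ s)\<rfloor>"
    proof -
      have "real n * real (p ^ s) \<le> x * real (p ^ s)" using x prime_power_pos[of s] by (intro mult_right_mono) auto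
      then show ?thesis by (simp add: le_floor_iff)
    qed
    finally have "hdim T (n + 2) (p ^ s) \<lfloor>x * real (p ^ s)\<rfloor> = 0" by (rule hdim_top[OF p n])
    then show ?thesis unfolding hk_approx_def by simp
  qed
  then show ?thesis by (intro limI) simp
qed

end

section \<open>The shape of the density function\<close>

context
  fixes n p :: nat and T :: "'k::field itself" and \<delta> \<epsilon> :: real
  assumes p: "prime p" "CHAR('k) = p" "odd p" and n: "n \<ge> 3" and pn: "p > n - 2"
    and \<delta>: "\<delta> = (real n - 2) / (2 * real p)" and \<epsilon>: "\<epsilon> = (real n + 2) / (2 * real p)"
begin

private abbreviation "hk x \<equiv> lim (\<lambda>s. hk_approx T n (p ^ s) x)"

private lemma n2: "n \<ge> 2" using n by simp

private lemma p_pos: "real p > 0" using prime_gt_0_nat[OF p(1)] by simp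

private lemma half_sum: "(real n + 2) / 2 = real n / 2 + 1" by simp

private lemma two_delta: "(real n - 2) / real p = 2 * \<delta>" and two_epsilon: "(real n + 2) / real p = 2 * \<epsilon>"
proof -
  have "a / b = 2 * (a / (2 * b))" for a b :: real by simp
  then show "(real n - 2) / real p = 2 * \<delta>" "(real n + 2) / real p = 2 * \<epsilon>" unfolding \<delta> \<epsilon> by blast+
qed

lemma delta_bounds: "0 < \<delta>" "\<delta> < 1 / 2"
  unfolding \<delta> using pn n p_pos by (auto simp: field_simps)

lemma epsilon_bounds: "\<delta> < \<epsilon>" "\<epsilon> \<le> 1"
proof -
  show "\<delta> < \<epsilon>" unfolding \<delta> \<epsilon> using p_pos by (intro divide_strict_right_mono) auto
  have "p \<ge> 3" using prime_ge_2_nat[OF p(1)] p(3) by (cases "p = 2") auto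
  then have "n + 2 \<le> 2 * p" using pn n by linarith
  then have "real n + 2 \<le> 2 * real p" by (simp flip: of_nat_le_iff)
  then show "\<epsilon> \<le> 1" unfolding \<epsilon> using p_pos by simp
qed

lemma density_Z:
  assumes "real i \<le> x" "x < real i + 1" "x < (real n + 2) / 2 - \<delta>"
  shows "lim (\<lambda>s. hk_approx T n (p ^ s) x) = Z n i x"
  by (rule hk_limit_eq_Z[OF p n2 assms(1,2)]) (unfold two_delta, use assms(3) half_sum in linarith)

text \<open>At the right end point by continuity; reflection turns the half-open intervals around, so this end point
  is needed for the polynomials \<open>Y\<close>.\<close>

lemma density_Z_right_end:
  assumes "real i < x" "x \<le> real i + 1" "x < (real n + 2) / 2 - \<delta>"
  shows "lim (\<lambda>s. hk_approx T n (p ^ s) x) = Z n i x"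
proof -
  let ?S = "{real i<..<x}"
  have c: "closure ?S = {real i..x}" using assms(1) by (rule closure_greaterThanLessThan)
  have "hk x - Z n i x = 0"
  proof (rule continuous_constant_on_closure[of ?S "\<lambda>x. hk x - Z n i x"])
    show "continuous_on (closure ?S) (\<lambda>x. hk x - Z n i x)"
      by (intro continuous_on_diff hk_limit_continuous[OF p n2] Z_continuous)
    show "hk y - Z n i y = 0" if "y \<in> ?S" for y using density_Z[of i y] that assms by simp
    show "x \<in> closure ?S" unfolding c using assms(1) by simp
  qed
  then show ?thesis by simp
qed

lemma density_ge_Z:
  assumes "real i \<le> x" "x < real i + 1" "x < (real n + 2) / 2"
  shows "Z n i x \<le> lim (\<lambda>s. hk_approx T n (p ^ s) x)"
  by (rule hk_limit_ge_Z[OF p n2 assms(1,2)]) (unfold two_epsilon, use assms(3) half_sum epsilon_bounds(2) in linarith)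

lemma density_symmetric:
  assumes "x \<ge> (real n + 2) / 2 + \<delta>"
  shows "lim (\<lambda>s. hk_approx T n (p ^ s) x) = lim (\<lambda>s. hk_approx T n (p ^ s) (real n - x))"
  by (rule hk_limit_symmetric[OF p n2]) (unfold two_delta, use assms half_sum in linarith)

lemma density_Y:
  assumes i: "i < n" "real i \<le> x" "x < real i + 1" and x: "x \<ge> (real n + 2) / 2 + \<delta>"
  shows "lim (\<lambda>s. hk_approx T n (p ^ s) x) = Y n i x"
proof -
  have i': "real (n - 1 - i) = real n - 1 - real i" using i(1) by simp
  have "hk (real n - x) = Z n (n - 1 - i) (real n - x)"
    by (rule density_Z_right_end) (use i' i x delta_bounds half_sum in linarith)+
  also have "\<dots> = Y n i x" using i(1) by (subst Y_eq_Z) auto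
  finally show ?thesis unfolding density_symmetric[OF x] .
qed

text \<open>The reflected point \<open>n - x\<close> lies in the range where the density is given by a polynomial \<open>Z\<close>, and the density at \<open>x\<close>
  is at least the one at \<open>n - x\<close>.\<close>

lemma density_ge_Y:
  assumes i: "i < n" "real i \<le> x" "x < real i + 1" and x: "x \<ge> real n / 2 + \<epsilon>"
  shows "Y n i x \<le> lim (\<lambda>s. hk_approx T n (p ^ s) x)"
proof -
  have i': "real (n - 1 - i) = real n - 1 - real i" using i(1) by simp
  have "Y n i x = Z n (n - 1 - i) (real n - x)" using i(1) by (subst Y_eq_Z) auto
  also have "\<dots> = hk (real n - x)"
    by (rule density_Z_right_end[symmetric]) (use i' i x epsilon_bounds half_sum in linarith)+
  also have "\<dots> \<le> hk x"
    by (rule hk_limit_ge_reflected[OF p n2]) (unfold two_epsilon, use x in linarith)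
  finally show ?thesis .
qed

end

text \<open>The corrections \<open>\<mu>\<close> are positive parts of the difference between the density and a polynomial. Taking the
  positive part makes them nonnegative on all of the unit interval, also where that difference is negative.\<close>

lemma positive_part_properties:
  fixes g :: "real \<Rightarrow> real"
  assumes "continuous_on UNIV g"
  shows "continuous_on {0..<1} (\<lambda>t. max 0 (g (a + t))) \<and> bounded ((\<lambda>t. max 0 (g (a + t))) ` {0..<1}) \<and>
    (\<forall>t\<in>{0..<1::real}. 0 \<le> max 0 (g (a + t)))"
proof -
  have c: "continuous_on A (\<lambda>t. max 0 (g (a + t)))" for A
    by (intro continuous_on_max continuous_on_const continuous_on_compose2[OF assms] continuous_intros) auto
  have "bounded ((\<lambda>t. max 0 (g (a + t))) ` {0..1})"
    by (intro compact_imp_bounded compact_continuous_image c compact_Icc)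
  then have "bounded ((\<lambda>t. max 0 (g (a + t))) ` {0..<1})" by (rule bounded_subset) auto
  then show ?thesis using c by auto
qed

theorem proposition1p1:
  fixes n n0 :: nat
  assumes n: "n \<ge> 3"
    and n0: "n0 = nat (\<lceil>real n / 2\<rceil> - 1)"
  shows
    "(\<forall>i\<le>n0 + 1. Polynomial.degree (Z_poly n i) = n) \<and>
     (\<forall>i. n0 + 1 \<le> i \<and> i \<le> n - 1 \<longrightarrow> Polynomial.degree (Y_poly n i) = n) \<and>
     (\<forall>p. prime p \<and> p \<noteq> 2 \<and> p > n - 2 \<and> CHAR('k::field) = p \<and> perfect_field TYPE('k) \<longrightarrow>
       (\<forall>x\<ge>0. convergent (\<lambda>s. hk_function TYPE('k) n (p ^ s) x)) \<and>
       (let f = hk_density TYPE('k) n; \<delta> = (real n - 2) / (2 * real p) in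
        \<exists>\<mu> :: nat \<Rightarrow> real \<Rightarrow> real.
          (\<forall>j\<in>{n0 - 1, n0, n0 + 1}.
             continuous_on {0..<1} (\<mu> j) \<and> bounded (\<mu> j ` {0..<1}) \<and> (\<forall>t\<in>{0..<1}. 0 \<le> \<mu> j t)) \<and>
          (even n \<longrightarrow>
             (\<forall>i\<le>n0. \<forall>x. real i \<le> x \<and> x < real i + 1 \<longrightarrow> f x = Z n i x) \<and>
             (\<forall>x. real n0 + 1 \<le> x \<and> x < (real n0 + 2) - \<delta> \<longrightarrow> f x = Z n (n0 + 1) x) \<and>
             (\<forall>x. 1 - \<delta> \<le> x - (real n0 + 1) \<and> x - (real n0 + 1) < 1 \<longrightarrow>
                f x = Z n (n0 + 1) x + \<mu> (n0 - 1) (x - real n0 - 1)) \<and>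
             (\<forall>x. 0 \<le> x - (real n0 + 2) \<and> x - (real n0 + 2) < \<delta> \<longrightarrow>
                f x = Y n (n0 + 2) x + \<mu> (n0 + 1) (x - real n0 - 2)) \<and>
             (\<forall>x. (real n0 + 2) + \<delta> \<le> x \<and> x < real n0 + 3 \<longrightarrow> f x = Y n (n0 + 2) x) \<and>
             (\<forall>i x. n0 + 3 \<le> i \<and> i < n \<and> real i \<le> x \<and> x < real i + 1 \<longrightarrow> f x = Y n i x) \<and>
             (\<forall>x\<ge>real n. f x = 0)) \<and>
          (odd n \<longrightarrow>
             (\<forall>i\<le>n0. \<forall>x. real i \<le> x \<and> x < real i + 1 \<longrightarrow> f x = Z n i x) \<and>
             (\<forall>x. real n0 + 1 \<le> x \<and> x < (real n0 + 3/2) - \<delta> \<longrightarrow> f x = Z n (n0 + 1) x) \<and>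
             (\<forall>x. 1/2 - \<delta> \<le> x - (real n0 + 1) \<and> x - (real n0 + 1) < 1/2 + \<delta> \<longrightarrow>
                f x = Y n (n0 + 1) x + \<mu> n0 (x - real n0 - 1)) \<and>
             (\<forall>x. (real n0 + 1) + 1/2 + \<delta> \<le> x \<and> x < real n0 + 2 \<longrightarrow> f x = Y n (n0 + 1) x) \<and>
             (\<forall>i x. n0 + 2 \<le> i \<and> i < n \<and> real i \<le> x \<and> x < real i + 1 \<longrightarrow> f x = Y n i x) \<and>
             (\<forall>x\<ge>real n. f x = 0) \<and>
             (\<forall>x. 1/2 - \<delta> \<le> x - (real n0 + 1) \<and> x - (real n0 + 1) < 1/2 \<longrightarrow>
                f x = Z n (n0 + 1) x + \<mu> (n0 - 1) (x - real n0 - 1))) \<and>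
          (\<forall>x. 0 \<le> x \<and> x \<le> (real n - 2) / 2 * (1 - 1 / real p) \<longrightarrow> f x = f (real n - x))))"
proof -
  have n0_even: "n = 2 * n0 + 2" if e: "even n"
  proof -
    obtain k where k: "n = 2 * k" using e by (rule evenE)
    then have "real n / 2 = of_int (int k)" by simp
    then have "n0 = nat (int k - 1)" unfolding n0 by (simp only: ceiling_of_int)
    then show ?thesis using k n by simp
  qed
  have n0_odd: "n = 2 * n0 + 1" if o: "odd n"
  proof -
    obtain k where k: "n = 2 * k + 1" using o by (rule oddE)
    have "\<lceil>real n / 2\<rceil> = int k + 1" by (rule ceiling_unique) (simp_all add: k)
    then have "n0 = k" unfolding n0 by simp
    then show ?thesis using k by simp
  qed
  have n0_pos: "n0 \<ge> 1" using n n0_even n0_odd by (cases "even n") auto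
  have n1: "n \<ge> 1" using n by simp
  show ?thesis (is "?A \<and> ?B \<and> ?C")
  proof (intro conjI)
    show ?A using Z_poly_degree[OF n1] by blast
    show ?B using Y_poly_degree[OF n1] by blast
    show ?C
    proof (rule allI, rule impI)
      fix p
      assume "prime p \<and> p \<noteq> 2 \<and> p > n - 2 \<and> CHAR('k) = p \<and> perfect_field TYPE('k)"
      then have p12: "prime p" "CHAR('k) = p" and p2: "p \<noteq> 2" and pn: "p > n - 2" by blast+
      have "odd p" using p12(1) p2 primes_dvd_imp_eq two_is_prime_nat by blast
      note p = p12 this
      have n2: "n \<ge> 2" using n by simp
      define f where "f = hk_density TYPE('k) n"
      define F where "F x = lim (\<lambda>s. hk_approx TYPE('k) n (p ^ s) x)" for x
      define \<delta> where "\<delta> = (real n - 2) / (2 * real p)"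
      define \<epsilon> where "\<epsilon> = (real n + 2) / (2 * real p)"
      have fF: "f x = F x" if "x \<ge> 0" for x
        unfolding f_def F_def hk_density_def p(2) hk_function_eq_approx[OF p(1,2) that] ..
      note \<delta> = delta_bounds[OF p n pn \<delta>_def \<epsilon>_def]
      note \<epsilon> = epsilon_bounds[OF p n pn \<delta>_def \<epsilon>_def]
      note FZ = density_Z[OF p n pn \<delta>_def \<epsilon>_def, where T = "TYPE('k)", folded F_def]
      note FgeZ = density_ge_Z[OF p n pn \<delta>_def \<epsilon>_def, where T = "TYPE('k)", folded F_def]
      note FY = density_Y[OF p n pn \<delta>_def \<epsilon>_def, where T = "TYPE('k)", folded F_def]
      note FgeY = density_ge_Y[OF p n pn \<delta>_def \<epsilon>_def, where T = "TYPE('k)", folded F_def]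
      note Fsym = density_symmetric[OF p n pn \<delta>_def \<epsilon>_def, where T = "TYPE('k)", folded F_def]
      note F0 = hk_limit_eq_0[OF p n2, where T = "TYPE('k)", folded F_def]
      note Fcont = hk_limit_continuous[OF p n2, where T = "TYPE('k)", folded F_def]
      (* The three indices are distinct because n0 >= 1. *)
      define \<mu> :: "nat \<Rightarrow> real \<Rightarrow> real" where "\<mu> j = (if j = n0 - 1 then (\<lambda>t. max 0 (F (real n0 + 1 + t) - Z n (n0 + 1) (real n0 + 1 + t)))
        else if j = n0 then (\<lambda>t. max 0 (F (real n0 + 1 + t) - Y n (n0 + 1) (real n0 + 1 + t)))
        else (\<lambda>t. max 0 (F (real n0 + 2 + t) - Y n (n0 + 2) (real n0 + 2 + t))))" for j
      have cY: "continuous_on A (Y n i)" for A i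
        unfolding Y_def by (intro continuous_intros)
      have \<mu>_props: "continuous_on {0..<1} (\<mu> j) \<and> bounded (\<mu> j ` {0..<1}) \<and> (\<forall>t\<in>{0..<1}. 0 \<le> \<mu> j t)" for j
        using positive_part_properties[of "\<lambda>x. F x - Z n (n0 + 1) x" "real n0 + 1"]
          positive_part_properties[of "\<lambda>x. F x - Y n (n0 + 1) x" "real n0 + 1"]
          positive_part_properties[of "\<lambda>x. F x - Y n (n0 + 2) x" "real n0 + 2"]
          continuous_on_diff[OF Fcont Z_continuous] continuous_on_diff[OF Fcont cY]
        unfolding \<mu>_def by (simp only: split: if_split) simp
      have \<mu>1: "F x = Z n (n0 + 1) x + \<mu> (n0 - 1) (x - real n0 - 1)" if "Z n (n0 + 1) x \<le> F x" for x
      proof -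
        have "real n0 + 1 + (x - real n0 - 1) = x" by simp
        then show ?thesis using that by (simp add: \<mu>_def)
      qed
      have \<mu>2: "F x = Y n (n0 + 1) x + \<mu> n0 (x - real n0 - 1)" if "Y n (n0 + 1) x \<le> F x" for x
      proof -
        have "real n0 + 1 + (x - real n0 - 1) = x" by simp
        then show ?thesis using that n0_pos unfolding \<mu>_def by (cases n0) simp_all
      qed
      have \<mu>3: "F x = Y n (n0 + 2) x + \<mu> (n0 + 1) (x - real n0 - 2)" if "Y n (n0 + 2) x \<le> F x" for x
      proof -
        have "real n0 + 2 + (x - real n0 - 2) = x" by simp
        then show ?thesis using that n0_pos unfolding \<mu>_def by (cases n0) simp_all
      qed
      have conv: "\<forall>x\<ge>0. convergent (\<lambda>s. hk_function TYPE('k) n (p ^ s) x)"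
        using hk_approx_convergent[OF p n2, where T = "TYPE('k)"] hk_function_eq_approx[OF p(1,2)] by simp
      have even: "(\<forall>i\<le>n0. \<forall>x. real i \<le> x \<and> x < real i + 1 \<longrightarrow> f x = Z n i x) \<and>
             (\<forall>x. real n0 + 1 \<le> x \<and> x < (real n0 + 2) - \<delta> \<longrightarrow> f x = Z n (n0 + 1) x) \<and>
             (\<forall>x. 1 - \<delta> \<le> x - (real n0 + 1) \<and> x - (real n0 + 1) < 1 \<longrightarrow>
                f x = Z n (n0 + 1) x + \<mu> (n0 - 1) (x - real n0 - 1)) \<and>
             (\<forall>x. 0 \<le> x - (real n0 + 2) \<and> x - (real n0 + 2) < \<delta> \<longrightarrow>
                f x = Y n (n0 + 2) x + \<mu> (n0 + 1) (x - real n0 - 2)) \<and>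
             (\<forall>x. (real n0 + 2) + \<delta> \<le> x \<and> x < real n0 + 3 \<longrightarrow> f x = Y n (n0 + 2) x) \<and>
             (\<forall>i x. n0 + 3 \<le> i \<and> i < n \<and> real i \<le> x \<and> x < real i + 1 \<longrightarrow> f x = Y n i x) \<and>
             (\<forall>x\<ge>real n. f x = 0)" if "even n"
      proof -
        have nn: "n = 2 * n0 + 2" and rn: "real n = 2 * real n0 + 2" using n0_even[OF that] by simp_all
        have c: "(real n + 2) / 2 = real n0 + 2" "real n / 2 = real n0 + 1" using rn by simp_all
        note FZ = FZ[unfolded c] and FgeZ = FgeZ[unfolded c] and FY = FY[unfolded c] and FgeY = FgeY[unfolded c]
        have n0r: "real n0 \<ge> 1" using n0_pos by simp
        have r: "real (n0 + 1) = real n0 + 1" "real (n0 + 2) = real n0 + 2" by simp_all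
        show ?thesis
        proof (intro conjI allI impI; (elim conjE)?)
          fix i x assume "i \<le> n0" "real i \<le> x" "x < real i + 1"
          moreover from this have "real i \<le> real n0" "x \<ge> 0" by (simp, linarith)
          ultimately show "f x = Z n i x" unfolding fF[OF \<open>x \<ge> 0\<close>] using \<delta> by (intro FZ) linarith+
        next
          fix x assume x: "real n0 + 1 \<le> x" "x < (real n0 + 2) - \<delta>"
          then have "x \<ge> 0" by linarith
          then show "f x = Z n (n0 + 1) x" unfolding fF[OF \<open>x \<ge> 0\<close>] using x \<delta> r by (intro FZ) linarith+
        next
          fix x assume x: "1 - \<delta> \<le> x - (real n0 + 1)" "x - (real n0 + 1) < 1"
          then have "x \<ge> 0" using \<delta> by linarith
          then show "f x = Z n (n0 + 1) x + \<mu> (n0 - 1) (x - real n0 - 1)" unfolding fF[OF \<open>x \<ge> 0\<close>]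
            using x \<delta> r by (intro \<mu>1 FgeZ) linarith+
        next
          fix x assume x: "0 \<le> x - (real n0 + 2)" "x - (real n0 + 2) < \<delta>"
          then have "x \<ge> 0" by linarith
          then show "f x = Y n (n0 + 2) x + \<mu> (n0 + 1) (x - real n0 - 2)" unfolding fF[OF \<open>x \<ge> 0\<close>]
            using x \<delta> \<epsilon> r nn n0_pos by (intro \<mu>3 FgeY) linarith+
        next
          fix x assume x: "(real n0 + 2) + \<delta> \<le> x" "x < real n0 + 3"
          then have "x \<ge> 0" using \<delta> by linarith
          then show "f x = Y n (n0 + 2) x" unfolding fF[OF \<open>x \<ge> 0\<close>]
            using x \<delta> r nn n0_pos by (intro FY) linarith+
        next
          fix i x assume x: "n0 + 3 \<le> i" "i < n" "real i \<le> x" "x < real i + 1"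
          then have "real n0 + 3 \<le> real i" "x \<ge> 0" by (simp, linarith)
          then show "f x = Y n i x" unfolding fF[OF \<open>x \<ge> 0\<close>] using x \<delta> by (intro FY) linarith+
        next
          fix x assume x: "real n \<le> x"
          then have "x \<ge> 0" by linarith
          then show "f x = 0" unfolding fF[OF \<open>x \<ge> 0\<close>] using F0[OF x] by simp
        qed
      qed
      have odd: "(\<forall>i\<le>n0. \<forall>x. real i \<le> x \<and> x < real i + 1 \<longrightarrow> f x = Z n i x) \<and>
             (\<forall>x. real n0 + 1 \<le> x \<and> x < (real n0 + 3/2) - \<delta> \<longrightarrow> f x = Z n (n0 + 1) x) \<and>
             (\<forall>x. 1/2 - \<delta> \<le> x - (real n0 + 1) \<and> x - (real n0 + 1) < 1/2 + \<delta> \<longrightarrow>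
                f x = Y n (n0 + 1) x + \<mu> n0 (x - real n0 - 1)) \<and>
             (\<forall>x. (real n0 + 1) + 1/2 + \<delta> \<le> x \<and> x < real n0 + 2 \<longrightarrow> f x = Y n (n0 + 1) x) \<and>
             (\<forall>i x. n0 + 2 \<le> i \<and> i < n \<and> real i \<le> x \<and> x < real i + 1 \<longrightarrow> f x = Y n i x) \<and>
             (\<forall>x\<ge>real n. f x = 0) \<and>
             (\<forall>x. 1/2 - \<delta> \<le> x - (real n0 + 1) \<and> x - (real n0 + 1) < 1/2 \<longrightarrow>
                f x = Z n (n0 + 1) x + \<mu> (n0 - 1) (x - real n0 - 1))" if "odd n"
      proof -
        have nn: "n = 2 * n0 + 1" and rn: "real n = 2 * real n0 + 1" using n0_odd[OF that] by simp_all
        have c: "(real n + 2) / 2 = real n0 + 3 / 2" "real n / 2 = real n0 + 1 / 2" using rn by simp_all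
        note FZ = FZ[unfolded c] and FgeZ = FgeZ[unfolded c] and FY = FY[unfolded c] and FgeY = FgeY[unfolded c]
        have n0r: "real n0 \<ge> 1" using n0_pos by simp
        have r: "real (n0 + 1) = real n0 + 1" by simp
        (* For odd n parity improves p > n - 2 to p >= n, so the interval on which the correction lives
           lies within the range of the reflected lower bound. *)
        have "p \<noteq> n - 1" using that p(3) n by auto
        then have "real n \<le> real p" using pn by simp
        moreover have "\<delta> + \<epsilon> = real n / real p" unfolding \<delta>_def \<epsilon>_def by (simp flip: add_divide_distrib)
        ultimately have \<delta>\<epsilon>: "\<delta> + \<epsilon> \<le> 1" using n by simp
        show ?thesis
        proof (intro conjI allI impI; (elim conjE)?)
          fix i x assume "i \<le> n0" "real i \<le> x" "x < real i + 1"
          moreover from this have "real i \<le> real n0" "x \<ge> 0" by (simp, linarith)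
          ultimately show "f x = Z n i x" unfolding fF[OF \<open>x \<ge> 0\<close>] using \<delta> by (intro FZ) linarith+
        next
          fix x assume x: "real n0 + 1 \<le> x" "x < (real n0 + 3/2) - \<delta>"
          then have "x \<ge> 0" by linarith
          then show "f x = Z n (n0 + 1) x" unfolding fF[OF \<open>x \<ge> 0\<close>] using x \<delta> r by (intro FZ) linarith+
        next
          fix x assume x: "1/2 - \<delta> \<le> x - (real n0 + 1)" "x - (real n0 + 1) < 1/2 + \<delta>"
          then have "x \<ge> 0" using \<delta> by linarith
          then show "f x = Y n (n0 + 1) x + \<mu> n0 (x - real n0 - 1)" unfolding fF[OF \<open>x \<ge> 0\<close>]
            using x \<delta> \<delta>\<epsilon> r nn n0_pos by (intro \<mu>2 FgeY) linarith+
        next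
          fix x assume x: "(real n0 + 1) + 1/2 + \<delta> \<le> x" "x < real n0 + 2"
          then have "x \<ge> 0" using \<delta> by linarith
          then show "f x = Y n (n0 + 1) x" unfolding fF[OF \<open>x \<ge> 0\<close>]
            using x \<delta> r nn n0_pos by (intro FY) linarith+
        next
          fix i x assume x: "n0 + 2 \<le> i" "i < n" "real i \<le> x" "x < real i + 1"
          then have "real n0 + 2 \<le> real i" "x \<ge> 0" by (simp, linarith)
          then show "f x = Y n i x" unfolding fF[OF \<open>x \<ge> 0\<close>] using x \<delta> by (intro FY) linarith+
        next
          fix x assume x: "real n \<le> x"
          then have "x \<ge> 0" by linarith
          then show "f x = 0" unfolding fF[OF \<open>x \<ge> 0\<close>] using F0[OF x] by simp
        next
          fix x assume x: "1/2 - \<delta> \<le> x - (real n0 + 1)" "x - (real n0 + 1) < 1/2"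
          then have "x \<ge> 0" using \<delta> by linarith
          then show "f x = Z n (n0 + 1) x + \<mu> (n0 - 1) (x - real n0 - 1)" unfolding fF[OF \<open>x \<ge> 0\<close>]
            using x \<delta> r by (intro \<mu>1 FgeZ) linarith+
        qed
      qed
      have sym: "\<forall>x. 0 \<le> x \<and> x \<le> (real n - 2) / 2 * (1 - 1 / real p) \<longrightarrow> f x = f (real n - x)"
      proof (intro allI impI, elim conjE)
        fix x assume x: "0 \<le> x" "x \<le> (real n - 2) / 2 * (1 - 1 / real p)"
        have e: "(real n - 2) / 2 * (1 - 1 / real p) = (real n - 2) / 2 - \<delta>" unfolding \<delta>_def by (simp add: right_diff_distrib)
        have a: "x \<le> (real n - 2) / 2 - \<delta>" unfolding e[symmetric] by (rule x(2))
        have h: "(real n - 2) / 2 = real n / 2 - 1" "(real n + 2) / 2 = real n / 2 + 1" by simp_all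
        have b: "real n - x \<ge> (real n + 2) / 2 + \<delta>" unfolding h(2) using a unfolding h(1) by linarith
        have "0 \<le> (real n + 2) / 2 + \<delta>" using \<delta>(1) by simp
        then have c: "0 \<le> real n - x" using b by (rule order_trans)
        show "f x = f (real n - x)" unfolding fF[OF x(1)] fF[OF c] using Fsym[OF b] by simp
      qed
      show "(\<forall>x\<ge>0. convergent (\<lambda>s. hk_function TYPE('k) n (p ^ s) x)) \<and>
       (let f = hk_density TYPE('k) n; \<delta> = (real n - 2) / (2 * real p) in
        \<exists>\<mu> :: nat \<Rightarrow> real \<Rightarrow> real.
          (\<forall>j\<in>{n0 - 1, n0, n0 + 1}.
             continuous_on {0..<1} (\<mu> j) \<and> bounded (\<mu> j ` {0..<1}) \<and> (\<forall>t\<in>{0..<1}. 0 \<le> \<mu> j t)) \<and>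
          (even n \<longrightarrow>
             (\<forall>i\<le>n0. \<forall>x. real i \<le> x \<and> x < real i + 1 \<longrightarrow> f x = Z n i x) \<and>
             (\<forall>x. real n0 + 1 \<le> x \<and> x < (real n0 + 2) - \<delta> \<longrightarrow> f x = Z n (n0 + 1) x) \<and>
             (\<forall>x. 1 - \<delta> \<le> x - (real n0 + 1) \<and> x - (real n0 + 1) < 1 \<longrightarrow>
                f x = Z n (n0 + 1) x + \<mu> (n0 - 1) (x - real n0 - 1)) \<and>
             (\<forall>x. 0 \<le> x - (real n0 + 2) \<and> x - (real n0 + 2) < \<delta> \<longrightarrow>
                f x = Y n (n0 + 2) x + \<mu> (n0 + 1) (x - real n0 - 2)) \<and>
             (\<forall>x. (real n0 + 2) + \<delta> \<le> x \<and> x < real n0 + 3 \<longrightarrow> f x = Y n (n0 + 2) x) \<and>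
             (\<forall>i x. n0 + 3 \<le> i \<and> i < n \<and> real i \<le> x \<and> x < real i + 1 \<longrightarrow> f x = Y n i x) \<and>
             (\<forall>x\<ge>real n. f x = 0)) \<and>
          (odd n \<longrightarrow>
             (\<forall>i\<le>n0. \<forall>x. real i \<le> x \<and> x < real i + 1 \<longrightarrow> f x = Z n i x) \<and>
             (\<forall>x. real n0 + 1 \<le> x \<and> x < (real n0 + 3/2) - \<delta> \<longrightarrow> f x = Z n (n0 + 1) x) \<and>
             (\<forall>x. 1/2 - \<delta> \<le> x - (real n0 + 1) \<and> x - (real n0 + 1) < 1/2 + \<delta> \<longrightarrow>
                f x = Y n (n0 + 1) x + \<mu> n0 (x - real n0 - 1)) \<and>
             (\<forall>x. (real n0 + 1) + 1/2 + \<delta> \<le> x \<and> x < real n0 + 2 \<longrightarrow> f x = Y n (n0 + 1) x) \<and>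
             (\<forall>i x. n0 + 2 \<le> i \<and> i < n \<and> real i \<le> x \<and> x < real i + 1 \<longrightarrow> f x = Y n i x) \<and>
             (\<forall>x\<ge>real n. f x = 0) \<and>
             (\<forall>x. 1/2 - \<delta> \<le> x - (real n0 + 1) \<and> x - (real n0 + 1) < 1/2 \<longrightarrow>
                f x = Z n (n0 + 1) x + \<mu> (n0 - 1) (x - real n0 - 1))) \<and>
          (\<forall>x. 0 \<le> x \<and> x \<le> (real n - 2) / 2 * (1 - 1 / real p) \<longrightarrow> f x = f (real n - x)))"
        unfolding Let_def f_def[symmetric] \<delta>_def[symmetric]
        by (intro conjI[OF conv] exI[of _ \<mu>] conjI[OF _ conjI[OF _ conjI[OF _ sym]]] ballI \<mu>_props impI; (erule even | erule odd))
    qed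
  qed
qed

end
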